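(* Let $(\mathcal A,.)$ be a finite dimensional real commutative associative algebra. Let $\nabla^0$ be the canonical affine connection of the vector space $\mathcal A^*$ and let $h$ be the symmetric bivector field on $\mathcal A^*$ given by $$h(\alpha,\beta)(\mu)=\prec\mu,\alpha(\mu).\beta(\mu)\succ,\qquad \alpha,\beta\in\Omega^1(\mathcal A^* )=C^\infty(\mathcal A^*,\mathcal A),\ \mu\in\mathcal A^*.$$ Then $(\mathcal A^*,\nabla^0,h)$ is a generalized pseudo-Hessian manifold, and the singular foliation associated to $\mathrm{Im}\,h_\#$ is given by the orbits of the linear action $\Phi$ of the abelian Lie group $(\mathcal A,+)$ on $\mathcal A^*$ given by $\Phi(u,\mu)=\exp(L_u^* )(\mu)$, where $L_u:\mathcal A\to\mathcal A$, $L_u(v)=u.v$, and $L_u^*:\mathcal A^*\to\mathcal A^*$ is the dual map. Moreover, $(\mathcal A^*,\nabla^0,h)$ is a generalized affine special real manifold if and only if $\mathcal A^4=0$. In particular, the orbits of $\Phi$ (with the connection induced by $\nabla^0$ and the metric $g(h_\#(\alpha),h_\#(\beta))=h(\alpha,\beta)$) are pseudo-Hessian manifolds, and if $\mathcal A^4=0$ they are affine special real manifolds.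
   Context: All objects are smooth and real; the algebra need not have a unit. $\mathcal A^4=0$ means that all products $u.v.w.x$ of four elements vanish. $\prec\cdot,\cdot\succ$ is the duality pairing; $\nabla^0_XY(\mu)=d_\mu Y(X(\mu))$ for vector fields regarded as maps $X,Y:\mathcal A^*\to\mathcal A^*$. For a symmetric bivector field $h$ on $M$ (a symmetric, possibly degenerate, section of $TM\otimes TM$ viewed as a bilinear form on $T^*M$), $h_\#:T^*M\to TM$ is defined by $\beta(h_\#(\alpha))=h(\alpha,\beta)$. A generalized pseudo-Hessian manifold is a triple $(M,\nabla,h)$ where $\nabla$ is a torsion-free flat connection and $h$ is a symmetric bivector field with $(\nabla_{h_\#(\alpha)}h)(\beta,\gamma)=(\nabla_{h_\#(\beta)}h)(\alpha,\gamma)$ for all $\alpha,\beta,\gamma\in\Omega^1(M)$. For such a triple $\mathrm{Im}\,h_\#$ is integrable (in the sense of Stefan–Sussmann); its leaves $L$ satisfy $T_xL=\mathrm{Im}\,h_\#(x)$ and $\nabla_XY$ is tangent to $L$ whenever $X,Y$ are, so $\nabla$ induces a connection on each leaf. Define $\mathcal D$ on $\Omega^1(M)$ by $\prec\mathcal D_\alpha\beta,X\succ=(\nabla_Xh)(\alpha,\beta)+\prec\nabla^*_{h_\#(\alpha)}\beta,X\succ$, with $\nabla^*$ the dual connection. $(M,\nabla,h)$ is a generalized affine special real manifold if in addition the tensor $T(\alpha,\beta,\gamma)=(\nabla_{h_\#(\alpha)}h)(\beta,\gamma)$ is $\mathcal D$-parallel, i.e. $h_\#(\delta).T(\alpha,\beta,\gamma)-T(\mathcal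 D_\delta\alpha,\beta,\gamma)-T(\alpha,\mathcal D_\delta\beta,\gamma)-T(\alpha,\beta,\mathcal D_\delta\gamma)=0$ for all 1-forms. A pseudo-Hessian manifold is a triple $(L,\nabla,g)$ with $\nabla$ flat torsion-free and $g$ a pseudo-Riemannian metric such that $\nabla g$ is totally symmetric. It is an affine special real manifold if in addition $\nabla g$ is $\nabla$-parallel. *)

theory Defs
  imports "HOL-Analysis.Analysis"
begin

text \<open>Manifolds are modelled as immersed submanifolds of a finite-dimensional normed space, the
  space itself (topology \<^term>\<open>euclidean\<close>) being one of them. All finite-dimensionality assumptions
  are made in the theorem; in finite dimension \<open>'a \<Rightarrow>\<^sub>L real\<close> is the full algebraic dual.\<close>

type_synonym 'a dual = "'a \<Rightarrow>\<^sub>L real"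


section \<open>Smooth maps and immersed submanifolds\<close>

text \<open>\<open>Ck_along k E U f\<close>: \<open>f\<close> is of class \<open>C\<^sup>k\<close> on \<open>U\<close>, where \<open>U\<close> is a relatively open subset of the
  linear subspace \<open>E\<close>. Derivatives are only evaluated on vectors of \<open>E\<close>, where the
  derivative within \<open>U\<close> is unique.\<close>

primrec Ck_along :: "nat \<Rightarrow> 'm::real_normed_vector set \<Rightarrow> 'm set \<Rightarrow> ('m \<Rightarrow> 'b::real_normed_vector) \<Rightarrow> bool"
  where
    "Ck_along 0 E U f \<longleftrightarrow> continuous_on U f"
  | "Ck_along (Suc k) E U f \<longleftrightarrow>
       (\<forall>x\<in>U. f differentiable (at x within U)) \<and>
       (\<forall>v\<in>E. Ck_along k E U (\<lambda>x. frechet_derivative f (at x within U) v))"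

definition smooth_along :: "'m::real_normed_vector set \<Rightarrow> 'm set \<Rightarrow> ('m \<Rightarrow> 'b::real_normed_vector) \<Rightarrow> bool"
  where "smooth_along E U f \<longleftrightarrow> (\<forall>k. Ck_along k E U f)"

text \<open>A submanifold is given by its manifold topology \<open>\<tau>\<close> (possibly finer than the subspace topology);
  its underlying set is \<open>topspace \<tau>\<close>. A local parametrization of \<open>\<tau>\<close> is a smooth immersion \<open>f\<close>, defined
  on a relatively open subset \<open>U\<close> of a subspace \<open>E\<close>, which is a homeomorphism onto a \<open>\<tau>\<close>-open set.
  The smooth structure of an immersed submanifold is determined by its topology, so the changes of
  parametrization are automatically smooth and no atlas has to be recorded.\<close>

definition parametrization ::
  "'v::real_normed_vector topology \<Rightarrow> 'v set \<Rightarrow> 'v set \<Rightarrow> ('v \<Rightarrow> 'v) \<Rightarrow> bool"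
  where "parametrization \<tau> E U f \<longleftrightarrow>
    subspace E \<and> openin (top_of_set E) U \<and> smooth_along E U f \<and>
    (\<forall>u\<in>U. \<forall>v\<in>E. frechet_derivative f (at u within U) v = 0 \<longrightarrow> v = 0) \<and>
    openin \<tau> (f ` U) \<and> homeomorphic_map (top_of_set U) (subtopology \<tau> (f ` U)) f"

definition immersed_submanifold :: "'v::real_normed_vector topology \<Rightarrow> bool"
  where "immersed_submanifold \<tau> \<longleftrightarrow>
    Hausdorff_space \<tau> \<and> second_countable \<tau> \<and>
    (\<forall>x\<in>topspace \<tau>. \<exists>E U f. parametrization \<tau> E U f \<and> x \<in> f ` U)"

definition tangent :: "'v::real_normed_vector topology \<Rightarrow> 'v \<Rightarrow> 'v set"
  where "tangent \<tau> x =
    {frechet_derivative f (at u within U) v | E U f u v.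
       parametrization \<tau> E U f \<and> u \<in> U \<and> f u = x \<and> v \<in> E}"

definition smooth_map :: "'v::real_normed_vector topology \<Rightarrow> ('v \<Rightarrow> 'b::real_normed_vector) \<Rightarrow> bool"
  where "smooth_map \<tau> F \<longleftrightarrow> (\<forall>E U f. parametrization \<tau> E U f \<longrightarrow> smooth_along E U (F \<circ> f))"

definition vector_field :: "'v::real_normed_vector topology \<Rightarrow> ('v \<Rightarrow> 'v) \<Rightarrow> bool"
  where "vector_field \<tau> X \<longleftrightarrow> smooth_map \<tau> X \<and> (\<forall>x\<in>topspace \<tau>. X x \<in> tangent \<tau> x)"

text \<open>\<open>dir \<tau> X F\<close> is the derivative of \<open>F\<close> along the vector field \<open>X\<close> of the submanifold \<open>\<tau>\<close>. It involves
  only values of \<open>F\<close> on \<open>topspace \<tau>\<close>; the derivative along the filter \<open>atin \<tau> x\<close> is uniquely determined on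
  tangent vectors. For \<open>\<tau> = euclidean\<close> the filter is \<open>at x\<close>, and for \<open>\<tau> = top_of_set S\<close> it is
  \<open>at x within S\<close> (when \<open>x \<in> S\<close>).\<close>

definition dir :: "'v::real_normed_vector topology \<Rightarrow> ('v \<Rightarrow> 'v) \<Rightarrow> ('v \<Rightarrow> 'b::real_normed_vector) \<Rightarrow> 'v \<Rightarrow> 'b"
  where "dir \<tau> X F x = frechet_derivative F (atin \<tau> x) (X x)"

definition lie_bracket :: "'v::real_normed_vector topology \<Rightarrow> ('v \<Rightarrow> 'v) \<Rightarrow> ('v \<Rightarrow> 'v) \<Rightarrow> 'v \<Rightarrow> 'v"
  where "lie_bracket \<tau> X Y x = dir \<tau> X Y x - dir \<tau> Y X x"


section \<open>Affine connections\<close>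

type_synonym 'v connection = "('v \<Rightarrow> 'v) \<Rightarrow> ('v \<Rightarrow> 'v) \<Rightarrow> 'v \<Rightarrow> 'v"

definition affine_connection :: "'v::real_normed_vector topology \<Rightarrow> 'v connection \<Rightarrow> bool"
  where "affine_connection \<tau> nabla \<longleftrightarrow>
    (\<forall>X Y. vector_field \<tau> X \<longrightarrow> vector_field \<tau> Y \<longrightarrow> vector_field \<tau> (nabla X Y)) \<and>
    (\<forall>X X' Y. vector_field \<tau> X \<longrightarrow> vector_field \<tau> X' \<longrightarrow> vector_field \<tau> Y \<longrightarrow>
       (\<forall>x\<in>topspace \<tau>. nabla (\<lambda>y. X y + X' y) Y x = nabla X Y x + nabla X' Y x)) \<and>
    (\<forall>\<phi> X Y. smooth_map \<tau> (\<phi> :: 'v \<Rightarrow> real) \<longrightarrow> vector_field \<tau> X \<longrightarrow> vector_field \<tau> Y \<longrightarrow>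
       (\<forall>x\<in>topspace \<tau>. nabla (\<lambda>y. \<phi> y *\<^sub>R X y) Y x = \<phi> x *\<^sub>R nabla X Y x)) \<and>
    (\<forall>X Y Y'. vector_field \<tau> X \<longrightarrow> vector_field \<tau> Y \<longrightarrow> vector_field \<tau> Y' \<longrightarrow>
       (\<forall>x\<in>topspace \<tau>. nabla X (\<lambda>y. Y y + Y' y) x = nabla X Y x + nabla X Y' x)) \<and>
    (\<forall>\<phi> X Y. smooth_map \<tau> (\<phi> :: 'v \<Rightarrow> real) \<longrightarrow> vector_field \<tau> X \<longrightarrow> vector_field \<tau> Y \<longrightarrow>
       (\<forall>x\<in>topspace \<tau>. nabla X (\<lambda>y. \<phi> y *\<^sub>R Y y) x = dir \<tau> X \<phi> x *\<^sub>R Y x + \<phi> x *\<^sub>R nabla X Y x))"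

definition torsion_free :: "'v::real_normed_vector topology \<Rightarrow> 'v connection \<Rightarrow> bool"
  where "torsion_free \<tau> nabla \<longleftrightarrow>
    (\<forall>X Y. vector_field \<tau> X \<longrightarrow> vector_field \<tau> Y \<longrightarrow>
       (\<forall>x\<in>topspace \<tau>. nabla X Y x - nabla Y X x = lie_bracket \<tau> X Y x))"

definition flat :: "'v::real_normed_vector topology \<Rightarrow> 'v connection \<Rightarrow> bool"
  where "flat \<tau> nabla \<longleftrightarrow>
    (\<forall>X Y Z. vector_field \<tau> X \<longrightarrow> vector_field \<tau> Y \<longrightarrow> vector_field \<tau> Z \<longrightarrow>
       (\<forall>x\<in>topspace \<tau>.
          nabla X (nabla Y Z) x - nabla Y (nabla X Z) x - nabla (lie_bracket \<tau> X Y) Z x = 0))"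


section \<open>Pseudo-Hessian and affine special real manifolds\<close>

definition pseudo_riemannian_metric ::
  "'v::real_normed_vector topology \<Rightarrow> ('v \<Rightarrow> 'v \<Rightarrow> 'v \<Rightarrow> real) \<Rightarrow> bool"
  where "pseudo_riemannian_metric \<tau> g \<longleftrightarrow>
    (\<forall>x\<in>topspace \<tau>. \<forall>u\<in>tangent \<tau> x. \<forall>v\<in>tangent \<tau> x.
       g x u v = g x v u \<and>
       (\<forall>w\<in>tangent \<tau> x. g x (u + v) w = g x u w + g x v w) \<and>
       (\<forall>c. g x (c *\<^sub>R u) v = c * g x u v)) \<and>
    (\<forall>x\<in>topspace \<tau>. \<forall>u\<in>tangent \<tau> x. (\<forall>v\<in>tangent \<tau> x. g x u v = 0) \<longrightarrow> u = 0) \<and>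
    (\<forall>X Y. vector_field \<tau> X \<longrightarrow> vector_field \<tau> Y \<longrightarrow> smooth_map \<tau> (\<lambda>x. g x (X x) (Y x)))"

definition cov_metric ::
  "'v::real_normed_vector topology \<Rightarrow> 'v connection \<Rightarrow> ('v \<Rightarrow> 'v \<Rightarrow> 'v \<Rightarrow> real) \<Rightarrow>
   ('v \<Rightarrow> 'v) \<Rightarrow> ('v \<Rightarrow> 'v) \<Rightarrow> ('v \<Rightarrow> 'v) \<Rightarrow> 'v \<Rightarrow> real"
  where "cov_metric \<tau> nabla g X Y Z x =
    dir \<tau> X (\<lambda>y. g y (Y y) (Z y)) x - g x (nabla X Y x) (Z x) - g x (Y x) (nabla X Z x)"

definition pseudo_Hessian_manifold ::
  "'v::real_normed_vector topology \<Rightarrow> 'v connection \<Rightarrow> ('v \<Rightarrow> 'v \<Rightarrow> 'v \<Rightarrow> real) \<Rightarrow> bool"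
  where "pseudo_Hessian_manifold \<tau> nabla g \<longleftrightarrow>
    immersed_submanifold \<tau> \<and> affine_connection \<tau> nabla \<and> torsion_free \<tau> nabla \<and> flat \<tau> nabla \<and>
    pseudo_riemannian_metric \<tau> g \<and>
    (\<forall>X Y Z. vector_field \<tau> X \<longrightarrow> vector_field \<tau> Y \<longrightarrow> vector_field \<tau> Z \<longrightarrow>
       (\<forall>x\<in>topspace \<tau>.
          cov_metric \<tau> nabla g X Y Z x = cov_metric \<tau> nabla g Y X Z x \<and>
          cov_metric \<tau> nabla g X Y Z x = cov_metric \<tau> nabla g X Z Y x))"

definition affine_special_real_manifold ::
  "'v::real_normed_vector topology \<Rightarrow> 'v connection \<Rightarrow> ('v \<Rightarrow> 'v \<Rightarrow> 'v \<Rightarrow> real) \<Rightarrow> bool"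
  where "affine_special_real_manifold \<tau> nabla g \<longleftrightarrow>
    pseudo_Hessian_manifold \<tau> nabla g \<and>
    (\<forall>W X Y Z. vector_field \<tau> W \<longrightarrow> vector_field \<tau> X \<longrightarrow> vector_field \<tau> Y \<longrightarrow> vector_field \<tau> Z \<longrightarrow>
       (\<forall>x\<in>topspace \<tau>.
          dir \<tau> W (cov_metric \<tau> nabla g X Y Z) x
          - cov_metric \<tau> nabla g (nabla W X) Y Z x
          - cov_metric \<tau> nabla g X (nabla W Y) Z x
          - cov_metric \<tau> nabla g X Y (nabla W Z) x = 0))"


section \<open>Leaves\<close>

text \<open>Leaves of a singular distribution in the sense of Stefan--Sussmann: maximal integral manifolds.
  They are recorded with their manifold topology.\<close>

definition integral_manifold ::
  "('v::real_normed_vector \<Rightarrow> 'v set) \<Rightarrow> 'v topology \<Rightarrow> bool"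
  where "integral_manifold D \<tau> \<longleftrightarrow>
    immersed_submanifold \<tau> \<and> connected_space \<tau> \<and> topspace \<tau> \<noteq> {} \<and>
    (\<forall>x\<in>topspace \<tau>. tangent \<tau> x = D x)"

definition leaf :: "('v::real_normed_vector \<Rightarrow> 'v set) \<Rightarrow> 'v topology \<Rightarrow> bool"
  where "leaf D \<tau> \<longleftrightarrow>
    integral_manifold D \<tau> \<and>
    (\<forall>\<sigma>. integral_manifold D \<sigma> \<and> topspace \<sigma> \<inter> topspace \<tau> \<noteq> {} \<longrightarrow>
       openin \<tau> (topspace \<sigma>) \<and> \<sigma> = subtopology \<tau> (topspace \<sigma>))"

text \<open>\<open>nablaL\<close> is the connection induced on the submanifold \<open>\<tau>\<close> by the connection \<open>nabla\<close> of the ambient space.\<close>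

definition induced_connection ::
  "'v::real_normed_vector connection \<Rightarrow> 'v topology \<Rightarrow> 'v connection \<Rightarrow> bool"
  where "induced_connection nabla \<tau> nablaL \<longleftrightarrow>
    affine_connection \<tau> nablaL \<and>
    (\<forall>X Y. vector_field euclidean X \<longrightarrow> vector_field euclidean Y \<longrightarrow>
       (\<forall>x\<in>topspace \<tau>. X x \<in> tangent \<tau> x \<and> Y x \<in> tangent \<tau> x) \<longrightarrow>
       (\<forall>x\<in>topspace \<tau>. nablaL X Y x = nabla X Y x))"


section \<open>Generalized pseudo-Hessian manifolds\<close>

text \<open>The manifold is the dual \<open>'a dual\<close> of a finite-dimensional space; its cotangent spaces
  are identified with \<open>'a\<close>, so 1-forms are smooth maps \<open>'a dual \<Rightarrow> 'a\<close> and the pairing of a vector field \<open>X\<close>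
  with a 1-form \<open>\<alpha>\<close> is \<open>\<lambda>\<mu>. blinfun_apply (X \<mu>) (\<alpha> \<mu>)\<close>. A bivector field \<open>h\<close> assigns to each \<open>\<mu>\<close> a
  bilinear form on \<open>'a\<close>.\<close>

definition one_form :: "('a::real_normed_vector dual \<Rightarrow> 'a) \<Rightarrow> bool"
  where "one_form \<alpha> \<longleftrightarrow> smooth_map euclidean \<alpha>"

type_synonym 'a bivector = "'a dual \<Rightarrow> 'a \<Rightarrow> 'a \<Rightarrow> real"

definition symmetric_bivector_field :: "'a::real_normed_vector bivector \<Rightarrow> bool"
  where "symmetric_bivector_field h \<longleftrightarrow>
    (\<forall>\<mu>. bilinear (h \<mu>) \<and> (\<forall>u v. h \<mu> u v = h \<mu> v u)) \<and>
    (\<forall>\<alpha> \<beta>. one_form \<alpha> \<longrightarrow> one_form \<beta> \<longrightarrow> smooth_map euclidean (\<lambda>\<mu>. h \<mu> (\<alpha> \<mu>) (\<beta> \<mu>)))"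

definition sharp :: "'a::real_normed_vector bivector \<Rightarrow> 'a dual \<Rightarrow> 'a \<Rightarrow> 'a dual"
  where "sharp h \<mu> u = Blinfun (h \<mu> u)"

definition sharp_field ::
  "'a::real_normed_vector bivector \<Rightarrow> ('a dual \<Rightarrow> 'a) \<Rightarrow> 'a dual \<Rightarrow> 'a dual"
  where "sharp_field h \<alpha> = (\<lambda>\<mu>. sharp h \<mu> (\<alpha> \<mu>))"

definition image_distribution :: "'a::real_normed_vector bivector \<Rightarrow> 'a dual \<Rightarrow> 'a dual set"
  where "image_distribution h \<mu> = range (sharp h \<mu>)"

definition dual_connection ::
  "'a::real_normed_vector dual connection \<Rightarrow> ('a dual \<Rightarrow> 'a dual) \<Rightarrow> ('a dual \<Rightarrow> 'a) \<Rightarrow> 'a dual \<Rightarrow> 'a"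
  where "dual_connection nabla X \<alpha> \<mu> =
    (THE u. \<forall>Y. vector_field euclidean Y \<longrightarrow>
       blinfun_apply (Y \<mu>) u =
         dir euclidean X (\<lambda>\<nu>. blinfun_apply (Y \<nu>) (\<alpha> \<nu>)) \<mu> - blinfun_apply (nabla X Y \<mu>) (\<alpha> \<mu>))"

definition cov_bivector ::
  "'a::real_normed_vector dual connection \<Rightarrow> 'a bivector \<Rightarrow>
   ('a dual \<Rightarrow> 'a dual) \<Rightarrow> ('a dual \<Rightarrow> 'a) \<Rightarrow> ('a dual \<Rightarrow> 'a) \<Rightarrow> 'a dual \<Rightarrow> real"
  where "cov_bivector nabla h X \<alpha> \<beta> \<mu> =
    dir euclidean X (\<lambda>\<nu>. h \<nu> (\<alpha> \<nu>) (\<beta> \<nu>)) \<mu>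
    - h \<mu> (dual_connection nabla X \<alpha> \<mu>) (\<beta> \<mu>) - h \<mu> (\<alpha> \<mu>) (dual_connection nabla X \<beta> \<mu>)"

definition generalized_pseudo_Hessian ::
  "'a::real_normed_vector dual connection \<Rightarrow> 'a bivector \<Rightarrow> bool"
  where "generalized_pseudo_Hessian nabla h \<longleftrightarrow>
    affine_connection euclidean nabla \<and> torsion_free euclidean nabla \<and> flat euclidean nabla \<and>
    symmetric_bivector_field h \<and>
    (\<forall>\<alpha> \<beta> \<gamma>. one_form \<alpha> \<longrightarrow> one_form \<beta> \<longrightarrow> one_form \<gamma> \<longrightarrow>
       (\<forall>\<mu>. cov_bivector nabla h (sharp_field h \<alpha>) \<beta> \<gamma> \<mu> = cov_bivector nabla h (sharp_field h \<beta>) \<alpha> \<gamma> \<mu>))"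

definition form_connection ::
  "'a::real_normed_vector dual connection \<Rightarrow> 'a bivector \<Rightarrow> ('a dual \<Rightarrow> 'a) \<Rightarrow> ('a dual \<Rightarrow> 'a) \<Rightarrow> 'a dual \<Rightarrow> 'a"
  where "form_connection nabla h \<alpha> \<beta> \<mu> =
    (THE u. \<forall>X. vector_field euclidean X \<longrightarrow>
       blinfun_apply (X \<mu>) u =
         cov_bivector nabla h X \<alpha> \<beta> \<mu> + blinfun_apply (X \<mu>) (dual_connection nabla (sharp_field h \<alpha>) \<beta> \<mu>))"

definition generalized_affine_special_real ::
  "'a::real_normed_vector dual connection \<Rightarrow> 'a bivector \<Rightarrow> bool"
  where "generalized_affine_special_real nabla h \<longleftrightarrow>
    generalized_pseudo_Hessian nabla h \<and>
    (let T = (\<lambda>\<alpha> \<beta> \<gamma>. cov_bivector nabla h (sharp_field h \<alpha>) \<beta> \<gamma>); D = form_connection nabla h in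
      \<forall>\<alpha> \<beta> \<gamma> \<delta>. one_form \<alpha> \<longrightarrow> one_form \<beta> \<longrightarrow> one_form \<gamma> \<longrightarrow> one_form \<delta> \<longrightarrow>
        (\<forall>\<mu>. dir euclidean (sharp_field h \<delta>) (T \<alpha> \<beta> \<gamma>) \<mu>
             - T (D \<delta> \<alpha>) \<beta> \<gamma> \<mu> - T \<alpha> (D \<delta> \<beta>) \<gamma> \<mu> - T \<alpha> \<beta> (D \<delta> \<gamma>) \<mu> = 0))"

text \<open>The form \<open>g (h\<^sub># u) (h\<^sub># v) = h u v\<close> on the image of \<open>h\<^sub>#\<close>; it does not depend on the choice of
  \<open>u\<close> and \<open>v\<close> when \<open>h \<mu>\<close> is symmetric.\<close>

definition leaf_metric :: "'a::real_normed_vector bivector \<Rightarrow> 'a dual \<Rightarrow> 'a dual \<Rightarrow> 'a dual \<Rightarrow> real"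
  where "leaf_metric h \<mu> x y = (THE r. \<exists>u v. sharp h \<mu> u = x \<and> sharp h \<mu> v = y \<and> r = h \<mu> u v)"


section \<open>The structure on the dual of a commutative associative algebra\<close>

definition nabla0 :: "'v::real_normed_vector connection"
  where "nabla0 X Y \<mu> = frechet_derivative Y (at \<mu>) (X \<mu>)"

text \<open>On a submanifold, \<open>nabla0\<close> induces (where it is tangent) the derivative of \<open>Y\<close> along \<open>X\<close>, which only
  needs \<open>Y\<close> on the submanifold.\<close>

definition nabla0_on :: "'v::real_normed_vector topology \<Rightarrow> 'v connection"
  where "nabla0_on \<tau> X Y = dir \<tau> X Y"

text \<open>The sort \<open>{real_normed_vector, real_algebra, comm_ring}\<close> is that of commutative associative real
  algebras, not necessarily unital, with a norm that need not be submultiplicative; in finite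
  dimension the norm only serves to provide the canonical topology.\<close>

definition alg_bivector :: "'a::{real_normed_vector, real_algebra, comm_ring} bivector"
  where "alg_bivector \<mu> u v = blinfun_apply \<mu> (u * v)"

definition L_dual :: "'a::{real_normed_vector, real_algebra, comm_ring} \<Rightarrow> 'a dual \<Rightarrow> 'a dual"
  where "L_dual u \<mu> = Blinfun (\<lambda>v. blinfun_apply \<mu> (u * v))"

definition exp_endo :: "('v::real_normed_vector \<Rightarrow> 'v) \<Rightarrow> 'v \<Rightarrow> 'v"
  where "exp_endo A x = (\<Sum>n. (A ^^ n) x /\<^sub>R fact n)"

definition Phi :: "'a::{real_normed_vector, real_algebra, comm_ring} \<Rightarrow> 'a dual \<Rightarrow> 'a dual"
  where "Phi u \<mu> = exp_endo (L_dual u) \<mu>"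

definition smooth_linear_action ::
  "('a::real_normed_vector \<Rightarrow> 'v::real_normed_vector \<Rightarrow> 'v) \<Rightarrow> bool"
  where "smooth_linear_action \<Psi> \<longleftrightarrow>
    (\<forall>\<mu>. \<Psi> 0 \<mu> = \<mu>) \<and> (\<forall>u v \<mu>. \<Psi> (u + v) \<mu> = \<Psi> u (\<Psi> v \<mu>)) \<and> (\<forall>u. linear (\<Psi> u)) \<and>
    smooth_along UNIV UNIV (\<lambda>p. \<Psi> (fst p) (snd p))"

definition orbit :: "('a \<Rightarrow> 'v \<Rightarrow> 'v) \<Rightarrow> 'v \<Rightarrow> 'v set"
  where "orbit \<Psi> \<mu> = range (\<lambda>u. \<Psi> u \<mu>)"

text \<open>The manifold topology of an orbit: the quotient topology of the group by the stabilizer, i.e.\ the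
  final topology with respect to the orbit map.\<close>

definition orbit_topology :: "('a::topological_space \<Rightarrow> 'v \<Rightarrow> 'v) \<Rightarrow> 'v \<Rightarrow> 'v topology"
  where "orbit_topology \<Psi> \<mu> = topology (\<lambda>S. S \<subseteq> orbit \<Psi> \<mu> \<and> open {u. \<Psi> u \<mu> \<in> S})"

end

theory Submission
  imports Defs
begin

text \<open>Write \<open>L u\<close> for \<open>L_dual u\<close> and \<open>\<phi> u = Phi u \<mu>\<close> for the orbit map. Since the algebra is commutative,
  all \<open>L u\<close> commute, \<open>Phi\<close> is an action, and its derivative in the direction \<open>(v, \<nu>)\<close> at \<open>(u, \<mu>)\<close> is
  \<open>Phi u (\<nu> + L v \<mu>)\<close>; this formula reproduces itself and gives smoothness.
  On the whole dual, \<open>\<nabla>\<^sub>X h (\<alpha>, \<beta>) = X (\<alpha> \<beta>)\<close>, so \<open>T (\<alpha>, \<beta>, \<gamma>) = \<mu> (\<alpha> \<beta> \<gamma>)\<close>, and the \<open>\<D>\<close>-derivative of \<open>T\<close> is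
  \<open>- 2 \<mu> (\<alpha> \<beta> \<gamma> \<delta>)\<close>.

  On an orbit everything is pulled back along \<open>\<phi>\<close>: a vector field \<open>X\<close> becomes a map \<open>\<xi>\<close> from the algebra to
  itself with \<open>X (\<phi> u) = L (\<xi> u) (\<phi> u)\<close>, the induced connection becomes \<open>D + \<close> multiplication, the metric becomes
  \<open>\<phi> u (\<xi> \<eta>)\<close> and its covariant derivative \<open>- \<phi> u (\<xi> \<eta> \<zeta>)\<close>, whose own covariant derivative is
  \<open>2 \<phi> u (\<xi> \<eta> \<zeta> \<theta>)\<close>.\<close>

section \<open>Finite-dimensional normed spaces\<close>

text \<open>The type class supplies no Euclidean structure and no submultiplicative norm, so
  boundedness of linear maps, closedness of subspaces and estimates for the product all rest on
  coordinates in a finite basis. The hardest claim is that no other leaves exist: an integral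
  manifold carries a topology of its own, and its parametrizations are smooth only as maps into the
  ambient space. Factoring such a map through a chart first gives a merely continuous map, which is
  differentiated afterwards by \<open>left_inverse_has_derivative\<close>. Strict differentiability
  does the work of the inverse function theorem: it yields injectivity at once and surjectivity by a
  contraction. A second obstacle is that a tangent vector \<open>L_dual u y\<close> determines
  \<open>u\<close> only up to elements annihilating \<open>y\<close>. Charts and coordinates of
  vector fields therefore use a fixed linear lift, and formulas are stated so that any other
  coefficient of the same tangent vector can be inserted.\<close>

definition fin_dim :: "'a::real_normed_vector set \<Rightarrow> bool"
  where "fin_dim S \<longleftrightarrow> (\<exists>B. finite B \<and> S \<subseteq> span B)"

text \<open>If coordinates depend boundedly on the vector, those of a convergent sequence are
  Cauchy, so they converge and the limit stays in the span. The induction in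
  \<open>coordinates_bounded\<close> needs this closedness for the smaller basis.\<close>

lemma closed_span_if_coordinates_bounded:
  fixes B :: "'a::real_normed_vector set"
  assumes B: "finite B" "independent B"
    and C: "\<And>c. (\<Sum>b\<in>B. \<bar>c b\<bar>) \<le> C * norm (\<Sum>b\<in>B. c b *\<^sub>R b)"
  shows "closed (span B)"
  unfolding closed_sequential_limits
proof (intro allI impI)
  fix X x assume X: "(\<forall>n. X n \<in> span B) \<and> X \<longlonglongrightarrow> x"
  then have "\<forall>n. \<exists>c. X n = (\<Sum>b\<in>B. c b *\<^sub>R b)"
    using B(1) by (auto simp: span_finite)
  then obtain c where c: "\<And>n. X n = (\<Sum>b\<in>B. c n b *\<^sub>R b)"
    by metis
  have le: "\<bar>c m b - c n b\<bar> \<le> \<bar>C\<bar> * norm (X m - X n)" if "b \<in> B" for b m n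
  proof -
    have "\<bar>c m b - c n b\<bar> \<le> (\<Sum>b\<in>B. \<bar>c m b - c n b\<bar>)"
      using that B(1) by (intro member_le_sum) auto
    also have "\<dots> \<le> C * norm (\<Sum>b\<in>B. (c m b - c n b) *\<^sub>R b)"
      by (rule C)
    also have "\<dots> = C * norm (X m - X n)"
      by (simp add: c scaleR_diff_left sum_subtractf)
    also have "\<dots> \<le> \<bar>C\<bar> * norm (X m - X n)"
      by (intro mult_right_mono) auto
    finally show ?thesis .
  qed
  have "Cauchy X"
    using X LIMSEQ_imp_Cauchy by blast
  have "convergent (\<lambda>n. c n b)" if b: "b \<in> B" for b
    unfolding Cauchy_convergent_iff[symmetric]
  proof (rule metric_CauchyI)
    fix e :: real assume "e > 0"
    then have "e / (\<bar>C\<bar> + 1) > 0" by simp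
    from metric_CauchyD[OF \<open>Cauchy X\<close> this]
    obtain M where M: "\<And>m n. m \<ge> M \<Longrightarrow> n \<ge> M \<Longrightarrow> dist (X m) (X n) < e / (\<bar>C\<bar> + 1)" by blast
    have "dist (c m b) (c n b) < e" if "m \<ge> M" "n \<ge> M" for m n
    proof -
      have "dist (c m b) (c n b) \<le> \<bar>C\<bar> * dist (X m) (X n)"
        using le[OF b, of m n] by (simp add: dist_norm)
      also have "\<dots> \<le> (\<bar>C\<bar> + 1) * dist (X m) (X n)"
        by (simp add: distrib_right)
      also have "\<dots> < e"
        using M[OF that] by (simp add: field_simps)
      finally show ?thesis .
    qed
    then show "\<exists>M. \<forall>m\<ge>M. \<forall>n\<ge>M. dist (c m b) (c n b) < e" by blast
  qed
  then obtain l where l: "\<And>b. b \<in> B \<Longrightarrow> (\<lambda>n. c n b) \<longlonglongrightarrow> l b"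
    unfolding convergent_def by metis
  have "X \<longlonglongrightarrow> (\<Sum>b\<in>B. l b *\<^sub>R b)"
    unfolding c[abs_def] by (intro tendsto_sum tendsto_scaleR l tendsto_const)
  then have "x = (\<Sum>b\<in>B. l b *\<^sub>R b)"
    using X LIMSEQ_unique by blast
  then show "x \<in> span B"
    by (auto intro: span_sum span_scale span_base)
qed

text \<open>Induction on the basis. The span of the old vectors is closed, so the new vector
  \<open>a\<close> has positive distance from it; this distance controls the coefficient of
  \<open>a\<close>, and the rest falls under the induction hypothesis.\<close>

lemma coordinates_bounded:
  fixes B :: "'a::real_normed_vector set"
  assumes "finite B" "independent B"
  shows "\<exists>C\<ge>0. \<forall>c. (\<Sum>b\<in>B. \<bar>c b\<bar>) \<le> C * norm (\<Sum>b\<in>B. c b *\<^sub>R b)"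
  using assms
proof (induction B rule: finite_induct)
  case (insert a B)
  then have ind: "independent B" and a: "a \<notin> span B"
    by (auto simp: independent_insert)
  from insert.IH[OF ind] obtain C where C: "C \<ge> 0"
    "\<And>c. (\<Sum>b\<in>B. \<bar>c b\<bar>) \<le> C * norm (\<Sum>b\<in>B. c b *\<^sub>R b)" by blast
  define d where "d = infdist a (span B)"
  have "closed (span B)"
    using closed_span_if_coordinates_bounded[OF \<open>finite B\<close> ind C(2)] .
  then have d: "d > 0"
    using a in_closed_iff_infdist_zero[of "span B" a] infdist_nonneg[of a "span B"] span_zero[of B]
    unfolding d_def by fastforce
  have lower: "\<bar>t\<bar> * d \<le> norm (t *\<^sub>R a + s)" if "s \<in> span B" for t s
  proof (cases "t = 0")
    case False
    have "- ((1/t) *\<^sub>R s) \<in> span B" using that by (intro span_neg span_scale)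
    then have "d \<le> dist a (- ((1/t) *\<^sub>R s))"
      unfolding d_def by (rule infdist_le)
    then have "\<bar>t\<bar> * d \<le> \<bar>t\<bar> * norm (a + (1/t) *\<^sub>R s)"
      by (intro mult_left_mono) (auto simp: dist_norm)
    also have "\<dots> = norm (t *\<^sub>R (a + (1/t) *\<^sub>R s))" by simp
    also have "t *\<^sub>R (a + (1/t) *\<^sub>R s) = t *\<^sub>R a + s"
      using False by (simp add: scaleR_add_right)
    finally show ?thesis .
  qed simp
  \<comment> \<open>\<open>1/d\<close> accounts for the coefficient of \<open>a\<close>; the factor
    \<open>1 + norm a / d\<close> bounds the norm of the remaining part \<open>s\<close> by that of
    \<open>x\<close>, and \<open>C\<close> then bounds its coordinates.\<close>
  define K where "K = 1/d + C * (1 + norm a / d)"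
  have "K \<ge> 0" using C d by (simp add: K_def)
  moreover have "(\<Sum>b\<in>insert a B. \<bar>c b\<bar>) \<le> K * norm (\<Sum>b\<in>insert a B. c b *\<^sub>R b)" for c
  proof -
    define s where "s = (\<Sum>b\<in>B. c b *\<^sub>R b)"
    define x where "x = c a *\<^sub>R a + s"
    have s: "s \<in> span B" unfolding s_def by (intro span_sum span_scale span_base)
    have ca: "\<bar>c a\<bar> \<le> norm x / d"
      using lower[OF s, of "c a"] d by (simp add: x_def field_simps)
    have "norm s \<le> norm x + \<bar>c a\<bar> * norm a"
      using norm_triangle_ineq4[of x "c a *\<^sub>R a"] by (simp add: x_def)
    also have "\<dots> \<le> norm x + norm x / d * norm a"
      using ca by (intro add_left_mono mult_right_mono) auto
    finally have ns: "norm s \<le> norm x * (1 + norm a / d)" by (simp add: algebra_simps)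
    have "(\<Sum>b\<in>insert a B. \<bar>c b\<bar>) = \<bar>c a\<bar> + (\<Sum>b\<in>B. \<bar>c b\<bar>)"
      using insert.hyps by simp
    also have "\<dots> \<le> norm x / d + C * norm s"
      using ca C(2)[of c] by (simp add: s_def)
    also have "\<dots> \<le> norm x / d + C * (norm x * (1 + norm a / d))"
      using ns C(1) by (intro add_left_mono mult_left_mono)
    also have "\<dots> = K * norm x" by (simp add: K_def algebra_simps)
    also have "x = (\<Sum>b\<in>insert a B. c b *\<^sub>R b)"
      using insert.hyps by (simp add: x_def s_def)
    finally show ?thesis .
  qed
  ultimately show ?case by blast
qed auto

lemma fin_dim_basis:
  assumes "fin_dim S"
  obtains B where "finite B" "independent B" "B \<subseteq> S" "S \<subseteq> span B"
proof -
  obtain T where T: "finite T" "S \<subseteq> span T" using assms by (auto simp: fin_dim_def)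
  obtain B where B: "B \<subseteq> S" "independent B" "S \<subseteq> span B"
    by (rule basis_exists[of S])
  then have "finite B"
    using independent_span_bound[OF T(1), of B] T by auto
  then show thesis using B that by blast
qed

lemma fin_dim_linear_bounded:
  fixes f :: "'a::real_normed_vector \<Rightarrow> 'b::real_normed_vector"
  assumes fd: "fin_dim (UNIV :: 'a set)" and f: "linear f"
  shows "bounded_linear f"
proof -
  obtain B :: "'a set" where B: "finite B" "independent B" "UNIV \<subseteq> span B"
    using fin_dim_basis[OF fd] by metis
  obtain C where C: "C \<ge> 0" "\<And>c. (\<Sum>b\<in>B. \<bar>c b\<bar>) \<le> C * norm (\<Sum>b\<in>B. c b *\<^sub>R b)"
    using coordinates_bounded[OF B(1,2)] by blast
  define K where "K = (\<Sum>b\<in>B. norm (f b))"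
  have "norm (f x) \<le> norm x * (C * K)" for x
  proof -
    have "x \<in> span B" using B by auto
    then obtain c where x: "x = (\<Sum>b\<in>B. c b *\<^sub>R b)" using B(1) by (auto simp: span_finite)
    have "norm (f x) \<le> (\<Sum>b\<in>B. norm (c b *\<^sub>R f b))"
      by (simp only: x linear_sum[OF f] linear_scale[OF f] norm_sum)
    also have "\<dots> \<le> (\<Sum>b\<in>B. \<bar>c b\<bar> * K)"
      unfolding norm_scaleR K_def using B(1)
      by (intro sum_mono mult_left_mono member_le_sum) auto
    also have "\<dots> = (\<Sum>b\<in>B. \<bar>c b\<bar>) * K" by (simp add: sum_distrib_right)
    also have "\<dots> \<le> C * norm x * K"
      using C(2)[of c] x by (intro mult_right_mono) (auto simp: K_def sum_nonneg)
    finally show ?thesis by (simp add: mult_ac)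
  qed
  then show ?thesis
    using f by (intro bounded_linear_intro[where K = "C * K"]) (auto simp: linear_add linear_scale)
qed

text \<open>Currying: each partial map is bounded by finite dimension of \<open>'b\<close>, and the
  linear map into the operator space is bounded by finite dimension of \<open>'a\<close>.\<close>

lemma fin_dim_bilinear_bounded:
  fixes f :: "'a::real_normed_vector \<Rightarrow> 'b::real_normed_vector \<Rightarrow> 'c::real_normed_vector"
  assumes fda: "fin_dim (UNIV :: 'a set)" and fdb: "fin_dim (UNIV :: 'b set)" and f: "bilinear f"
  shows "bounded_bilinear f"
proof -
  have l: "linear (f x)" "linear (\<lambda>x. f x y)" for x y using f by (auto simp: bilinear_def)
  have bl: "bounded_linear (f x)" for x
    by (rule fin_dim_linear_bounded[OF fdb l(1)])
  have "linear (\<lambda>x. Blinfun (f x))"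
    by (intro linearI blinfun_eqI)
      (simp_all add: bounded_linear_Blinfun_apply bl blinfun.add_left blinfun.scaleR_left
        linear_add[OF l(2)] linear_scale[OF l(2)])
  then have "bounded_linear (\<lambda>x. Blinfun (f x))" by (rule fin_dim_linear_bounded[OF fda])
  then have "bounded_bilinear (\<lambda>x. blinfun_apply (Blinfun (f x)))"
    using bounded_bilinear.comp[OF bounded_bilinear_blinfun_apply _ bounded_linear_ident] by blast
  then show ?thesis by (simp add: bounded_linear_Blinfun_apply bl)
qed

lemma fin_dim_projection:
  fixes E :: "'a::real_normed_vector set"
  assumes fd: "fin_dim (UNIV :: 'a set)" and E: "subspace E"
  obtains P :: "'a \<Rightarrow> 'a" where "bounded_linear P" "range P = E" "\<And>x. x \<in> E \<Longrightarrow> P x = x"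
proof -
  have "\<exists>g. g ` UNIV \<subseteq> E \<and> linear g \<and> (\<forall>v\<in>E. g (id v) = v)"
    using E by (intro linear_exists_left_inverse_on) (auto simp: linear_iff)
  then obtain P where "range P \<subseteq> E" "linear P" "\<And>v. v \<in> E \<Longrightarrow> P v = v" by auto
  then show thesis
    by (intro that[of P]) (auto intro: fin_dim_linear_bounded[OF fd], metis rangeI)
qed

text \<open>The vectors \<open>e i\<close> are projections of a basis of the whole space. They need
  not be independent, but in exchange the coefficient functions are bounded linear everywhere and
  can be composed with arbitrary maps.\<close>

lemma fin_dim_coordinates:
  fixes E :: "'a::real_normed_vector set"
  assumes fd: "fin_dim (UNIV :: 'a set)" and E: "subspace E"
  obtains I :: "'a set" and e k where "finite I" "\<And>i. i \<in> I \<Longrightarrow> e i \<in> E"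
    "\<And>i. i \<in> I \<Longrightarrow> bounded_linear (k i)" "\<And>x. x \<in> E \<Longrightarrow> x = (\<Sum>i\<in>I. k i x *\<^sub>R e i)"
proof -
  obtain B :: "'a set" where B: "finite B" "independent B" "UNIV \<subseteq> span B"
    using fin_dim_basis[OF fd] by metis
  obtain P :: "'a \<Rightarrow> 'a" where P: "bounded_linear P" "range P = E" "\<And>x. x \<in> E \<Longrightarrow> P x = x"
    using fin_dim_projection[OF fd E] by metis
  define k where "k = (\<lambda>b x. representation B x b)"
  have "linear (k b)" for b
    unfolding k_def using B
    by (intro linearI) (auto simp: representation_add representation_scale top.extremum_unique)
  then have "bounded_linear (k b)" for b by (rule fin_dim_linear_bounded[OF fd])
  moreover have "x = (\<Sum>b\<in>B. k b x *\<^sub>R P b)" if "x \<in> E" for x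
  proof -
    have "x = (\<Sum>b\<in>B. k b x *\<^sub>R b)"
      unfolding k_def using B by (subst sum_representation_eq) auto
    then have "P x = P (\<Sum>b\<in>B. k b x *\<^sub>R b)" by simp
    also have "\<dots> = (\<Sum>b\<in>B. k b x *\<^sub>R P b)"
      by (simp add: linear_sum linear_scale bounded_linear.linear[OF P(1)])
    finally show ?thesis using P(3)[OF that] by simp
  qed
  ultimately show thesis using B(1) P(2) by (intro that[of B P k]) auto
qed

lemma fin_dim_closed_subspace:
  fixes E :: "'a::real_normed_vector set"
  assumes fd: "fin_dim (UNIV :: 'a set)" and E: "subspace E"
  shows "closed E"
proof -
  obtain P :: "'a \<Rightarrow> 'a" where P: "bounded_linear P" "range P = E" "\<And>x. x \<in> E \<Longrightarrow> P x = x"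
    using fin_dim_projection[OF fd E] by metis
  have "x \<in> E \<longleftrightarrow> P x = x" for x using P(2,3) by (metis rangeI)
  then have "E = {x. P x = x}" by blast
  moreover have "closed {x. P x = x}"
    using bounded_linear.continuous_on[OF P(1) continuous_on_id] by (intro closed_Collect_eq) auto
  ultimately show ?thesis by simp
qed

lemma fin_dim_right_inverse:
  fixes f :: "'a::real_normed_vector \<Rightarrow> 'b::real_normed_vector"
  assumes fd: "fin_dim (UNIV :: 'b set)" and f: "linear f"
  obtains g where "bounded_linear g" "\<And>y. y \<in> range f \<Longrightarrow> f (g y) = y"
  using linear_exists_right_inverse_on[OF f subspace_UNIV] fin_dim_linear_bounded[OF fd] by metis

lemma fin_dim_left_inverse:
  fixes f :: "'a::real_normed_vector \<Rightarrow> 'b::real_normed_vector"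
  assumes fd: "fin_dim (UNIV :: 'b set)" and f: "linear f" and E: "subspace E"
    and inj: "\<And>v. v \<in> E \<Longrightarrow> f v = 0 \<Longrightarrow> v = 0"
  obtains g where "bounded_linear g" "\<And>v. v \<in> E \<Longrightarrow> g (f v) = v" "range g \<subseteq> E"
proof -
  have "inj_on f E"
    using linear_inj_on_iff_eq_0[OF f E] inj by blast
  then show thesis
    using linear_exists_left_inverse_on[OF f E] fin_dim_linear_bounded[OF fd] that by metis
qed

lemma fin_dim_dual:
  assumes fd: "fin_dim (UNIV :: 'a::real_normed_vector set)"
  shows "fin_dim (UNIV :: 'a dual set)"
proof -
  obtain I :: "'a set" and e :: "'a \<Rightarrow> 'a" and k :: "'a \<Rightarrow> 'a \<Rightarrow> real" where I: "finite I"
    "\<And>i. i \<in> I \<Longrightarrow> bounded_linear (k i)" "\<And>x. x = (\<Sum>i\<in>I. k i x *\<^sub>R e i)"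
    by (rule fin_dim_coordinates[OF fd subspace_UNIV]) auto
  have "\<mu> \<in> span ((\<lambda>i. Blinfun (k i)) ` I)" for \<mu> :: "'a dual"
  proof -
    have "\<mu> = (\<Sum>i\<in>I. \<mu> (e i) *\<^sub>R Blinfun (k i))"
    proof (rule blinfun_eqI)
      fix x
      have "\<mu> x = \<mu> (\<Sum>i\<in>I. k i x *\<^sub>R e i)" using I(3)[of x] by simp
      also have "\<dots> = (\<Sum>i\<in>I. \<mu> (e i) *\<^sub>R Blinfun (k i)) x"
        unfolding blinfun.sum_left blinfun.sum_right
        by (intro sum.cong) (auto simp: blinfun.scaleR_left blinfun.scaleR_right bounded_linear_Blinfun_apply I(2))
      finally show "\<mu> x = (\<Sum>i\<in>I. \<mu> (e i) *\<^sub>R Blinfun (k i)) x" .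
    qed
    also have "\<dots> \<in> span ((\<lambda>i. Blinfun (k i)) ` I)"
      by (intro span_sum span_scale span_base imageI)
    finally show ?thesis .
  qed
  then show ?thesis using I(1) unfolding fin_dim_def by (meson finite_imageI subsetI)
qed

lemma fin_dim_prod:
  assumes "fin_dim (UNIV :: 'a::real_normed_vector set)" "fin_dim (UNIV :: 'b::real_normed_vector set)"
  shows "fin_dim (UNIV :: ('a \<times> 'b) set)"
proof -
  obtain A :: "'a set" and B :: "'b set" where AB: "finite A" "span A = UNIV" "finite B" "span B = UNIV"
    using assms unfolding fin_dim_def by (metis UNIV_I subsetD UNIV_eq_I)
  have "(x, y) \<in> span ((\<lambda>a. (a, 0)) ` A \<union> (\<lambda>b. (0, b)) ` B)" (is "_ \<in> span (?A \<union> ?B)") for x y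
  proof -
    have "linear (\<lambda>a::'a. (a, 0::'b))" "linear (\<lambda>b::'b. (0::'a, b))" by (auto intro!: linearI)
    then have "span ?A = (\<lambda>a. (a, 0)) ` UNIV" "span ?B = (\<lambda>b. (0, b)) ` UNIV"
      by (simp_all add: linear_span_image AB)
    then have "(x, 0) \<in> span ?A" "(0, y) \<in> span ?B" by auto
    then have "(x, 0) + (0, y) \<in> span (?A \<union> ?B)"
      by (intro span_add) (auto intro: span_mono[THEN subsetD])
    then show ?thesis by simp
  qed
  then show ?thesis unfolding fin_dim_def using AB by (intro exI[of _ "?A \<union> ?B"]) auto
qed

lemma dual_separates:
  fixes u :: "'a::real_normed_vector"
  assumes fd: "fin_dim (UNIV :: 'a set)" and 0: "\<And>\<mu> :: 'a dual. blinfun_apply \<mu> u = 0"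
  shows "u = 0"
proof -
  obtain I :: "'a set" and e :: "'a \<Rightarrow> 'a" and k :: "'a \<Rightarrow> 'a \<Rightarrow> real" where I: "finite I"
    "\<And>i. i \<in> I \<Longrightarrow> bounded_linear (k i)" "\<And>x. x = (\<Sum>i\<in>I. k i x *\<^sub>R e i)"
    by (rule fin_dim_coordinates[OF fd subspace_UNIV]) auto
  have "k i u = 0" if "i \<in> I" for i
    using 0[of "Blinfun (k i)"] I(2)[OF that] by (simp add: bounded_linear_Blinfun_apply)
  then show ?thesis using I(3)[of u] by simp
qed

section \<open>Maps of class \<open>C\<^sup>k\<close> along a subspace\<close>

definition open_along :: "'a::real_normed_vector set \<Rightarrow> 'a set \<Rightarrow> bool"
  where "open_along E U \<longleftrightarrow> subspace E \<and> openin (top_of_set E) U"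

lemma open_along_UNIV [simp]: "open_along UNIV U \<longleftrightarrow> open U"
  by (simp add: open_along_def open_openin[symmetric])

lemma open_along_subset: "open_along E U \<Longrightarrow> U \<subseteq> E"
  by (auto simp: open_along_def openin_imp_subset dest: openin_imp_subset)

lemma open_along_ball:
  assumes "open_along E U" "x \<in> U"
  obtains \<delta> where "\<delta> > 0" "ball x \<delta> \<inter> E \<subseteq> U"
proof -
  obtain T where T: "open T" "U = E \<inter> T"
    using assms by (auto simp: open_along_def openin_open)
  then obtain \<delta> where "\<delta> > 0" "ball x \<delta> \<subseteq> T"
    using assms(2) openE[of T x] by blast
  then show thesis using T by (intro that[of \<delta>]) auto
qed

lemma open_along_ball_Int:
  assumes "subspace E"
  shows "open_along E (ball x \<delta> \<inter> E)"
  using assms by (auto simp: open_along_def openin_open)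

lemma at_within_open_along:
  assumes "open_along E U" "x \<in> U"
  shows "at x within U = at x within E"
proof -
  obtain T where "open T" "U = E \<inter> T"
    using assms by (auto simp: open_along_def openin_open)
  then show ?thesis using assms(2) by (intro at_within_nhd[of x T]) auto
qed

text \<open>Along the line through \<open>x\<close> in direction \<open>v\<close>, which stays in
  \<open>E\<close>, both candidates give the derivative of the same function of one real variable.
  Relative openness replaces the filter within \<open>U\<close> by the one within \<open>E\<close>,
  where the whole line is available.\<close>

lemma has_derivative_unique_subspace:
  assumes E: "open_along E U" and x: "x \<in> U" and v: "v \<in> E"
    and D: "(f has_derivative D1) (at x within U)" "(f has_derivative D2) (at x within U)"
  shows "D1 v = D2 v"
proof -
  have sE: "subspace E" and xE: "x \<in> E"
    using E x open_along_subset[OF E] by (auto simp: open_along_def)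
  define c where "c = (\<lambda>t::real. x + t *\<^sub>R v)"
  have c: "(c has_derivative (\<lambda>t. t *\<^sub>R v)) (at 0)"
    unfolding c_def by (auto intro!: derivative_eq_intros)
  have cE: "range c \<subseteq> E"
    using sE xE v by (auto simp: c_def intro!: subspace_add subspace_scale)
  have "((\<lambda>t. f (c t)) has_derivative (\<lambda>t. D (t *\<^sub>R v))) (at 0)"
    if "(f has_derivative D) (at x within U)" for D
  proof (rule has_derivative_in_compose[OF c])
    have "(f has_derivative D) (at x within E)"
      using that at_within_open_along[OF E x] by simp
    then show "(f has_derivative D) (at (c 0) within range c)"
      using has_derivative_subset[OF _ cE, of f D x] by (simp add: c_def)
  qed
  from has_derivative_unique[OF this[OF D(1)] this[OF D(2)]]
  have "(\<lambda>t::real. D1 (t *\<^sub>R v)) = (\<lambda>t. D2 (t *\<^sub>R v))" .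
  from fun_cong[OF this, of 1] show ?thesis by simp
qed

lemma frechet_derivative_subspace:
  assumes "open_along E U" "x \<in> U" "v \<in> E" "(f has_derivative D) (at x within U)"
  shows "frechet_derivative f (at x within U) v = D v"
  using assms has_derivative_unique_subspace frechet_derivative_works differentiableI by blast

text \<open>Difference quotients within \<open>U\<close> evaluate the derivative on increments in
  \<open>E\<close> only, so its values elsewhere may be changed.\<close>

lemma has_derivative_cong_subspace:
  assumes E: "subspace E" "U \<subseteq> E" "x \<in> E" and D: "(f has_derivative D) (at x within U)"
    and L: "bounded_linear L" "\<And>v. v \<in> E \<Longrightarrow> D v = L v"
  shows "(f has_derivative L) (at x within U)"
proof -
  have "y - x \<in> E" if "y \<in> U" for y using that E by (auto intro: subspace_diff)
  then show ?thesis
    using D L unfolding has_derivative_within_alt by simp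
qed

text \<open>Projecting \<open>f\<close> to \<open>F\<close> does not change it on \<open>U\<close>,
  so the projected derivative is again a derivative and uniqueness along \<open>E\<close>
  applies.\<close>

lemma derivative_in_subspace:
  fixes f :: "'a::real_normed_vector \<Rightarrow> 'b::real_normed_vector"
  assumes fd: "fin_dim (UNIV :: 'b set)" and E: "open_along E U" and F: "subspace F" "f ` U \<subseteq> F"
    and x: "x \<in> U" "v \<in> E" and D: "(f has_derivative D) (at x within U)"
  shows "D v \<in> F"
proof -
  obtain P :: "'b \<Rightarrow> 'b" where P: "bounded_linear P" "range P = F" "\<And>x. x \<in> F \<Longrightarrow> P x = x"
    using fin_dim_projection[OF fd F(1)] by metis
  have "((\<lambda>y. P (f y)) has_derivative (\<lambda>v. P (D v))) (at x within U)"
    by (rule bounded_linear.has_derivative[OF P(1) D])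
  then have "(f has_derivative (\<lambda>v. P (D v))) (at x within U)"
    by (rule has_derivative_transform[OF x(1), rotated]) (metis F(2) P(3) image_subset_iff)
  from has_derivative_unique_subspace[OF E x D this] show ?thesis
    using P(2) by (metis rangeI)
qed

lemma Ck_cong:
  assumes "\<And>x. x \<in> U \<Longrightarrow> f x = g x"
  shows "Ck_along k E U f \<longleftrightarrow> Ck_along k E U g"
  using assms
proof (induction k arbitrary: f g)
  case 0
  then show ?case by (simp cong: continuous_on_cong)
next
  case (Suc j)
  have "(f has_derivative D) (at x within U) \<longleftrightarrow> (g has_derivative D) (at x within U)" if "x \<in> U" for x D
    using Suc.prems that has_derivative_transform[of x U f g D] has_derivative_transform[of x U g f D]
    by auto
  then have *: "f differentiable (at x within U) \<longleftrightarrow> g differentiable (at x within U)"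
    "frechet_derivative f (at x within U) = frechet_derivative g (at x within U)" if "x \<in> U" for x
    using that by (auto simp: differentiable_def frechet_derivative_def)
  have "Ck_along j E U (\<lambda>x. frechet_derivative f (at x within U) v) \<longleftrightarrow>
      Ck_along j E U (\<lambda>x. frechet_derivative g (at x within U) v)" for v
    by (rule Suc.IH) (simp add: *(2))
  then show ?case using *(1) by simp
qed

text \<open>Frees the definition from the chosen \<open>frechet_derivative\<close>: any pointwise
  derivative can serve as witness, since all of them agree on \<open>E\<close>.\<close>

lemma Ck_Suc_iff:
  assumes E: "open_along E U"
  shows "Ck_along (Suc k) E U f \<longleftrightarrow>
    (\<exists>f'. (\<forall>x\<in>U. (f has_derivative f' x) (at x within U)) \<and> (\<forall>v\<in>E. Ck_along k E U (\<lambda>x. f' x v)))"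
proof
  assume L: "Ck_along (Suc k) E U f"
  then show "\<exists>f'. (\<forall>x\<in>U. (f has_derivative f' x) (at x within U)) \<and> (\<forall>v\<in>E. Ck_along k E U (\<lambda>x. f' x v))"
    by (intro exI[of _ "\<lambda>x. frechet_derivative f (at x within U)"])
      (simp add: frechet_derivative_works[symmetric])
next
  assume "\<exists>f'. (\<forall>x\<in>U. (f has_derivative f' x) (at x within U)) \<and> (\<forall>v\<in>E. Ck_along k E U (\<lambda>x. f' x v))"
  then obtain f' where f': "\<And>x. x \<in> U \<Longrightarrow> (f has_derivative f' x) (at x within U)"
    "\<And>v. v \<in> E \<Longrightarrow> Ck_along k E U (\<lambda>x. f' x v)" by blast
  have "Ck_along k E U (\<lambda>x. frechet_derivative f (at x within U) v)" if "v \<in> E" for v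
    using f'(2)[OF that] frechet_derivative_subspace[OF E _ that f'(1)]
    by (subst Ck_cong[where g = "\<lambda>x. f' x v"]) auto
  then show "Ck_along (Suc k) E U f"
    using f'(1) by (auto simp: differentiable_def)
qed

lemma Ck_SucI:
  assumes "open_along E U" "\<And>x. x \<in> U \<Longrightarrow> (f has_derivative f' x) (at x within U)"
    "\<And>v. v \<in> E \<Longrightarrow> Ck_along k E U (\<lambda>x. f' x v)"
  shows "Ck_along (Suc k) E U f"
  using assms Ck_Suc_iff by blast

lemma Ck_SucE:
  assumes "open_along E U" "Ck_along (Suc k) E U f"
  obtains f' where "\<And>x. x \<in> U \<Longrightarrow> (f has_derivative f' x) (at x within U)"
    "\<And>v. v \<in> E \<Longrightarrow> Ck_along k E U (\<lambda>x. f' x v)"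
  using assms Ck_Suc_iff by blast

lemma Ck_SucD:
  assumes "open_along E U" "Ck_along (Suc k) E U f"
  shows "Ck_along k E U f"
  using assms(2)
proof (induction k arbitrary: f)
  case 0
  then show ?case by (auto intro: differentiable_imp_continuous_on simp: differentiable_on_def)
next
  case (Suc k)
  obtain f' where f': "\<And>x. x \<in> U \<Longrightarrow> (f has_derivative f' x) (at x within U)"
    "\<And>v. v \<in> E \<Longrightarrow> Ck_along (Suc k) E U (\<lambda>x. f' x v)"
    using Ck_SucE[OF assms(1) Suc.prems] by blast
  show ?case by (rule Ck_SucI[OF assms(1) f'(1) Suc.IH[OF f'(2)]])
qed

lemma Ck_continuous_on:
  assumes "open_along E U" "Ck_along k E U f"
  shows "continuous_on U f"
  using assms(2) by (induction k) (simp_all add: Ck_SucD[OF assms(1)] del: Ck_along.simps(2))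

lemma Ck_const:
  assumes "open_along E U"
  shows "Ck_along k E U (\<lambda>x. c)"
proof (induction k arbitrary: c)
  case (Suc k)
  show ?case by (rule Ck_SucI[OF assms, where f' = "\<lambda>x v. 0"]) (simp_all add: Suc.IH)
qed simp

lemma Ck_linear:
  assumes E: "open_along E U" and L: "bounded_linear L" and f: "Ck_along k E U f"
  shows "Ck_along k E U (\<lambda>x. L (f x))"
  using f
proof (induction k arbitrary: f)
  case 0
  then show ?case using bounded_linear.continuous_on[OF L] by simp
next
  case (Suc k)
  obtain f' where f': "\<And>x. x \<in> U \<Longrightarrow> (f has_derivative f' x) (at x within U)"
    "\<And>v. v \<in> E \<Longrightarrow> Ck_along k E U (\<lambda>x. f' x v)"
    using Ck_SucE[OF E Suc.prems] by blast
  show ?case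
    by (rule Ck_SucI[OF E, where f' = "\<lambda>x v. L (f' x v)"])
      (auto intro: bounded_linear.has_derivative[OF L f'(1)] Suc.IH f'(2))
qed

lemma Ck_id:
  assumes E: "open_along E U"
  shows "Ck_along k E U (\<lambda>x. x)"
proof (cases k)
  case (Suc j)
  show ?thesis unfolding Suc
    by (rule Ck_SucI[OF E, where f' = "\<lambda>x v. v"]) (simp_all add: Ck_const[OF E])
qed simp

lemma Ck_add:
  assumes E: "open_along E U" and "Ck_along k E U f" "Ck_along k E U g"
  shows "Ck_along k E U (\<lambda>x. f x + g x)"
  using assms(2,3)
proof (induction k arbitrary: f g)
  case 0
  then show ?case by (simp add: continuous_on_add)
next
  case (Suc k)
  obtain f' where f': "\<And>x. x \<in> U \<Longrightarrow> (f has_derivative f' x) (at x within U)"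
    "\<And>v. v \<in> E \<Longrightarrow> Ck_along k E U (\<lambda>x. f' x v)"
    using Ck_SucE[OF E Suc.prems(1)] by blast
  obtain g' where g': "\<And>x. x \<in> U \<Longrightarrow> (g has_derivative g' x) (at x within U)"
    "\<And>v. v \<in> E \<Longrightarrow> Ck_along k E U (\<lambda>x. g' x v)"
    using Ck_SucE[OF E Suc.prems(2)] by blast
  show ?case
    by (rule Ck_SucI[OF E, where f' = "\<lambda>x v. f' x v + g' x v"])
      (auto intro: has_derivative_add f'(1) g'(1) Suc.IH f'(2) g'(2))
qed

lemma Ck_sum:
  assumes E: "open_along E U" and "\<And>i. i \<in> I \<Longrightarrow> Ck_along k E U (f i)"
  shows "Ck_along k E U (\<lambda>x. \<Sum>i\<in>I. f i x)"
  using assms(2)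
proof (induction I rule: infinite_finite_induct)
  case (insert i I)
  then have "Ck_along k E U (\<lambda>x. f i x + (\<Sum>i\<in>I. f i x))"
    by (intro Ck_add[OF E]) auto
  then show ?case using insert.hyps by simp
qed (simp_all add: Ck_const[OF E])

lemma Ck_bilinear:
  assumes E: "open_along E U" and B: "bounded_bilinear B"
    and "Ck_along k E U f" "Ck_along k E U g"
  shows "Ck_along k E U (\<lambda>x. B (f x) (g x))"
  using assms(3,4)
proof (induction k arbitrary: f g)
  case 0
  then show ?case by (simp add: bounded_bilinear.continuous_on[OF B])
next
  case (Suc k)
  obtain f' where f': "\<And>x. x \<in> U \<Longrightarrow> (f has_derivative f' x) (at x within U)"
    "\<And>v. v \<in> E \<Longrightarrow> Ck_along k E U (\<lambda>x. f' x v)"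
    using Ck_SucE[OF E Suc.prems(1)] by blast
  obtain g' where g': "\<And>x. x \<in> U \<Longrightarrow> (g has_derivative g' x) (at x within U)"
    "\<And>v. v \<in> E \<Longrightarrow> Ck_along k E U (\<lambda>x. g' x v)"
    using Ck_SucE[OF E Suc.prems(2)] by blast
  show ?case
    by (rule Ck_SucI[OF E, where f' = "\<lambda>x v. B (f x) (g' x v) + B (f' x v) (g x)"])
      (assumption | rule bounded_bilinear.FDERIV[OF B f'(1) g'(1)] Ck_add[OF E] Suc.IH f'(2) g'(2)
        Ck_SucD[OF E Suc.prems(1)] Ck_SucD[OF E Suc.prems(2)])+
qed

lemma Ck_Pair:
  assumes E: "open_along E U" and "Ck_along k E U f" "Ck_along k E U g"
  shows "Ck_along k E U (\<lambda>x. (f x, g x))"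
proof -
  have "Ck_along k E U (\<lambda>x. (f x, 0) + (0, g x))"
    by (intro Ck_add[OF E] Ck_linear[OF E _ assms(2)] Ck_linear[OF E _ assms(3)]
        bounded_linear_Pair bounded_linear_ident bounded_linear_zero)
  then show ?thesis by simp
qed

text \<open>The chain rule yields \<open>g' (f x) (f' x v)\<close>, whose direction varies with
  \<open>x\<close>, whereas the hypothesis on \<open>g\<close> concerns fixed directions. Expanding
  \<open>f' x v\<close> in fixed vectors of \<open>F\<close> gives a sum of products to which the
  induction applies.\<close>

lemma Ck_compose:
  fixes f :: "'a::real_normed_vector \<Rightarrow> 'b::real_normed_vector"
  assumes fd: "fin_dim (UNIV :: 'b set)"
    and E: "open_along E U" and F: "open_along F V" and fUV: "f ` U \<subseteq> V"
    and "Ck_along k E U f" "Ck_along k F V g"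
  shows "Ck_along k E U (\<lambda>x. g (f x))"
  using assms(5,6)
proof (induction k arbitrary: g)
  case 0
  then show ?case using fUV by (auto intro: continuous_on_compose2)
next
  case (Suc k)
  have sF: "subspace F" using F by (simp add: open_along_def)
  obtain I :: "'b set" and e :: "'b \<Rightarrow> 'b" and c :: "'b \<Rightarrow> 'b \<Rightarrow> real"
    where I: "finite I" "\<And>i. i \<in> I \<Longrightarrow> e i \<in> F"
    "\<And>i. i \<in> I \<Longrightarrow> bounded_linear (c i)" "\<And>x. x \<in> F \<Longrightarrow> x = (\<Sum>i\<in>I. c i x *\<^sub>R e i)"
    by (rule fin_dim_coordinates[OF fd sF]) (rule that; assumption)
  obtain f' where f': "\<And>x. x \<in> U \<Longrightarrow> (f has_derivative f' x) (at x within U)"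
    "\<And>v. v \<in> E \<Longrightarrow> Ck_along k E U (\<lambda>x. f' x v)"
    using Ck_SucE[OF E Suc.prems(1)] by blast
  obtain g' where g': "\<And>x. x \<in> V \<Longrightarrow> (g has_derivative g' x) (at x within V)"
    "\<And>v. v \<in> F \<Longrightarrow> Ck_along k F V (\<lambda>x. g' x v)"
    using Ck_SucE[OF F Suc.prems(2)] by blast
  have fk: "Ck_along k E U f" by (rule Ck_SucD[OF E Suc.prems(1)])
  show ?case
  proof (rule Ck_SucI[OF E])
    show "((\<lambda>x. g (f x)) has_derivative (\<lambda>v. g' (f x) (f' x v))) (at x within U)" if "x \<in> U" for x
      by (rule has_derivative_in_compose2[OF g'(1) fUV that f'(1)[OF that]])
  next
    fix v assume v: "v \<in> E"
    have eq: "g' (f x) (f' x v) = (\<Sum>i\<in>I. c i (f' x v) *\<^sub>R g' (f x) (e i))" if x: "x \<in> U" for x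
    proof -
      have "f x \<in> V" using fUV x by auto
      then have l: "linear (g' (f x))" using g'(1) has_derivative_bounded_linear bounded_linear.linear by blast
      have "f' x v \<in> F"
        using derivative_in_subspace[OF fd E sF _ x v f'(1)[OF x]] fUV open_along_subset[OF F] by blast
      then have "g' (f x) (f' x v) = g' (f x) (\<Sum>i\<in>I. c i (f' x v) *\<^sub>R e i)"
        using I(4) by simp
      also have "\<dots> = (\<Sum>i\<in>I. c i (f' x v) *\<^sub>R g' (f x) (e i))"
        by (simp add: linear_sum[OF l] linear_scale[OF l])
      finally show ?thesis .
    qed
    have "Ck_along k E U (\<lambda>x. \<Sum>i\<in>I. c i (f' x v) *\<^sub>R g' (f x) (e i))"
      by (intro Ck_sum[OF E] Ck_bilinear[OF E bounded_bilinear_scaleR] Ck_linear[OF E I(3) f'(2)]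
          Suc.IH fk g'(2) I(2) v)
    then show "Ck_along k E U (\<lambda>x. g' (f x) (f' x v))"
      by (subst Ck_cong[OF eq])
  qed
qed

lemma Ck_subset:
  assumes E: "open_along E U" "open_along E W" "W \<subseteq> U" and f: "Ck_along k E U f"
  shows "Ck_along k E W f"
  using f
proof (induction k arbitrary: f)
  case 0
  then show ?case using E continuous_on_subset by auto
next
  case (Suc k)
  obtain f' where f': "\<And>x. x \<in> U \<Longrightarrow> (f has_derivative f' x) (at x within U)"
    "\<And>v. v \<in> E \<Longrightarrow> Ck_along k E U (\<lambda>x. f' x v)"
    using Ck_SucE[OF E(1) Suc.prems] by blast
  show ?case
    by (rule Ck_SucI[OF E(2) has_derivative_subset[OF f'(1) E(3)] Suc.IH[OF f'(2)]]) (use E in auto)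
qed

lemma Ck_local:
  assumes E: "open_along E U"
    and loc: "\<And>x. x \<in> U \<Longrightarrow> \<exists>W. open_along E W \<and> x \<in> W \<and> W \<subseteq> U \<and> Ck_along k E W f"
  shows "Ck_along k E U f"
  using loc
proof (induction k arbitrary: f)
  case 0
  have "continuous (at x within U) f" if x: "x \<in> U" for x
  proof -
    obtain W where W: "open_along E W" "x \<in> W" "W \<subseteq> U" "continuous_on W f"
      using 0[OF x] by auto
    then have "continuous (at x within W) f"
      using continuous_on_eq_continuous_within by blast
    then show ?thesis using at_within_open_along E W x by metis
  qed
  then show ?case by (simp add: continuous_on_eq_continuous_within)
next
  case (Suc k)
  have at: "at x within W = at x within U" if "open_along E W" "x \<in> W" "W \<subseteq> U" for x W
    using at_within_open_along E that by (metis subsetD)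
  have "f differentiable (at x within U)" if "x \<in> U" for x
    using Suc.prems[OF that] at by fastforce
  moreover have "Ck_along k E U (\<lambda>x. frechet_derivative f (at x within U) v)" if v: "v \<in> E" for v
  proof (rule Suc.IH)
    fix x assume "x \<in> U"
    then obtain W where W: "open_along E W" "x \<in> W" "W \<subseteq> U" "Ck_along (Suc k) E W f"
      using Suc.prems by blast
    then have "Ck_along k E W (\<lambda>x. frechet_derivative f (at x within W) v)" using v by simp
    then have "Ck_along k E W (\<lambda>x. frechet_derivative f (at x within U) v)"
      using at[OF W(1) _ W(3)] by (subst Ck_cong[where g = "\<lambda>x. frechet_derivative f (at x within W) v"]) auto
    then show "\<exists>W. open_along E W \<and> x \<in> W \<and> W \<subseteq> U \<and>
        Ck_along k E W (\<lambda>x. frechet_derivative f (at x within U) v)"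
      using W by blast
  qed
  ultimately show ?case by simp
qed

lemma smooth_along_derivative:
  assumes E: "open_along E U" and f: "smooth_along E U f"
  shows "x \<in> U \<Longrightarrow> (f has_derivative frechet_derivative f (at x within U)) (at x within U)"
    and "v \<in> E \<Longrightarrow> smooth_along E U (\<lambda>x. frechet_derivative f (at x within U) v)"
proof -
  have *: "Ck_along (Suc k) E U f" for k using f by (simp only: smooth_along_def)
  show "x \<in> U \<Longrightarrow> (f has_derivative frechet_derivative f (at x within U)) (at x within U)"
    using *[of 0] by (simp add: frechet_derivative_works[symmetric])
  show "v \<in> E \<Longrightarrow> smooth_along E U (\<lambda>x. frechet_derivative f (at x within U) v)"
    using * by (simp add: smooth_along_def)
qed

section \<open>Substitutes for the inverse function theorem\<close>

text \<open>The mean value inequality is applied to the difference of \<open>f\<close> and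
  \<open>D\<close> on a convex relative ball. Continuity of finitely many directional derivatives
  makes the derivative of this difference uniformly small there.\<close>

lemma strictly_differentiable:
  fixes f :: "'a::real_normed_vector \<Rightarrow> 'b::real_normed_vector"
  assumes fd: "fin_dim (UNIV :: 'a set)" and E: "open_along E U"
    and f: "Ck_along (Suc 0) E U f" and x0: "x0 \<in> U" and D: "(f has_derivative D) (at x0 within U)"
    and "\<epsilon> > 0"
  obtains \<delta> where "\<delta> > 0" "ball x0 \<delta> \<inter> E \<subseteq> U"
    "\<And>x y. x \<in> ball x0 \<delta> \<inter> E \<Longrightarrow> y \<in> ball x0 \<delta> \<inter> E \<Longrightarrow>
      norm (f x - f y - D (x - y)) \<le> \<epsilon> * norm (x - y)"
proof -
  have sE: "subspace E" using E by (simp add: open_along_def)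
  obtain I :: "'a set" and e :: "'a \<Rightarrow> 'a" and c :: "'a \<Rightarrow> 'a \<Rightarrow> real"
    where I: "finite I" "\<And>i. i \<in> I \<Longrightarrow> e i \<in> E"
    "\<And>i. i \<in> I \<Longrightarrow> bounded_linear (c i)" "\<And>x. x \<in> E \<Longrightarrow> x = (\<Sum>i\<in>I. c i x *\<^sub>R e i)"
    by (rule fin_dim_coordinates[OF fd sE]) (rule that; assumption)
  obtain f' where f': "\<And>x. x \<in> U \<Longrightarrow> (f has_derivative f' x) (at x within U)"
    "\<And>v. v \<in> E \<Longrightarrow> continuous_on U (\<lambda>x. f' x v)"
    using Ck_SucE[OF E f] by auto
  have D': "f' x0 v = D v" if "v \<in> E" for v
    by (rule has_derivative_unique_subspace[OF E x0 that f'(1)[OF x0] D])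
  \<comment> \<open>\<open>K\<close> bounds all coordinate functionals together, so directional
    errors below \<open>\<eta>\<close> add up to an operator error of at most
    \<open>\<epsilon>\<close>.\<close>
  define K where "K = (\<Sum>i\<in>I. onorm (c i))"
  have K: "K \<ge> 0" unfolding K_def by (intro sum_nonneg onorm_pos_le I)
  define \<eta> where "\<eta> = \<epsilon> / (K + 1)"
  have \<eta>: "\<eta> > 0" "K * \<eta> \<le> \<epsilon>" using K \<open>\<epsilon> > 0\<close> by (auto simp: \<eta>_def field_simps)
  have "eventually (\<lambda>x. dist (f' x (e i)) (f' x0 (e i)) < \<eta>) (at x0 within U)" if "i \<in> I" for i
    using f'(2)[OF I(2)[OF that]] x0 \<eta>(1) by (auto simp: continuous_on_def dest: tendstoD)
  then have "eventually (\<lambda>x. \<forall>i\<in>I. dist (f' x (e i)) (f' x0 (e i)) < \<eta>) (at x0 within U)"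
    using I(1) by (simp add: eventually_ball_finite)
  then obtain \<delta>1 where \<delta>1: "\<delta>1 > 0"
    "\<And>x i. x \<in> U \<Longrightarrow> dist x x0 < \<delta>1 \<Longrightarrow> i \<in> I \<Longrightarrow> dist (f' x (e i)) (f' x0 (e i)) < \<eta>"
    unfolding eventually_at using \<eta>(1) by (metis dist_self)
  obtain \<delta>2 where \<delta>2: "\<delta>2 > 0" "ball x0 \<delta>2 \<inter> E \<subseteq> U" using open_along_ball[OF E x0] .
  define \<delta> where "\<delta> = min \<delta>1 \<delta>2"
  have sub: "ball x0 \<delta> \<inter> E \<subseteq> U" using \<delta>2 by (auto simp: \<delta>_def)
  \<comment> \<open>\<open>G x\<close> agrees with the difference of \<open>f' x\<close> and
    \<open>D\<close> on \<open>E\<close>, but is determined everywhere by the directions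
    \<open>e i\<close>, so its operator norm can be estimated.\<close>
  define G where "G = (\<lambda>x v. \<Sum>i\<in>I. c i v *\<^sub>R (f' x (e i) - D (e i)))"
  have Dl: "bounded_linear D" by (rule has_derivative_bounded_linear[OF D])
  have bl: "bounded_linear (G x)" for x
    unfolding G_def
    by (intro bounded_linear_sum bounded_linear_compose[OF bounded_linear_scaleR_left] I(3))
  have der: "((\<lambda>y. f y - D y) has_derivative G x) (at x within ball x0 \<delta> \<inter> E)"
    if x: "x \<in> ball x0 \<delta> \<inter> E" for x
  proof (rule has_derivative_cong_subspace[OF sE])
    have xU: "x \<in> U" using sub x by auto
    show "((\<lambda>y. f y - D y) has_derivative (\<lambda>v. f' x v - D v)) (at x within ball x0 \<delta> \<inter> E)"
      by (intro has_derivative_diff has_derivative_subset[OF f'(1)[OF xU] sub]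
          bounded_linear_imp_has_derivative Dl)
    fix v assume v: "v \<in> E"
    have l: "linear (\<lambda>v. f' x v - D v)"
      using Dl has_derivative_bounded_linear[OF f'(1)[OF xU]]
      by (intro linear_compose_sub bounded_linear.linear)
    have "f' x v - D v = (\<lambda>v. f' x v - D v) (\<Sum>i\<in>I. c i v *\<^sub>R e i)"
      using I(4)[OF v] by simp
    also have "\<dots> = G x v"
      unfolding G_def by (simp only: linear_sum[OF l] linear_scale[OF l])
    finally show "f' x v - D v = G x v" .
  qed (use x bl in auto)
  have on: "onorm (G x) \<le> \<epsilon>" if x: "x \<in> ball x0 \<delta> \<inter> E" for x
  proof (rule onorm_bound[OF less_imp_le[OF \<open>\<epsilon> > 0\<close>]])
    fix v
    have xU: "x \<in> U" using sub x by auto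
    have "norm (G x v) \<le> (\<Sum>i\<in>I. norm (c i v) * norm (f' x (e i) - D (e i)))"
      unfolding G_def using norm_sum[of "\<lambda>i. c i v *\<^sub>R (f' x (e i) - D (e i))" I] by simp
    also have "\<dots> \<le> (\<Sum>i\<in>I. (onorm (c i) * norm v) * \<eta>)"
    proof (rule sum_mono)
      fix i assume i: "i \<in> I"
      have "norm (f' x (e i) - D (e i)) \<le> \<eta>"
        using \<delta>1(2)[OF xU _ i] x D'[OF I(2)[OF i]] by (auto simp: \<delta>_def dist_norm norm_minus_commute)
      then show "norm (c i v) * norm (f' x (e i) - D (e i)) \<le> (onorm (c i) * norm v) * \<eta>"
        using onorm[OF I(3)[OF i], of v] by (intro mult_mono) auto
    qed
    also have "\<dots> = K * \<eta> * norm v"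
      unfolding K_def sum_distrib_right by (simp add: mult_ac)
    also have "\<dots> \<le> \<epsilon> * norm v" using \<eta>(2) by (intro mult_right_mono) auto
    finally show "norm (G x v) \<le> \<epsilon> * norm v" .
  qed
  have "convex (ball x0 \<delta> \<inter> E)"
    by (intro convex_Int convex_ball subspace_imp_convex sE)
  from differentiable_bound[OF this der on]
  have "norm ((f x - D x) - (f y - D y)) \<le> \<epsilon> * norm (x - y)"
    if "x \<in> ball x0 \<delta> \<inter> E" "y \<in> ball x0 \<delta> \<inter> E" for x y
    using that by blast
  moreover have "(f x - D x) - (f y - D y) = f x - f y - D (x - y)" for x y
    by (simp add: linear_diff[OF bounded_linear.linear[OF Dl]])
  ultimately show thesis
    using \<delta>1(1) \<delta>2(1) sub by (intro that[of \<delta>]) (auto simp: \<delta>_def)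
qed

text \<open>The map \<open>x - g x + w\<close> is a contraction whose fixed points are the
  solutions. The distance of \<open>w\<close> from \<open>g x0\<close> takes half of the radius, and
  the factor 1/2 leaves the other half for the displacement from \<open>x0\<close>.\<close>

lemma near_identity_surjective:
  fixes g :: "'v::banach \<Rightarrow> 'v"
  assumes E: "subspace E" "closed E" "x0 \<in> E" and "\<delta> > 0"
    and gE: "\<And>x. x \<in> cball x0 \<delta> \<inter> E \<Longrightarrow> g x \<in> E"
    and g: "\<And>x y. x \<in> cball x0 \<delta> \<inter> E \<Longrightarrow> y \<in> cball x0 \<delta> \<inter> E \<Longrightarrow>
      norm (g x - g y - (x - y)) \<le> 1/2 * norm (x - y)"
    and w: "w \<in> E" "norm (w - g x0) \<le> \<delta> / 2"
  obtains x where "x \<in> cball x0 \<delta> \<inter> E" "g x = w"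
proof -
  define T where "T = (\<lambda>x. x - g x + w)"
  have x0: "x0 \<in> cball x0 \<delta> \<inter> E" using E \<open>\<delta> > 0\<close> by auto
  have "\<exists>!x\<in>cball x0 \<delta> \<inter> E. T x = x"
  proof (rule Banach_fix)
    show "complete (cball x0 \<delta> \<inter> E)" using E by (simp add: complete_eq_closed closed_Int)
    show "cball x0 \<delta> \<inter> E \<noteq> {}" using x0 by blast
    show "T ` (cball x0 \<delta> \<inter> E) \<subseteq> cball x0 \<delta> \<inter> E"
    proof (safe)
      fix x assume x: "x \<in> cball x0 \<delta>" "x \<in> E"
      have "T x - x0 = (w - g x0) - (g x - g x0 - (x - x0))" by (simp add: T_def)
      then have "norm (T x - x0) \<le> norm (w - g x0) + norm (g x - g x0 - (x - x0))"
        by (metis norm_triangle_ineq4)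
      also have "\<dots> \<le> \<delta> / 2 + 1/2 * norm (x - x0)"
        using w(2) g[of x x0] x x0 by (intro add_mono) auto
      also have "\<dots> \<le> \<delta>" using x by (auto simp: dist_norm norm_minus_commute)
      finally show "T x \<in> cball x0 \<delta>" by (simp add: dist_norm norm_minus_commute)
      show "T x \<in> E" using gE[of x] x E(1) w(1) by (auto simp: T_def intro!: subspace_add subspace_diff)
    qed
    show "dist (T x) (T y) \<le> 1/2 * dist x y" if "x \<in> cball x0 \<delta> \<inter> E" "y \<in> cball x0 \<delta> \<inter> E" for x y
    proof -
      have "T x - T y = - (g x - g y - (x - y))" by (simp add: T_def)
      then have "norm (T x - T y) = norm (g x - g y - (x - y))" by (metis norm_minus_cancel)
      then show ?thesis using g[OF that] by (simp add: dist_norm)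
    qed
  qed auto
  then obtain x where "x \<in> cball x0 \<delta> \<inter> E" "T x = x" by blast
  then show thesis by (intro that[of x]) (auto simp: T_def)
qed

text \<open>Applying \<open>h\<close> to the first-order expansion of \<open>g\<close> along
  \<open>c\<close> expresses the increment of \<open>c\<close> by that of \<open>f\<close>, up to an
  error relative to the increment of \<open>c\<close> itself. An error factor of at most 1/2 can be
  absorbed; this gives a Lipschitz bound at \<open>x0\<close>, after which the error is of small
  order.\<close>

lemma left_inverse_has_derivative:
  assumes g: "(g has_derivative g') (at (c x0) within S')" and c: "continuous (at x0 within S) c"
    and cS: "c ` S \<subseteq> S'" and x0: "x0 \<in> S" and f: "(f has_derivative f') (at x0 within S)"
    and gc: "\<And>x. x \<in> S \<Longrightarrow> g (c x) = f x"
    and h: "bounded_linear h" "\<And>z. z \<in> S' \<Longrightarrow> h (g' (z - c x0)) = z - c x0"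
  shows "(c has_derivative (\<lambda>v. h (f' v))) (at x0 within S)"
  unfolding has_derivative_within_alt
proof (intro conjI allI impI)
  have f'l: "bounded_linear f'" using f by (rule has_derivative_bounded_linear)
  show "bounded_linear (\<lambda>v. h (f' v))" using bounded_linear_compose[OF h(1) f'l] .
  obtain H where H: "H > 0" "\<And>w. norm (h w) \<le> norm w * H" using bounded_linear.pos_bounded[OF h(1)] by blast
  obtain F where F: "F > 0" "\<And>w. norm (f' w) \<le> norm w * F" using bounded_linear.pos_bounded[OF f'l] by blast
  fix \<epsilon> :: real assume "\<epsilon> > 0"
  \<comment> \<open>\<open>e1\<close> limits the error of \<open>f\<close> and \<open>e2\<close>
    that of \<open>g\<close>. The bound \<open>e1 \<le> 1\<close> keeps the increment of
    \<open>f\<close> within the factor \<open>1 + F\<close>, \<open>H * e2 \<le> 1/2\<close> allows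
    the absorption, and the remaining bounds give each error term half of
    \<open>\<epsilon>\<close>.\<close>
  define e1 where "e1 = min 1 (\<epsilon> / (2 * H))"
  define e2 where "e2 = min (1 / (2 * H)) (\<epsilon> / (4 * H * H * (1 + F)))"
  have e: "e1 > 0" "e1 \<le> 1" "H * e1 \<le> \<epsilon> / 2" "e2 > 0" "H * e2 \<le> 1/2" "H * e2 * (2 * H * (1 + F)) \<le> \<epsilon> / 2"
  proof -
    have "e1 \<le> \<epsilon> / (2 * H)" "e2 \<le> 1 / (2 * H)" "e2 \<le> \<epsilon> / (4 * H * H * (1 + F))"
      by (auto simp: e1_def e2_def)
    then show "H * e1 \<le> \<epsilon> / 2" "H * e2 \<le> 1/2"
      using H(1) by (auto simp: field_simps)
    have "4 * H * H * (1 + F) > 0" using H(1) F(1) by simp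
    then have "e2 * (4 * H * H * (1 + F)) \<le> \<epsilon>"
      using \<open>e2 \<le> \<epsilon> / (4 * H * H * (1 + F))\<close> by (simp add: pos_le_divide_eq)
    then show "H * e2 * (2 * H * (1 + F)) \<le> \<epsilon> / 2" by (simp add: algebra_simps)
  qed (use H(1) F(1) \<open>\<epsilon> > 0\<close> in \<open>auto simp: e1_def e2_def\<close>)
  obtain d1 where d1: "d1 > 0" "\<And>y. y \<in> S \<Longrightarrow> norm (y - x0) < d1 \<Longrightarrow>
      norm (f y - f x0 - f' (y - x0)) \<le> e1 * norm (y - x0)"
    using f e(1) unfolding has_derivative_within_alt by blast
  obtain d2 where d2: "d2 > 0" "\<And>z. z \<in> S' \<Longrightarrow> norm (z - c x0) < d2 \<Longrightarrow>
      norm (g z - g (c x0) - g' (z - c x0)) \<le> e2 * norm (z - c x0)"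
    using g e(4) unfolding has_derivative_within_alt by blast
  obtain d3 where d3: "d3 > 0" "\<And>y. y \<in> S \<Longrightarrow> dist y x0 < d3 \<Longrightarrow> dist (c y) (c x0) < d2"
    using c d2(1) unfolding continuous_within_eps_delta by blast
  have "norm (c y - c x0 - h (f' (y - x0))) \<le> \<epsilon> * norm (y - x0)"
    if y: "y \<in> S" "norm (y - x0) < min d1 d3" for y
  proof -
    define N where "N = norm (y - x0)"
    define C where "C = norm (c y - c x0)"
    define r where "r = g (c y) - g (c x0) - g' (c y - c x0)"
    define q where "q = f y - f x0 - f' (y - x0)"
    have r: "norm r \<le> e2 * C"
      unfolding r_def C_def using d3(2)[OF y(1)] y cS by (intro d2(2)) (auto simp: dist_norm)
    have q: "norm q \<le> e1 * N"
      unfolding q_def N_def using y by (intro d1(2)) auto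
    have fq: "f y - f x0 = q + f' (y - x0)" by (simp add: q_def)
    note lh = linear_add[OF bounded_linear.linear[OF h(1)]] linear_diff[OF bounded_linear.linear[OF h(1)]]
    have "h (g' (c y - c x0)) = c y - c x0" using h(2) cS y(1) by auto
    moreover have "g' (c y - c x0) = f y - f x0 - r"
      using gc y(1) x0 by (simp add: r_def)
    ultimately have c_eq: "c y - c x0 = h (f y - f x0) - h r" by (simp add: lh)
    have hr: "norm (h r) \<le> H * e2 * C"
      using order_trans[OF H(2)[of r] mult_right_mono[OF r, of H]] H(1) by (simp add: mult_ac)
    have "norm (h (f y - f x0)) \<le> H * (N * (1 + F))"
    proof -
      have "norm (f y - f x0) \<le> norm q + norm (f' (y - x0))" unfolding fq by (rule norm_triangle_ineq)
      also have "\<dots> \<le> e1 * N + N * F" using q F(2)[of "y - x0"] by (simp add: N_def)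
      also have "\<dots> \<le> N * (1 + F)"
        using e(2) mult_right_mono[of e1 1 N] by (simp add: N_def algebra_simps)
      finally show ?thesis using H(1) H(2)[of "f y - f x0"] by (smt (verit) mult.commute mult_left_mono)
    qed
    moreover have "C \<le> norm (h (f y - f x0)) + norm (h r)"
      unfolding C_def c_eq by (rule norm_triangle_ineq4)
    moreover have "norm (h r) \<le> 1/2 * C"
      using hr e(5) mult_right_mono[of "H * e2" "1/2" C] by (simp add: C_def)
    ultimately have C: "C \<le> 2 * H * (1 + F) * N" by (simp add: algebra_simps)
    have "c y - c x0 - h (f' (y - x0)) = h q - h r"
      unfolding c_eq fq by (simp add: lh)
    then have "norm (c y - c x0 - h (f' (y - x0))) \<le> norm (h q) + norm (h r)"
      by (simp add: norm_triangle_ineq4)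
    also have "norm (h q) \<le> H * e1 * N"
      using order_trans[OF H(2)[of q] mult_right_mono[OF q, of H]] H(1) by (simp add: mult_ac)
    also have "H * e1 * N \<le> \<epsilon> / 2 * N" using e(3) by (intro mult_right_mono) (auto simp: N_def)
    also have "norm (h r) \<le> H * e2 * (2 * H * (1 + F) * N)"
      by (rule order_trans[OF hr mult_left_mono[OF C]]) (use H(1) e(4) in simp)
    also have "\<dots> = H * e2 * (2 * H * (1 + F)) * N" by simp
    also have "\<dots> \<le> \<epsilon> / 2 * N" using e(6) by (intro mult_right_mono) (auto simp: N_def)
    finally show ?thesis by (simp add: N_def)
  qed
  then show "\<exists>d>0. \<forall>y\<in>S. norm (y - x0) < d \<longrightarrow>
      norm (c y - c x0 - h (f' (y - x0))) \<le> \<epsilon> * norm (y - x0)"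
    using d1(1) d3(1) by (intro exI[of _ "min d1 d3"]) auto
qed

section \<open>Symmetry of second derivatives\<close>

text \<open>Two applications of the mean value theorem: in direction \<open>v\<close> to the
  difference \<open>\<phi>\<close>, then in direction \<open>w\<close> to the derivative of
  \<open>G\<close> along \<open>v\<close>.\<close>

lemma second_difference:
  fixes G :: "'a::real_normed_vector \<Rightarrow> real"
  assumes G': "\<And>x. (G has_derivative G' x) (at x)"
    and H: "\<And>x. ((\<lambda>x. G' x v) has_derivative H x) (at x)" and "s > 0"
  obtains a b where "0 < a" "a < s" "0 < b" "b < s"
    "G (x + s *\<^sub>R v + s *\<^sub>R w) - G (x + s *\<^sub>R v) - G (x + s *\<^sub>R w) + G x = s * s * H (x + a *\<^sub>R v + b *\<^sub>R w) w"
proof -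
  define \<phi> where "\<phi> = (\<lambda>t. G (x + t *\<^sub>R v + s *\<^sub>R w) - G (x + t *\<^sub>R v))"
  have \<phi>': "(\<phi> has_real_derivative (G' (x + t *\<^sub>R v + s *\<^sub>R w) v - G' (x + t *\<^sub>R v) v)) (at t)" for t
  proof -
    have l: "linear (G' y)" for y using G' has_derivative_bounded_linear bounded_linear.linear by blast
    have "((\<lambda>t. G (x + t *\<^sub>R v + y)) has_derivative (\<lambda>d. G' (x + t *\<^sub>R v + y) (d *\<^sub>R v))) (at t)" for y
      by (rule has_derivative_compose[OF _ G']) (auto intro!: derivative_eq_intros)
    from has_derivative_diff[OF this[of "s *\<^sub>R w"] this[of 0]] show ?thesis
      unfolding \<phi>_def has_field_derivative_def add_0_right
      by (rule has_derivative_eq_rhs) (auto simp: linear_scale[OF l] algebra_simps)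
  qed
  obtain a where a: "0 < a" "a < s" "\<phi> s - \<phi> 0 = s * (G' (x + a *\<^sub>R v + s *\<^sub>R w) v - G' (x + a *\<^sub>R v) v)"
    using MVT2[OF \<open>s > 0\<close> \<phi>'] by auto
  define \<psi> where "\<psi> = (\<lambda>t. G' (x + a *\<^sub>R v + t *\<^sub>R w) v)"
  have \<psi>': "(\<psi> has_real_derivative H (x + a *\<^sub>R v + t *\<^sub>R w) w) (at t)" for t
  proof -
    have l: "linear (H y)" for y using H has_derivative_bounded_linear bounded_linear.linear by blast
    have "(\<psi> has_derivative (\<lambda>d. H (x + a *\<^sub>R v + t *\<^sub>R w) (d *\<^sub>R w))) (at t)"
      unfolding \<psi>_def by (rule has_derivative_compose[OF _ H]) (auto intro!: derivative_eq_intros)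
    then show ?thesis
      unfolding has_field_derivative_def by (simp add: linear_scale[OF l] mult.commute[of _ "H _ _"])
  qed
  obtain b where b: "0 < b" "b < s" "\<psi> s - \<psi> 0 = s * H (x + a *\<^sub>R v + b *\<^sub>R w) w"
    using MVT2[OF \<open>s > 0\<close> \<psi>'] by auto
  show thesis
    using a b by (intro that[of a b]) (auto simp: \<phi>_def \<psi>_def algebra_simps)
qed

text \<open>The second difference does not depend on the order of \<open>v\<close> and
  \<open>w\<close>. Evaluating it in both orders gives equal mixed derivatives at two points near
  \<open>x\<close>, and continuity lets both points tend to \<open>x\<close>.\<close>

lemma symmetric_second_derivative_real:
  fixes G :: "'a::real_normed_vector \<Rightarrow> real"
  assumes G': "\<And>x. (G has_derivative G' x) (at x)"
    and H: "\<And>x v. ((\<lambda>x. G' x v) has_derivative H v x) (at x)"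
    and cont: "\<And>v w. continuous_on UNIV (\<lambda>x. H v x w)"
  shows "H v x w = H w x v"
proof -
  have "\<exists>a b a' b'. 0 < a \<and> a < s \<and> 0 < b \<and> b < s \<and> 0 < a' \<and> a' < s \<and> 0 < b' \<and> b' < s \<and>
      H v (x + a *\<^sub>R v + b *\<^sub>R w) w = H w (x + a' *\<^sub>R w + b' *\<^sub>R v) v" if s: "s > 0" for s
  proof -
    obtain a b where ab: "0 < a" "a < s" "0 < b" "b < s"
      "G (x + s *\<^sub>R v + s *\<^sub>R w) - G (x + s *\<^sub>R v) - G (x + s *\<^sub>R w) + G x = s * s * H v (x + a *\<^sub>R v + b *\<^sub>R w) w"
      by (rule second_difference[OF G' H[of v] s, of x w])
    obtain a' b' where ab': "0 < a'" "a' < s" "0 < b'" "b' < s"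
      "G (x + s *\<^sub>R w + s *\<^sub>R v) - G (x + s *\<^sub>R w) - G (x + s *\<^sub>R v) + G x = s * s * H w (x + a' *\<^sub>R w + b' *\<^sub>R v) v"
      by (rule second_difference[OF G' H[of w] s, of x v])
    have eq: "x + s *\<^sub>R w + s *\<^sub>R v = x + s *\<^sub>R v + s *\<^sub>R w" by (simp add: add_ac)
    have "s * s * H v (x + a *\<^sub>R v + b *\<^sub>R w) w = s * s * H w (x + a' *\<^sub>R w + b' *\<^sub>R v) v"
      using ab(5) ab'(5)[unfolded eq] by linarith
    then have "H v (x + a *\<^sub>R v + b *\<^sub>R w) w = H w (x + a' *\<^sub>R w + b' *\<^sub>R v) v"
      using s by simp
    then show ?thesis using ab ab' by blast
  qed
  then have "\<forall>n. \<exists>a b a' b'. 0 < a \<and> a < inverse (real (Suc n)) \<and> 0 < b \<and> b < inverse (real (Suc n))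
      \<and> 0 < a' \<and> a' < inverse (real (Suc n)) \<and> 0 < b' \<and> b' < inverse (real (Suc n)) \<and>
      H v (x + a *\<^sub>R v + b *\<^sub>R w) w = H w (x + a' *\<^sub>R w + b' *\<^sub>R v) v"
    by (intro allI) simp
  then obtain a b a' b' where ab: "\<And>n. 0 < a n \<and> a n < inverse (real (Suc n))"
    "\<And>n. 0 < b n \<and> b n < inverse (real (Suc n))" "\<And>n. 0 < a' n \<and> a' n < inverse (real (Suc n))"
    "\<And>n. 0 < b' n \<and> b' n < inverse (real (Suc n))"
    "\<And>n. H v (x + a n *\<^sub>R v + b n *\<^sub>R w) w = H w (x + a' n *\<^sub>R w + b' n *\<^sub>R v) v"
    by metis
  have z: "t \<longlonglongrightarrow> 0" if "\<And>n. 0 < t n \<and> t n < inverse (real (Suc n))" for t :: "nat \<Rightarrow> real"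
    by (rule tendsto_sandwich[OF _ _ tendsto_const LIMSEQ_inverse_real_of_nat])
      (use that in \<open>auto intro!: always_eventually less_imp_le\<close>)
  have lim: "(\<lambda>n. H p (x + s n *\<^sub>R p + t n *\<^sub>R q) q) \<longlonglongrightarrow> H p x q"
    if "s \<longlonglongrightarrow> 0" "t \<longlonglongrightarrow> 0" for s t and p q
  proof -
    have "(\<lambda>n. x + s n *\<^sub>R p + t n *\<^sub>R q) \<longlonglongrightarrow> x + 0 *\<^sub>R p + 0 *\<^sub>R q"
      by (intro tendsto_intros that)
    then have "(\<lambda>n. x + s n *\<^sub>R p + t n *\<^sub>R q) \<longlonglongrightarrow> x" by simp
    from continuous_on_tendsto_compose[OF cont this] show ?thesis by simp
  qed
  show ?thesis
    using lim[OF z[OF ab(1)] z[OF ab(2)], of v w] lim[OF z[OF ab(3)] z[OF ab(4)], of w v]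
    unfolding ab(5) by (rule LIMSEQ_unique)
qed


section \<open>Calculus of smooth maps\<close>

abbreviation smooth :: "('a::real_normed_vector \<Rightarrow> 'b::real_normed_vector) \<Rightarrow> bool"
  where "smooth \<equiv> smooth_along UNIV UNIV"

lemma smooth_along_cong:
  "(\<And>x. x \<in> U \<Longrightarrow> f x = g x) \<Longrightarrow> smooth_along E U f \<longleftrightarrow> smooth_along E U g"
  unfolding smooth_along_def by (rule iff_allI, rule Ck_cong)

lemma smooth_along_const: "open_along E U \<Longrightarrow> smooth_along E U (\<lambda>x. c)"
  by (simp add: smooth_along_def Ck_const)

lemma smooth_along_id: "open_along E U \<Longrightarrow> smooth_along E U (\<lambda>x. x)"
  by (simp add: smooth_along_def Ck_id)

lemma smooth_along_linear:
  "open_along E U \<Longrightarrow> bounded_linear L \<Longrightarrow> smooth_along E U f \<Longrightarrow> smooth_along E U (\<lambda>x. L (f x))"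
  by (simp add: smooth_along_def Ck_linear)

lemma smooth_along_add:
  "open_along E U \<Longrightarrow> smooth_along E U f \<Longrightarrow> smooth_along E U g \<Longrightarrow> smooth_along E U (\<lambda>x. f x + g x)"
  by (simp add: smooth_along_def Ck_add)

lemma smooth_along_uminus:
  "open_along E U \<Longrightarrow> smooth_along E U f \<Longrightarrow> smooth_along E U (\<lambda>x. - f x)"
  by (rule smooth_along_linear[OF _ bounded_linear_minus[OF bounded_linear_ident]])

lemma smooth_along_diff:
  "open_along E U \<Longrightarrow> smooth_along E U f \<Longrightarrow> smooth_along E U g \<Longrightarrow> smooth_along E U (\<lambda>x. f x - g x)"
  using smooth_along_add[OF _ _ smooth_along_uminus, of E U f g] by simp

lemma smooth_along_sum:
  "open_along E U \<Longrightarrow> (\<And>i. i \<in> I \<Longrightarrow> smooth_along E U (f i)) \<Longrightarrow> smooth_along E U (\<lambda>x. \<Sum>i\<in>I. f i x)"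
  by (simp add: smooth_along_def Ck_sum)

lemma smooth_along_bilinear:
  "open_along E U \<Longrightarrow> bounded_bilinear B \<Longrightarrow> smooth_along E U f \<Longrightarrow> smooth_along E U g \<Longrightarrow>
    smooth_along E U (\<lambda>x. B (f x) (g x))"
  by (simp add: smooth_along_def Ck_bilinear)

lemma smooth_along_compose:
  fixes f :: "'a::real_normed_vector \<Rightarrow> 'b::real_normed_vector"
  assumes "fin_dim (UNIV :: 'b set)" "open_along E U" "open_along F V" "f ` U \<subseteq> V"
    "smooth_along E U f" "smooth_along F V g"
  shows "smooth_along E U (\<lambda>x. g (f x))"
  using assms(5,6) by (simp add: smooth_along_def Ck_compose[OF assms(1-4)])

lemma smooth_along_compose_smooth:
  fixes f :: "'a::real_normed_vector \<Rightarrow> 'b::real_normed_vector"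
  assumes "fin_dim (UNIV :: 'b set)" "open_along E U" "smooth_along E U f" "smooth g"
  shows "smooth_along E U (\<lambda>x. g (f x))"
  using smooth_along_compose[OF assms(1,2) _ _ assms(3,4)] by simp

lemma smooth_along_Pair:
  "open_along E U \<Longrightarrow> smooth_along E U f \<Longrightarrow> smooth_along E U g \<Longrightarrow> smooth_along E U (\<lambda>x. (f x, g x))"
  by (simp add: smooth_along_def Ck_Pair)

lemma smooth_along_subset:
  "open_along E U \<Longrightarrow> open_along E W \<Longrightarrow> W \<subseteq> U \<Longrightarrow> smooth_along E U f \<Longrightarrow> smooth_along E W f"
  by (simp add: smooth_along_def Ck_subset)

lemma smooth_along_of_smooth:
  fixes f :: "'a::real_normed_vector \<Rightarrow> 'b::real_normed_vector"
  assumes "fin_dim (UNIV :: 'a set)" "open_along E U" "smooth f"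
  shows "smooth_along E U f"
  using smooth_along_compose_smooth[OF assms(1,2) smooth_along_id[OF assms(2)] assms(3)] .

lemma smooth_along_local:
  assumes E: "open_along E U"
    and "\<And>x. x \<in> U \<Longrightarrow> \<exists>W. open_along E W \<and> x \<in> W \<and> W \<subseteq> U \<and> smooth_along E W f"
  shows "smooth_along E U f"
  unfolding smooth_along_def
proof
  fix k show "Ck_along k E U f"
    by (rule Ck_local[OF E]) (use assms(2) in \<open>force simp: smooth_along_def\<close>)
qed

lemma smooth_along_continuous_on:
  "open_along E U \<Longrightarrow> smooth_along E U f \<Longrightarrow> continuous_on U f"
  by (auto simp: smooth_along_def intro: Ck_continuous_on)

lemma smooth_has_derivative:
  "smooth f \<Longrightarrow> (f has_derivative frechet_derivative f (at x)) (at x)"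
  using smooth_along_derivative(1)[of UNIV UNIV f x] by simp

lemma smooth_linear_derivative: "smooth f \<Longrightarrow> linear (frechet_derivative f (at x))"
  by (rule bounded_linear.linear[OF has_derivative_bounded_linear[OF smooth_has_derivative]])

lemma smooth_derivative_along:
  fixes f :: "'a::real_normed_vector \<Rightarrow> 'b::real_normed_vector"
  assumes fd: "fin_dim (UNIV :: 'a set)" and f: "smooth f" and \<xi>: "smooth \<xi>"
  shows "smooth (\<lambda>x. frechet_derivative f (at x) (\<xi> x))"
proof -
  obtain I :: "'a set" and e :: "'a \<Rightarrow> 'a" and c :: "'a \<Rightarrow> 'a \<Rightarrow> real" where I: "finite I"
    "\<And>i. i \<in> I \<Longrightarrow> bounded_linear (c i)" "\<And>x. x = (\<Sum>i\<in>I. c i x *\<^sub>R e i)"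
    by (rule fin_dim_coordinates[OF fd subspace_UNIV]) auto
  have eq: "frechet_derivative f (at x) v = (\<Sum>i\<in>I. c i v *\<^sub>R frechet_derivative f (at x) (e i))" for x v
  proof -
    note l = smooth_linear_derivative[OF f, of x]
    have "frechet_derivative f (at x) v = frechet_derivative f (at x) (\<Sum>i\<in>I. c i v *\<^sub>R e i)"
      using I(3)[of v] by simp
    then show ?thesis by (simp only: linear_sum[OF l] linear_scale[OF l])
  qed
  have "smooth (\<lambda>x. \<Sum>i\<in>I. c i (\<xi> x) *\<^sub>R frechet_derivative f (at x) (e i))"
    using smooth_along_derivative(2)[OF _ f]
    by (intro smooth_along_sum smooth_along_bilinear[OF _ bounded_bilinear_scaleR] 
        smooth_along_linear[OF _ I(2) \<xi>]) auto
  moreover have "(\<lambda>x. frechet_derivative f (at x) (\<xi> x)) =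
      (\<lambda>x. \<Sum>i\<in>I. c i (\<xi> x) *\<^sub>R frechet_derivative f (at x) (e i))"
    by (rule ext) (rule eq)
  ultimately show ?thesis by (rule ssubst[rotated])
qed

text \<open>Evaluation at each \<open>a\<close> reduces the claim to the real-valued case, and such
  evaluations separate the elements of a dual.\<close>

lemma symmetric_second_derivative:
  fixes G :: "'m::real_normed_vector \<Rightarrow> 'a::real_normed_vector dual"
  assumes G: "smooth G"
  shows "frechet_derivative (\<lambda>x. frechet_derivative G (at x) v) (at x) w =
    frechet_derivative (\<lambda>x. frechet_derivative G (at x) w) (at x) v"
proof (rule blinfun_eqI)
  fix a :: 'a
  have l: "bounded_linear (\<lambda>\<mu>. blinfun_apply \<mu> a)" for a :: 'a
    by (rule blinfun.bounded_linear_left)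
  have G1: "smooth (\<lambda>x. frechet_derivative G (at x) v)" for v
    using smooth_along_derivative(2)[OF _ G, of v] by simp
  have G2: "smooth (\<lambda>x. frechet_derivative (\<lambda>x. frechet_derivative G (at x) v) (at x) w)" for v w
    using smooth_along_derivative(2)[OF _ G1, of w v] by simp
  show "blinfun_apply (frechet_derivative (\<lambda>x. frechet_derivative G (at x) v) (at x) w) a =
    blinfun_apply (frechet_derivative (\<lambda>x. frechet_derivative G (at x) w) (at x) v) a"
  proof (rule symmetric_second_derivative_real[where G = "\<lambda>x. G x a" and
        G' = "\<lambda>x v. frechet_derivative G (at x) v a" and
        H = "\<lambda>v x w. frechet_derivative (\<lambda>x. frechet_derivative G (at x) v) (at x) w a"])
    show "((\<lambda>x. G x a) has_derivative (\<lambda>v. frechet_derivative G (at x) v a)) (at x)" for x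
      by (rule bounded_linear.has_derivative[OF l smooth_has_derivative[OF G]])
    show "((\<lambda>x. frechet_derivative G (at x) v a) has_derivative
        (\<lambda>w. frechet_derivative (\<lambda>x. frechet_derivative G (at x) v) (at x) w a)) (at x)" for x v
      by (rule bounded_linear.has_derivative[OF l smooth_has_derivative[OF G1]])
    show "continuous_on UNIV (\<lambda>x. frechet_derivative (\<lambda>x. frechet_derivative G (at x) v) (at x) w a)" for v w
      using smooth_along_continuous_on[OF _ smooth_along_linear[OF _ l G2]] by simp
  qed
qed

lemma has_derivative_quadratic_remainder:
  assumes "bounded_linear D" "r > 0"
    and le: "\<And>y. norm (y - x) < r \<Longrightarrow> norm (f y - f x - D (y - x)) \<le> C * (norm (y - x))\<^sup>2"
  shows "(f has_derivative D) (at x)"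
  unfolding has_derivative_at_alt
proof (intro conjI allI impI assms(1))
  fix \<epsilon> :: real assume "\<epsilon> > 0"
  define d where "d = min r (\<epsilon> / (\<bar>C\<bar> + 1))"
  have "norm (f y - f x - D (y - x)) \<le> \<epsilon> * norm (y - x)" if y: "norm (y - x) < d" for y
  proof -
    have "norm (f y - f x - D (y - x)) \<le> C * (norm (y - x))\<^sup>2" using le y by (simp add: d_def)
    also have "\<dots> \<le> ((\<bar>C\<bar> + 1) * norm (y - x)) * norm (y - x)"
      unfolding power2_eq_square mult.assoc by (intro mult_right_mono) auto
    also have "\<dots> \<le> \<epsilon> * norm (y - x)"
      using y by (intro mult_right_mono) (auto simp: d_def field_simps)
    finally show ?thesis .
  qed
  then show "\<exists>d>0. \<forall>y. norm (y - x) < d \<longrightarrow> norm (f y - f x - D (y - x)) \<le> \<epsilon> * norm (y - x)"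
    using \<open>\<epsilon> > 0\<close> \<open>r > 0\<close> by (intro exI[of _ d]) (auto simp: d_def)
qed

section \<open>The exponential action\<close>

lemma real_exp_sums: "(\<lambda>n. (x::real) ^ n / fact n) sums exp x"
  using exp_converges[of x] by (simp add: scaleR_conv_of_real divide_inverse mult.commute)

locale fd_comm_algebra =
  fixes type :: "'a::{real_normed_vector, real_algebra, comm_ring} itself"
  assumes fin_dim_algebra: "fin_dim (UNIV :: 'a set)"
begin

lemma fin_dim_alg_dual: "fin_dim (UNIV :: 'a dual set)"
  by (rule fin_dim_dual[OF fin_dim_algebra])

text \<open>The norm of the algebra need not be submultiplicative; the product is continuous because
  the dimension is finite.\<close>

lemma bounded_bilinear_mult_alg: "bounded_bilinear ((*) :: 'a \<Rightarrow> 'a \<Rightarrow> 'a)"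
  by (rule fin_dim_bilinear_bounded[OF fin_dim_algebra fin_dim_algebra])
    (simp add: bilinear_def linear_iff algebra_simps)

lemma L_dual_apply [simp]: "blinfun_apply (L_dual u \<mu>) v = blinfun_apply \<mu> (u * v)" for u v :: 'a
  unfolding L_dual_def
  by (subst bounded_linear_Blinfun_apply)
    (auto intro!: bounded_linear_compose[OF blinfun.bounded_linear_right]
      bounded_bilinear.bounded_linear_right[OF bounded_bilinear_mult_alg])

lemma L_dual_add: "L_dual (u + v) \<mu> = L_dual u \<mu> + L_dual v \<mu>" for u v :: 'a
  by (rule blinfun_eqI) (simp add: blinfun.add_left blinfun.add_right distrib_right)

lemma L_dual_scaleR: "L_dual (c *\<^sub>R u) \<mu> = c *\<^sub>R L_dual u \<mu>" for u :: 'a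
  by (rule blinfun_eqI) (simp add: blinfun.scaleR_left blinfun.scaleR_right)

lemma L_dual_add_right: "L_dual u (\<mu> + \<nu>) = L_dual u \<mu> + L_dual u \<nu>" for u :: 'a
  by (rule blinfun_eqI) (simp add: blinfun.add_left)

lemma L_dual_scaleR_right: "L_dual u (c *\<^sub>R \<mu>) = c *\<^sub>R L_dual u \<mu>" for u :: 'a
  by (rule blinfun_eqI) (simp add: blinfun.scaleR_left)

lemma bounded_bilinear_L_dual: "bounded_bilinear (L_dual :: 'a \<Rightarrow> 'a dual \<Rightarrow> 'a dual)"
  by (rule fin_dim_bilinear_bounded[OF fin_dim_algebra fin_dim_alg_dual])
    (simp add: bilinear_def linear_iff L_dual_add L_dual_scaleR L_dual_add_right L_dual_scaleR_right)

lemmas bounded_linear_L_dual_left = bounded_bilinear.bounded_linear_left[OF bounded_bilinear_L_dual]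
lemmas bounded_linear_L_dual_right = bounded_bilinear.bounded_linear_right[OF bounded_bilinear_L_dual]
lemmas L_dual_diff = bounded_bilinear.diff_left[OF bounded_bilinear_L_dual]
lemmas L_dual_zero = bounded_bilinear.zero_left[OF bounded_bilinear_L_dual]
lemmas L_dual_zero_right = bounded_bilinear.zero_right[OF bounded_bilinear_L_dual]

lemma L_dual_L_dual: "L_dual u (L_dual v \<mu>) = L_dual (u * v) \<mu>" for u v :: 'a
  by (rule blinfun_eqI) (simp add: mult_ac)

lemma L_dual_commute: "L_dual u (L_dual v \<mu>) = L_dual v (L_dual u \<mu>)" for u v :: 'a
  by (simp add: L_dual_L_dual mult.commute)

lemma L_dual_bound:
  obtains M where "M > 0" "\<And>(u::'a) \<mu>. norm (L_dual u \<mu>) \<le> M * norm u * norm \<mu>"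
  using bounded_bilinear.pos_bounded[OF bounded_bilinear_L_dual] by (auto simp: mult_ac)

lemma L_dual_power_bound:
  fixes u :: 'a
  assumes M: "M > 0" "\<And>(u::'a) \<mu>. norm (L_dual u \<mu>) \<le> M * norm u * norm \<mu>"
  shows "norm ((L_dual u ^^ n) \<mu>) \<le> (M * norm u) ^ n * norm \<mu>"
proof (induction n)
  case (Suc n)
  have "norm ((L_dual u ^^ Suc n) \<mu>) \<le> M * norm u * norm ((L_dual u ^^ n) \<mu>)"
    using M(2) by simp
  also have "\<dots> \<le> M * norm u * ((M * norm u) ^ n * norm \<mu>)"
    using Suc M(1) by (intro mult_left_mono) auto
  finally show ?case by (simp add: mult_ac)
qed simp

lemma summable_Phi: "summable (\<lambda>n. norm ((L_dual u ^^ n) \<mu> /\<^sub>R fact n))" for u :: 'a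
proof -
  obtain M where M: "M > 0" "\<And>(u::'a) \<mu>. norm (L_dual u \<mu>) \<le> M * norm u * norm \<mu>"
    by (rule L_dual_bound) (rule that; assumption)
  have "summable (\<lambda>n. (M * norm u) ^ n / fact n * norm \<mu>)"
    by (intro summable_mult2 sums_summable[OF real_exp_sums])
  then show ?thesis
    by (rule summable_comparison_test'[where N = 0])
      (use L_dual_power_bound[OF M, where u = u and \<mu> = \<mu>] in \<open>auto simp: field_simps\<close>)
qed

lemma Phi_sums: "(\<lambda>n. (L_dual u ^^ n) \<mu> /\<^sub>R fact n) sums Phi u \<mu>" for u :: 'a
  unfolding Phi_def exp_endo_def by (rule summable_sums[OF summable_norm_cancel[OF summable_Phi]])

lemma linear_L_dual_power: "linear ((L_dual u ^^ n) :: 'a dual \<Rightarrow> 'a dual)" for u :: 'a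
  by (induction n) (auto simp: linear_iff L_dual_add_right L_dual_scaleR_right)

lemma linear_Phi: "linear (Phi u :: 'a dual \<Rightarrow> 'a dual)" for u :: 'a
proof (rule linearI)
  note l = linear_L_dual_power
  show "Phi u (\<mu> + \<nu>) = Phi u \<mu> + Phi u \<nu>" for \<mu> \<nu>
    using sums_unique2[OF Phi_sums[of u "\<mu> + \<nu>"]] sums_add[OF Phi_sums[of u \<mu>] Phi_sums[of u \<nu>]]
    by (simp add: linear_add[OF l] scaleR_add_right)
  show "Phi u (c *\<^sub>R \<mu>) = c *\<^sub>R Phi u \<mu>" for c \<mu>
    using sums_unique2[OF Phi_sums[of u "c *\<^sub>R \<mu>"]] sums_scaleR_right[OF Phi_sums[of u \<mu>], of c]
    by (simp add: linear_scale[OF l] mult.commute)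
qed

lemma bounded_linear_Phi: "bounded_linear (Phi u :: 'a dual \<Rightarrow> 'a dual)" for u :: 'a
  by (rule fin_dim_linear_bounded[OF fin_dim_alg_dual linear_Phi])

lemmas Phi_add_right = linear_add[OF linear_Phi]
lemmas Phi_diff_right = linear_diff[OF linear_Phi]
lemmas Phi_zero_right = linear_0[OF linear_Phi]

text \<open>Only the constant term of the exponential series survives. This makes the charts of an
  orbit independent of the choice of a lift.\<close>

lemma Phi_stabilizer:
  fixes k :: 'a
  assumes "L_dual k \<mu> = 0"
  shows "Phi k \<mu> = \<mu>"
proof -
  have "(L_dual k ^^ Suc n) \<mu> = 0" for n
    using assms by (induction n) (simp_all add: L_dual_zero_right)
  then have "(\<lambda>n. (L_dual k ^^ n) \<mu> /\<^sub>R fact n) = (\<lambda>n. if n = 0 then \<mu> else 0)"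
    by (auto simp: fun_eq_iff gr0_conv_Suc)
  then have "(\<lambda>n. (L_dual k ^^ n) \<mu> /\<^sub>R fact n) sums \<mu>"
    using sums_single[of 0 "\<lambda>_. \<mu>"] by simp
  then show ?thesis using Phi_sums sums_unique2 by blast
qed

lemma Phi_zero [simp]: "Phi 0 \<mu> = \<mu>" for \<mu> :: "'a dual"
  by (rule Phi_stabilizer) (rule L_dual_zero)

lemma Phi_commute_linear:
  fixes u :: 'a and T :: "'a dual \<Rightarrow> 'a dual"
  assumes T: "bounded_linear T" "\<And>\<mu>. T (L_dual u \<mu>) = L_dual u (T \<mu>)"
  shows "T (Phi u \<mu>) = Phi u (T \<mu>)"
proof -
  have "T ((L_dual u ^^ n) \<mu>) = (L_dual u ^^ n) (T \<mu>)" for n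
    by (induction n) (simp_all add: T(2))
  then have eq: "(\<lambda>n. T ((L_dual u ^^ n) \<mu> /\<^sub>R fact n)) = (\<lambda>n. (L_dual u ^^ n) (T \<mu>) /\<^sub>R fact n)"
    by (simp add: linear_scale[OF bounded_linear.linear[OF T(1)]])
  have "(\<lambda>n. (L_dual u ^^ n) (T \<mu>) /\<^sub>R fact n) sums T (Phi u \<mu>)"
    using bounded_linear.sums[OF T(1) Phi_sums[of u \<mu>]] by (simp only: eq)
  then show ?thesis by (rule sums_unique2[OF _ Phi_sums])
qed

lemma L_dual_Phi: "L_dual v (Phi u \<mu>) = Phi u (L_dual v \<mu>)" for u v :: 'a
  by (rule Phi_commute_linear[OF bounded_linear_L_dual_right L_dual_commute])

text \<open>Binomial theorem for commuting operators, normalised by factorials so that the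
  right-hand side is the \<open>n\<close>-th antidiagonal of the double exponential series.\<close>

lemma L_dual_add_power:
  fixes u v :: 'a
  shows "(L_dual (u + v) ^^ n) \<mu> /\<^sub>R fact n =
    (\<Sum>i\<le>n. (L_dual u ^^ i) ((L_dual v ^^ (n - i)) \<mu>) /\<^sub>R (fact i * fact (n - i)))"
proof -
  have comm: "L_dual v ((L_dual u ^^ i) \<nu>) = (L_dual u ^^ i) (L_dual v \<nu>)" for i \<nu>
    by (induction i) (simp_all, metis L_dual_commute)
  have "(L_dual (u + v) ^^ n) \<mu> =
    (\<Sum>i\<le>n. real (n choose i) *\<^sub>R (L_dual u ^^ i) ((L_dual v ^^ (n - i)) \<mu>))"
  proof (induction n)
    case (Suc n)
    define a where "a = (\<lambda>i j. (L_dual u ^^ i) ((L_dual v ^^ j) \<mu>))"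
    have au: "L_dual u (a i j) = a (Suc i) j" for i j by (simp add: a_def)
    have av: "L_dual v (a i j) = a i (Suc j)" for i j by (simp add: a_def comm)
    have "(L_dual (u + v) ^^ Suc n) \<mu> = L_dual (u + v) (\<Sum>i\<le>n. real (n choose i) *\<^sub>R a i (n - i))"
      using Suc by (simp add: a_def)
    also have "\<dots> = (\<Sum>i\<le>n. real (n choose i) *\<^sub>R a (Suc i) (n - i))
        + (\<Sum>i\<le>n. real (n choose i) *\<^sub>R a i (Suc (n - i)))"
      by (simp add: L_dual_add linear_sum[OF bounded_linear.linear[OF bounded_linear_L_dual_right]]
          L_dual_scaleR_right au av scaleR_add_right sum.distrib)
    also have "(\<Sum>i\<le>n. real (n choose i) *\<^sub>R a i (Suc (n - i)))
        = (\<Sum>i\<le>Suc n. real (n choose i) *\<^sub>R a i (Suc n - i))"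
      by (simp add: Suc_diff_le)
    also have "\<dots> = a 0 (Suc n) + (\<Sum>i\<le>n. real (n choose Suc i) *\<^sub>R a (Suc i) (n - i))"
      by (subst sum.atMost_Suc_shift) simp
    also have "(\<Sum>i\<le>n. real (n choose i) *\<^sub>R a (Suc i) (n - i)) +
        (a 0 (Suc n) + (\<Sum>i\<le>n. real (n choose Suc i) *\<^sub>R a (Suc i) (n - i)))
        = a 0 (Suc n) + (\<Sum>i\<le>n. real (Suc n choose Suc i) *\<^sub>R a (Suc i) (n - i))"
      by (simp add: sum.distrib scaleR_add_left)
    also have "\<dots> = (\<Sum>i\<le>Suc n. real (Suc n choose i) *\<^sub>R a i (Suc n - i))"
      by (subst sum.atMost_Suc_shift) simp
    finally show ?case by (simp only: a_def)
  qed simp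
  then have "(L_dual (u + v) ^^ n) \<mu> /\<^sub>R fact n =
    (\<Sum>i\<le>n. (real (n choose i) / fact n) *\<^sub>R (L_dual u ^^ i) ((L_dual v ^^ (n - i)) \<mu>))"
    by (simp add: scaleR_sum_right divide_inverse mult.commute)
  also have "\<dots> = (\<Sum>i\<le>n. (L_dual u ^^ i) ((L_dual v ^^ (n - i)) \<mu>) /\<^sub>R (fact i * fact (n - i)))"
    by (intro sum.cong refl) (simp add: binomial_fact field_simps)
  finally show ?thesis .
qed

text \<open>A Cauchy product for the double series of the two exponentials.\<close>

lemma Phi_add: "Phi (u + v) \<mu> = Phi u (Phi v \<mu>)" for u v :: 'a
proof -
  obtain M where M: "M > 0" "\<And>(u::'a) \<mu>. norm (L_dual u \<mu>) \<le> M * norm u * norm \<mu>"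
    by (rule L_dual_bound) (rule that; assumption)
  define a where "a = (\<lambda>(i, j). (L_dual u ^^ i) ((L_dual v ^^ j) \<mu>) /\<^sub>R (fact i * fact j))"
  \<comment> \<open>A summable majorant: the product of two real exponential series.\<close>
  define b where "b = (\<lambda>(i::nat, j::nat). ((M * norm u) ^ i / fact i) * ((M * norm v) ^ j / fact j * norm \<mu>))"
  have exp_hs: "((\<lambda>n. (M * norm w) ^ n / fact n) has_sum exp (M * norm w)) UNIV" for w :: 'a
    by (rule norm_summable_imp_has_sum) (use M(1) sums_summable[OF real_exp_sums] real_exp_sums in auto)
  define g where "g = (\<lambda>i. (M * norm u) ^ i / fact i * (exp (M * norm v) * norm \<mu>))"
  have "b summable_on UNIV \<times> UNIV"
  proof (rule summable_on_SigmaI)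
    show "((\<lambda>j. b (i, j)) has_sum g i) UNIV" for i
      unfolding b_def g_def prod.case by (intro has_sum_cmult_right has_sum_cmult_left exp_hs)
    show "g summable_on UNIV"
      unfolding g_def by (rule has_sum_imp_summable[OF has_sum_cmult_left[OF exp_hs]])
    show "b (i, j) \<ge> 0" for i j
      using M(1) by (simp add: b_def)
  qed
  then have "b summable_on UNIV" by simp
  moreover have "norm (a p) \<le> b p" for p
  proof -
    obtain i j where p: "p = (i, j)" by fastforce
    have "norm ((L_dual u ^^ i) ((L_dual v ^^ j) \<mu>)) \<le> (M * norm u) ^ i * ((M * norm v) ^ j * norm \<mu>)"
      using M(1) by (intro order_trans[OF L_dual_power_bound[OF M]] mult_left_mono L_dual_power_bound[OF M]) auto
    then show ?thesis by (simp add: p a_def b_def field_simps)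
  qed
  ultimately have sum_a: "a summable_on UNIV"
    by (rule abs_summable_summable[OF summable_on_comparison_test[of b]]) simp_all
  define S where "S = infsum a UNIV"
  have S: "(a has_sum S) (UNIV \<times> UNIV)" using sum_a by (simp add: S_def)
  have "((\<lambda>i. (L_dual u ^^ i) (Phi v \<mu>) /\<^sub>R fact i) has_sum S) UNIV"
  proof (rule has_sum_SigmaD[OF S])
    fix i
    have "bounded_linear (\<lambda>\<nu>. (L_dual u ^^ i) \<nu> /\<^sub>R fact i)"
      by (intro bounded_linear_compose[OF bounded_linear_scaleR_right]
          fin_dim_linear_bounded[OF fin_dim_alg_dual] linear_L_dual_power)
    moreover have "((\<lambda>j. (L_dual v ^^ j) \<mu> /\<^sub>R fact j) has_sum Phi v \<mu>) UNIV"
      by (rule norm_summable_imp_has_sum[OF summable_Phi Phi_sums])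
    ultimately have "((\<lambda>j. (L_dual u ^^ i) ((L_dual v ^^ j) \<mu> /\<^sub>R fact j) /\<^sub>R fact i) has_sum
        ((L_dual u ^^ i) (Phi v \<mu>) /\<^sub>R fact i)) UNIV"
      by (rule has_sum_bounded_linear)
    then show "((\<lambda>j. a (i, j)) has_sum ((L_dual u ^^ i) (Phi v \<mu>) /\<^sub>R fact i)) UNIV"
      by (simp add: a_def linear_scale[OF linear_L_dual_power])
  qed
  then have 1: "S = Phi u (Phi v \<mu>)"
    using has_sum_imp_sums Phi_sums sums_unique2 by blast
  \<comment> \<open>The index pairs \<open>(i, j)\<close> are regrouped along the antidiagonals
    \<open>n = i + j\<close>.\<close>
  have "((\<lambda>(n, i). a (i, n - i)) has_sum S) (SIGMA n:UNIV. {..n})"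
    using S by (subst has_sum_reindex_bij_witness[where T = "UNIV \<times> UNIV" and h = a and
        i = "\<lambda>(i, j). (i + j, i)" and j = "\<lambda>(n, i). (i, n - i)" and s' = S]) auto
  then have "((\<lambda>n. \<Sum>i\<le>n. a (i, n - i)) has_sum S) UNIV"
    by (rule has_sum_SigmaD) (auto intro: has_sum_finite)
  then have "((\<lambda>n. (L_dual (u + v) ^^ n) \<mu> /\<^sub>R fact n) has_sum S) UNIV"
    by (simp only: L_dual_add_power a_def prod.case)
  then have "S = Phi (u + v) \<mu>"
    using has_sum_imp_sums Phi_sums sums_unique2 by blast
  with 1 show ?thesis by simp
qed

lemma Phi_minus [simp]: "Phi (- u) (Phi u \<mu>) = \<mu>" "Phi u (Phi (- u) \<mu>) = \<mu>" for u :: 'a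
  using Phi_add[of "- u" u \<mu>] Phi_add[of u "- u" \<mu>] by simp_all

section \<open>Differentiability and smoothness of the action\<close>

text \<open>Splitting off two terms of the series leaves a tail that, because
  \<open>fact (n + 2)\<close> is at least \<open>fact n\<close>, is dominated by the square of
  \<open>M * norm v\<close> times a full exponential series.\<close>

lemma Phi_remainder:
  fixes v :: 'a
  assumes M: "M > 0" "\<And>(u::'a) \<mu>. norm (L_dual u \<mu>) \<le> M * norm u * norm \<mu>"
  shows "norm (Phi v x - x - L_dual v x) \<le> (M * norm v)\<^sup>2 * exp (M * norm v) * norm x"
proof -
  define f where "f = (\<lambda>n. (L_dual v ^^ n) x /\<^sub>R fact n)"
  have sf: "summable f" unfolding f_def by (rule summable_norm_cancel[OF summable_Phi])
  have "Phi v x = suminf f"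
    unfolding f_def using Phi_sums sums_unique by blast
  also have "\<dots> = (\<Sum>n. f (n + 2)) + (\<Sum>i<2. f i)" by (rule suminf_split_initial_segment[OF sf])
  also have "(\<Sum>i<2. f i) = x + L_dual v x" by (simp add: f_def numeral_2_eq_2)
  finally have eq: "Phi v x - x - L_dual v x = (\<Sum>n. f (n + 2))" by simp
  have g: "(\<lambda>n. (M * norm v)\<^sup>2 * ((M * norm v) ^ n / fact n) * norm x) sums
      ((M * norm v)\<^sup>2 * exp (M * norm v) * norm x)"
    by (intro sums_mult sums_mult2 real_exp_sums)
  have "norm (f (n + 2)) \<le> (M * norm v)\<^sup>2 * ((M * norm v) ^ n / fact n) * norm x" for n
  proof -
    have "norm (f (n + 2)) \<le> (M * norm v) ^ (n + 2) * norm x / fact (n + 2)"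
      using L_dual_power_bound[OF M, where u = v and n = "n + 2" and \<mu> = x] by (simp add: f_def field_simps del: funpow.simps fact_Suc power_Suc)
    also have "\<dots> \<le> (M * norm v) ^ (n + 2) * norm x / fact n"
      using M(1) by (intro divide_left_mono fact_mono) auto
    finally show ?thesis by (simp add: power_add power2_eq_square mult_ac)
  qed
  then have "norm (\<Sum>n. f (n + 2)) \<le> (\<Sum>n. (M * norm v)\<^sup>2 * ((M * norm v) ^ n / fact n) * norm x)"
    by (rule norm_suminf_le[OF _ sums_summable[OF g]])
  then show ?thesis unfolding eq using sums_unique[OF g] by simp
qed

text \<open>The action property moves the increment to the identity of the group:
  \<open>Phi u' \<mu>' = Phi u (Phi v (\<mu> + \<nu>))\<close>. There the error is quadratic;
  besides the series remainder it contains the mixed term \<open>L_dual v \<nu>\<close>.\<close>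

lemma Phi_has_derivative:
  "((\<lambda>p. Phi (fst p) (snd p)) has_derivative (\<lambda>q. Phi u (snd q + L_dual (fst q) \<mu>))) (at (u, \<mu>))"
  for u :: 'a and \<mu> :: "'a dual"
proof -
  obtain M where M: "M > 0" "\<And>(u::'a) \<mu>. norm (L_dual u \<mu>) \<le> M * norm u * norm \<mu>"
    by (rule L_dual_bound) (rule that; assumption)
  obtain K where K: "K > 0" "\<And>\<nu>. norm (Phi u \<nu>) \<le> norm \<nu> * K"
    using bounded_linear.pos_bounded[OF bounded_linear_Phi, of u] by blast
  \<comment> \<open>The bracket collects the series remainder, with
    \<open>norm (\<mu> + \<nu>)\<close> at most \<open>norm \<mu> + 1\<close> in the unit ball, and
    \<open>M\<close> for the mixed term; \<open>K\<close> bounds \<open>Phi u\<close>.\<close>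
  define C where "C = (M\<^sup>2 * exp M * (norm \<mu> + 1) + M) * K"
  show ?thesis
  proof (rule has_derivative_quadratic_remainder[where r = 1 and C = C])
    show "bounded_linear (\<lambda>q. Phi u (snd q + L_dual (fst q) \<mu>))"
      by (intro bounded_linear_compose[OF bounded_linear_Phi] bounded_linear_add bounded_linear_snd
          bounded_linear_compose[OF bounded_linear_L_dual_left] bounded_linear_fst)
    fix p :: "'a \<times> 'a dual"
    assume less: "norm (p - (u, \<mu>)) < 1"
    obtain u' \<mu>' where p: "p = (u', \<mu>')" by fastforce
    define v where "v = u' - u"
    define \<nu> where "\<nu> = \<mu>' - \<mu>"
    define r where "r = norm (p - (u, \<mu>))"
    have pe: "p - (u, \<mu>) = (v, \<nu>)" by (simp add: p v_def \<nu>_def)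
    have r: "norm v \<le> r" "norm \<nu> \<le> r" "r \<le> 1" "r \<ge> 0"
      using less norm_fst_le[of v \<nu>] norm_snd_le[of \<nu> v] by (auto simp: r_def pe)
    have "Phi u' \<mu>' = Phi u (Phi v (\<mu> + \<nu>))" by (simp add: Phi_add[symmetric] v_def \<nu>_def)
    then have eq: "Phi (fst p) (snd p) - Phi (fst (u, \<mu>)) (snd (u, \<mu>))
        - Phi u (snd (p - (u, \<mu>)) + L_dual (fst (p - (u, \<mu>))) \<mu>) =
        Phi u ((Phi v (\<mu> + \<nu>) - (\<mu> + \<nu>) - L_dual v (\<mu> + \<nu>)) + L_dual v \<nu>)"
      unfolding pe by (simp add: p Phi_add_right Phi_diff_right L_dual_add_right)
    have "norm (Phi v (\<mu> + \<nu>) - (\<mu> + \<nu>) - L_dual v (\<mu> + \<nu>)) \<le>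
        (M * norm v)\<^sup>2 * exp (M * norm v) * norm (\<mu> + \<nu>)"
      by (rule Phi_remainder[OF M])
    also have "\<dots> \<le> (M * r)\<^sup>2 * exp M * (norm \<mu> + 1)"
      using M(1) r norm_triangle_ineq[of \<mu> \<nu>]
      by (intro mult_mono power_mono) (auto intro!: mult_nonneg_nonneg mult_left_le)
    finally have 1: "norm (Phi v (\<mu> + \<nu>) - (\<mu> + \<nu>) - L_dual v (\<mu> + \<nu>)) \<le> (M\<^sup>2 * exp M * (norm \<mu> + 1)) * r\<^sup>2"
      by (simp add: power_mult_distrib mult_ac)
    have "norm (L_dual v \<nu>) \<le> M * norm v * norm \<nu>" by (rule M(2))
    also have "\<dots> \<le> M * r * r" using M(1) r by (intro mult_mono) auto
    finally have 2: "norm (L_dual v \<nu>) \<le> M * r\<^sup>2" by (simp add: power2_eq_square mult_ac)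
    have "norm ((Phi v (\<mu> + \<nu>) - (\<mu> + \<nu>) - L_dual v (\<mu> + \<nu>)) + L_dual v \<nu>) \<le>
        (M\<^sup>2 * exp M * (norm \<mu> + 1) + M) * r\<^sup>2"
      using norm_triangle_mono[OF 1 2] by (simp add: algebra_simps)
    then have "norm (Phi u ((Phi v (\<mu> + \<nu>) - (\<mu> + \<nu>) - L_dual v (\<mu> + \<nu>)) + L_dual v \<nu>)) \<le>
        (M\<^sup>2 * exp M * (norm \<mu> + 1) + M) * r\<^sup>2 * K"
      using K(1) by (intro order_trans[OF K(2)] mult_right_mono) auto
    then show "norm (Phi (fst p) (snd p) - Phi (fst (u, \<mu>)) (snd (u, \<mu>))
        - Phi u (snd (p - (u, \<mu>)) + L_dual (fst (p - (u, \<mu>))) \<mu>)) \<le> C * (norm (p - (u, \<mu>)))\<^sup>2"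
      unfolding eq by (simp add: C_def r_def mult_ac)
  qed simp
qed

lemma fin_dim_alg_prod: "fin_dim (UNIV :: ('a \<times> 'a dual) set)"
  by (rule fin_dim_prod[OF fin_dim_algebra fin_dim_alg_dual])

lemma smooth_Phi: "smooth (\<lambda>p. Phi (fst p) (snd p) :: 'a dual)"
  unfolding smooth_along_def
proof
  fix k
  let ?\<Phi> = "\<lambda>p. Phi (fst p :: 'a) (snd p)"
  have d: "(?\<Phi> has_derivative (\<lambda>q. Phi (fst p) (snd q + L_dual (fst q) (snd p)))) (at p within UNIV)" for p
    using Phi_has_derivative[of "fst p" "snd p"] by simp
  show "Ck_along k UNIV UNIV ?\<Phi>"
  proof (induction k)
    case 0
    have "continuous_on UNIV ?\<Phi>"
      by (rule has_derivative_continuous_on[OF d])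
    then show ?case by simp
  next
    case (Suc k)
    show ?case
    proof (rule Ck_SucI[where f' = "\<lambda>p q. Phi (fst p) (snd q + L_dual (fst q) (snd p))"])
      fix q :: "'a \<times> 'a dual"
      let ?a = "\<lambda>p::'a \<times> 'a dual. (fst p, snd q + L_dual (fst q) (snd p))"
      have "smooth ?a"
        by (intro smooth_along_Pair smooth_along_add smooth_along_const smooth_along_id
            smooth_along_linear[where L = fst] smooth_along_linear[where L = snd]
            smooth_along_linear[where L = "L_dual (fst q)"]
            bounded_linear_L_dual_right bounded_linear_fst bounded_linear_snd) simp_all
      then have a: "Ck_along k UNIV UNIV ?a" by (simp only: smooth_along_def)
      have "Ck_along k UNIV UNIV (\<lambda>p. ?\<Phi> (?a p))"
        by (rule Ck_compose[where f = ?a and g = ?\<Phi> and V = UNIV and F = UNIV, OF fin_dim_alg_prod _ _ _ a Suc.IH])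
          simp_all
      then show "Ck_along k UNIV UNIV (\<lambda>p. Phi (fst p) (snd q + L_dual (fst q) (snd p)))" by simp
    qed (use d in simp_all)
  qed
qed

lemma smooth_along_Phi:
  fixes u :: "'m::real_normed_vector \<Rightarrow> 'a"
  assumes E: "open_along E U" and "smooth_along E U u" "smooth_along E U \<mu>"
  shows "smooth_along E U (\<lambda>x. Phi (u x) (\<mu> x))"
  using smooth_along_compose_smooth[OF fin_dim_alg_prod E smooth_along_Pair[OF E assms(2,3)] smooth_Phi]
  by simp

lemma smooth_orbit_map: "smooth (\<lambda>u::'a. Phi u \<mu>)"
  by (intro smooth_along_Phi smooth_along_id smooth_along_const) simp_all

lemma orbit_map_has_derivative:
  "((\<lambda>u. Phi u \<mu>) has_derivative (\<lambda>v. L_dual v (Phi u \<mu>))) (at u)" for u :: 'a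
proof -
  have "((\<lambda>u. (u, \<mu>)) has_derivative (\<lambda>v. (v, 0))) (at u)"
    by (auto intro!: derivative_eq_intros)
  from has_derivative_compose[OF this Phi_has_derivative[of u \<mu>]]
  have "((\<lambda>u. Phi u \<mu>) has_derivative (\<lambda>v. Phi u (0 + L_dual v \<mu>))) (at u)" by simp
  then show ?thesis by (simp add: L_dual_Phi)
qed

lemma smooth_linear_action_Phi: "smooth_linear_action (Phi :: 'a \<Rightarrow> 'a dual \<Rightarrow> 'a dual)"
  unfolding smooth_linear_action_def using smooth_Phi by (simp add: Phi_add linear_Phi)

end

section \<open>The flat structure of the ambient space\<close>

lemma frechet_derivative_eq: "(f has_derivative D) (at x) \<Longrightarrow> frechet_derivative f (at x) = D"
  using frechet_derivative_at by metis

lemma atin_euclidean: "atin euclidean x = at x"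
  by (rule filter_eqI) (auto simp: eventually_atin eventually_at_topological)

lemma dir_euclidean: "dir euclidean X F x = frechet_derivative F (at x) (X x)"
  by (simp add: dir_def atin_euclidean)

lemma parametrization_open_along: "parametrization \<tau> E U f \<Longrightarrow> open_along E U"
  by (simp add: parametrization_def open_along_def)

lemma parametrization_euclidean_id:
  "parametrization euclidean UNIV UNIV (\<lambda>x::'v::real_normed_vector. x)"
  by (simp add: parametrization_def smooth_along_id frechet_derivative_eq[OF has_derivative_ident]
      homeomorphic_map_maps homeomorphic_maps_def exI[of _ "\<lambda>x. x"])

lemma smooth_map_euclidean_iff:
  fixes F :: "'v::real_normed_vector \<Rightarrow> 'b::real_normed_vector"
  assumes fd: "fin_dim (UNIV :: 'v set)"
  shows "smooth_map euclidean F \<longleftrightarrow> smooth F"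
proof
  assume "smooth_map euclidean F"
  then have "smooth (F \<circ> (\<lambda>x. x))"
    unfolding smooth_map_def using parametrization_euclidean_id by blast
  then show "smooth F" by (simp add: o_def)
next
  assume F: "smooth F"
  show "smooth_map euclidean F"
    unfolding smooth_map_def o_def
  proof (intro allI impI)
    fix E U and f :: "'v \<Rightarrow> 'v" assume p: "parametrization euclidean E U f"
    then show "smooth_along E U (\<lambda>x. F (f x))"
      using smooth_along_compose_smooth[OF fd parametrization_open_along[OF p] _ F]
      by (simp add: parametrization_def)
  qed
qed

lemma tangent_euclidean: "tangent euclidean (x::'v::real_normed_vector) = UNIV"
proof -
  have "v \<in> tangent euclidean x" for v
    unfolding tangent_def mem_Collect_eq
    by (intro exI[of _ "\<lambda>x. x"] exI[of _ UNIV] exI[of _ x] exI[of _ v])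
      (simp add: parametrization_euclidean_id frechet_derivative_eq[OF has_derivative_ident])
  then show ?thesis by blast
qed

lemma vector_field_euclidean_iff:
  fixes X :: "'v::real_normed_vector \<Rightarrow> 'v"
  assumes "fin_dim (UNIV :: 'v set)"
  shows "vector_field euclidean X \<longleftrightarrow> smooth X"
  by (simp add: vector_field_def smooth_map_euclidean_iff[OF assms] tangent_euclidean)

text \<open>In coordinates the function is a finite sum of products of scalar and vector functions,
  so the product rule separates the variation of the base point, with the direction frozen at
  \<open>\<xi> x\<close>, from the variation of the direction.\<close>

lemma derivative_along_has_derivative:
  fixes f :: "'m::real_normed_vector \<Rightarrow> 'b::real_normed_vector"
  assumes fd: "fin_dim (UNIV :: 'm set)" and f: "smooth f" and \<xi>: "smooth \<xi>"
  shows "((\<lambda>y. frechet_derivative f (at y) (\<xi> y)) has_derivative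
    (\<lambda>v. frechet_derivative (\<lambda>y. frechet_derivative f (at y) (\<xi> x)) (at x) v
       + frechet_derivative f (at x) (frechet_derivative \<xi> (at x) v))) (at x)"
proof -
  obtain I :: "'m set" and e :: "'m \<Rightarrow> 'm" and c :: "'m \<Rightarrow> 'm \<Rightarrow> real" where I: "finite I"
    "\<And>i. i \<in> I \<Longrightarrow> bounded_linear (c i)" "\<And>x. x = (\<Sum>i\<in>I. c i x *\<^sub>R e i)"
    by (rule fin_dim_coordinates[OF fd subspace_UNIV]) auto
  define A where "A = (\<lambda>i y. frechet_derivative f (at y) (e i))"
  have A: "(A i has_derivative frechet_derivative (A i) (at x)) (at x)" for i
    unfolding A_def using smooth_along_derivative(2)[OF _ f] by (intro smooth_has_derivative) simp
  have eq: "frechet_derivative f (at y) w = (\<Sum>i\<in>I. c i w *\<^sub>R A i y)" for y w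
  proof -
    note l = smooth_linear_derivative[OF f, of y]
    have "frechet_derivative f (at y) w = frechet_derivative f (at y) (\<Sum>i\<in>I. c i w *\<^sub>R e i)"
      using I(3)[of w] by simp
    then show ?thesis by (simp only: linear_sum[OF l] linear_scale[OF l] A_def)
  qed
  have 1: "((\<lambda>y. \<Sum>i\<in>I. c i (\<xi> y) *\<^sub>R A i y) has_derivative
      (\<lambda>v. \<Sum>i\<in>I. c i (\<xi> x) *\<^sub>R frechet_derivative (A i) (at x) v
        + c i (frechet_derivative \<xi> (at x) v) *\<^sub>R A i x)) (at x)"
    by (intro has_derivative_sum has_derivative_scaleR A
        bounded_linear.has_derivative[OF I(2) smooth_has_derivative[OF \<xi>]])
  have 2: "((\<lambda>y. \<Sum>i\<in>I. c i (\<xi> x) *\<^sub>R A i y) has_derivative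
      (\<lambda>v. \<Sum>i\<in>I. c i (\<xi> x) *\<^sub>R frechet_derivative (A i) (at x) v)) (at x)"
    by (intro has_derivative_sum has_derivative_scaleR_right A)
  have 3: "(\<lambda>y. frechet_derivative f (at y) (\<xi> x)) = (\<lambda>y. \<Sum>i\<in>I. c i (\<xi> x) *\<^sub>R A i y)"
    "(\<lambda>y. frechet_derivative f (at y) (\<xi> y)) = (\<lambda>y. \<Sum>i\<in>I. c i (\<xi> y) *\<^sub>R A i y)"
    by (intro ext eq)+
  show ?thesis
    unfolding 3 frechet_derivative_eq[OF 2] eq[of x "frechet_derivative \<xi> (at x) _"] sum.distrib[symmetric]
    by (rule 1)
qed

text \<open>Symmetry cancels the second-order terms. With the dual as domain this gives flatness of
  the ambient connection, with the algebra as domain flatness on the orbits.\<close>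

lemma derivative_along_commutator:
  fixes Z :: "'m::real_normed_vector \<Rightarrow> 'a::real_normed_vector dual"
  assumes fd: "fin_dim (UNIV :: 'm set)" and Z: "smooth Z" and X: "smooth X" and Y: "smooth Y"
  shows "frechet_derivative (\<lambda>y. frechet_derivative Z (at y) (Y y)) (at x) (X x)
    - frechet_derivative (\<lambda>y. frechet_derivative Z (at y) (X y)) (at x) (Y x)
    = frechet_derivative Z (at x) (frechet_derivative Y (at x) (X x) - frechet_derivative X (at x) (Y x))"
  unfolding frechet_derivative_eq[OF derivative_along_has_derivative[OF fd Z X]]
    frechet_derivative_eq[OF derivative_along_has_derivative[OF fd Z Y]]
    linear_diff[OF smooth_linear_derivative[OF Z]]
  by (simp add: symmetric_second_derivative[OF Z, of "X x" x "Y x"])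

lemma smooth_derivative_add:
  "smooth f \<Longrightarrow> smooth g \<Longrightarrow>
    frechet_derivative (\<lambda>y. f y + g y) (at x) v = frechet_derivative f (at x) v + frechet_derivative g (at x) v"
  by (subst frechet_derivative_eq[OF has_derivative_add[OF smooth_has_derivative smooth_has_derivative]]) auto

lemma smooth_derivative_bilinear:
  assumes "bounded_bilinear B" "smooth f" "smooth g"
  shows "frechet_derivative (\<lambda>y. B (f y) (g y)) (at x) v =
    B (f x) (frechet_derivative g (at x) v) + B (frechet_derivative f (at x) v) (g x)"
  by (subst frechet_derivative_eq[OF bounded_bilinear.FDERIV[OF assms(1) smooth_has_derivative[OF assms(2)]
          smooth_has_derivative[OF assms(3)]]]) simp

lemma affine_connection_nabla0:
  assumes fd: "fin_dim (UNIV :: 'v::real_normed_vector set)"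
  shows "affine_connection euclidean (nabla0 :: 'v connection)"
proof -
  note [simp] = vector_field_euclidean_iff[OF fd] smooth_map_euclidean_iff[OF fd]
  show ?thesis
    unfolding affine_connection_def nabla0_def
  proof (intro conjI allI impI ballI, goal_cases)
    case (1 X Y)
    then show ?case using smooth_derivative_along[OF fd] by simp
  next
    case (2 X X' Y x)
    then show ?case using linear_add[OF smooth_linear_derivative[of Y]] by simp
  next
    case (3 \<phi> X Y x)
    then show ?case using linear_scale[OF smooth_linear_derivative[of Y]] by simp
  next
    case (4 X Y Y' x)
    then show ?case by (simp add: smooth_derivative_add)
  next
    case (5 \<phi> X Y x)
    then show ?case by (simp add: dir_euclidean smooth_derivative_bilinear[OF bounded_bilinear_scaleR])
  qed
qed

lemma torsion_free_nabla0: "torsion_free euclidean nabla0"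
  by (simp add: torsion_free_def nabla0_def lie_bracket_def dir_euclidean)

lemma flat_nabla0:
  assumes fd: "fin_dim (UNIV :: 'a::real_normed_vector dual set)"
  shows "flat euclidean (nabla0 :: 'a dual connection)"
  unfolding flat_def nabla0_def lie_bracket_def dir_euclidean vector_field_euclidean_iff[OF fd]
  by (simp add: derivative_along_commutator[OF fd])

section \<open>The bivector field of the algebra\<close>

context fd_comm_algebra
begin

lemma one_form_iff: "one_form \<alpha> \<longleftrightarrow> smooth (\<alpha> :: 'a dual \<Rightarrow> 'a)"
  by (simp add: one_form_def smooth_map_euclidean_iff[OF fin_dim_alg_dual])

lemmas vector_field_dual_iff = vector_field_euclidean_iff[OF fin_dim_alg_dual]

lemma sharp_alg_bivector: "sharp alg_bivector \<mu> u = L_dual u \<mu>" for u :: 'a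
proof -
  have "alg_bivector \<mu> u = (\<lambda>v. blinfun_apply \<mu> (u * v))" by (auto simp: alg_bivector_def)
  then show ?thesis by (simp add: sharp_def L_dual_def)
qed

lemma image_distribution_alg: "image_distribution alg_bivector \<mu> = range (\<lambda>u::'a. L_dual u \<mu>)"
  by (simp add: image_distribution_def sharp_alg_bivector)

lemma sharp_field_alg: "sharp_field alg_bivector \<alpha> = (\<lambda>\<mu>. L_dual (\<alpha> \<mu>) \<mu>)" for \<alpha> :: "'a dual \<Rightarrow> 'a"
  by (simp add: sharp_field_def sharp_alg_bivector)

lemma smooth_apply:
  assumes "open_along E U" "smooth_along E U Y" "smooth_along E U \<alpha>"
  shows "smooth_along E U (\<lambda>\<nu>. blinfun_apply (Y \<nu>) (\<alpha> \<nu>))"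
  by (rule smooth_along_bilinear[OF assms(1) bounded_bilinear_blinfun_apply assms(2,3)])

lemma smooth_mult:
  fixes \<alpha> \<beta> :: "'m::real_normed_vector \<Rightarrow> 'a"
  assumes "open_along E U" "smooth_along E U \<alpha>" "smooth_along E U \<beta>"
  shows "smooth_along E U (\<lambda>\<nu>. \<alpha> \<nu> * \<beta> \<nu>)"
  by (rule smooth_along_bilinear[OF assms(1) bounded_bilinear_mult_alg assms(2,3)])

lemma smooth_L_dual:
  fixes \<alpha> :: "'m::real_normed_vector \<Rightarrow> 'a"
  assumes "open_along E U" "smooth_along E U \<alpha>" "smooth_along E U Y"
  shows "smooth_along E U (\<lambda>\<nu>. L_dual (\<alpha> \<nu>) (Y \<nu>))"
  by (rule smooth_along_bilinear[OF assms(1) bounded_bilinear_L_dual assms(2,3)])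

lemmas derivative_apply = smooth_derivative_bilinear[OF bounded_bilinear_blinfun_apply]
lemmas derivative_mult = smooth_derivative_bilinear[OF bounded_bilinear_mult_alg]
lemmas derivative_L_dual = smooth_derivative_bilinear[OF bounded_bilinear_L_dual]

lemma derivative_ident: "frechet_derivative (\<lambda>x. x) (at x) v = v"
  by (simp add: frechet_derivative_eq[OF has_derivative_ident])

text \<open>Evaluates the descriptions in \<open>dual_connection\<close> and
  \<open>form_connection\<close>. Constant vector fields already determine the covector, since the
  dual separates points.\<close>

lemma the_covector:
  fixes \<mu> :: "'a dual"
  assumes "\<And>Y :: 'a dual \<Rightarrow> 'a dual. smooth Y \<Longrightarrow> blinfun_apply (Y \<mu>) u = r Y"
  shows "(THE u::'a. \<forall>Y. vector_field euclidean Y \<longrightarrow> blinfun_apply (Y \<mu>) u = r Y) = u"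
proof (rule the_equality)
  show "\<forall>Y. vector_field euclidean Y \<longrightarrow> blinfun_apply (Y \<mu>) u = r Y"
    using assms by (simp add: vector_field_dual_iff)
  fix w assume w: "\<forall>Y. vector_field euclidean Y \<longrightarrow> blinfun_apply (Y \<mu>) w = r Y"
  have "blinfun_apply \<nu> (w - u) = 0" for \<nu> :: "'a dual"
  proof -
    have "smooth (\<lambda>_::'a dual. \<nu>)" by (simp add: smooth_along_const)
    with w[rule_format, of "\<lambda>_. \<nu>"] assms[of "\<lambda>_. \<nu>"] show ?thesis
      by (simp add: vector_field_dual_iff blinfun.diff_right)
  qed
  then show "w = u" using dual_separates[OF fin_dim_algebra, of "w - u"] by simp
qed

section \<open>Covariant derivatives of the bivector field and of the cubic form\<close>

lemma dual_connection_nabla0: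
  assumes \<alpha>: "smooth (\<alpha> :: 'a dual \<Rightarrow> 'a)"
  shows "dual_connection nabla0 X \<alpha> \<mu> = frechet_derivative \<alpha> (at \<mu>) (X \<mu>)"
  unfolding dual_connection_def
  by (rule the_covector) (simp add: dir_euclidean nabla0_def derivative_apply[OF _ \<alpha>])

text \<open>The variations of \<open>\<alpha>\<close> and \<open>\<beta>\<close> cancel against the
  dual connection; what remains is the variation of the base point, in which the bivector is
  linear.\<close>

lemma cov_bivector_alg:
  assumes \<alpha>: "smooth (\<alpha> :: 'a dual \<Rightarrow> 'a)" and \<beta>: "smooth \<beta>"
  shows "cov_bivector nabla0 alg_bivector X \<alpha> \<beta> \<mu> = blinfun_apply (X \<mu>) (\<alpha> \<mu> * \<beta> \<mu>)"
proof -
  have "smooth (\<lambda>\<nu>. \<alpha> \<nu> * \<beta> \<nu>)" using \<alpha> \<beta> by (simp add: smooth_mult)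
  then show ?thesis
    unfolding cov_bivector_def dual_connection_nabla0[OF \<alpha>] dual_connection_nabla0[OF \<beta>]
      dir_euclidean alg_bivector_def
    by (simp add: derivative_apply smooth_along_id derivative_ident derivative_mult[OF \<alpha> \<beta>]
        blinfun.add_right)
qed

lemma symmetric_bivector_field_alg: "symmetric_bivector_field (alg_bivector :: 'a bivector)"
  unfolding symmetric_bivector_field_def
proof (intro conjI allI impI)
  show "bilinear (alg_bivector \<mu> :: 'a \<Rightarrow> 'a \<Rightarrow> real)" for \<mu> :: "'a dual"
    by (simp add: bilinear_def linear_iff alg_bivector_def blinfun.add_right blinfun.scaleR_right
        distrib_left distrib_right)
  show "alg_bivector \<mu> u v = alg_bivector \<mu> v u" for \<mu> and u v :: 'a
    by (simp add: alg_bivector_def mult.commute)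
  show "smooth_map euclidean (\<lambda>\<mu>. alg_bivector \<mu> (\<alpha> \<mu>) (\<beta> \<mu>))"
    if "one_form \<alpha>" "one_form \<beta>" for \<alpha> \<beta> :: "'a dual \<Rightarrow> 'a"
    using that unfolding one_form_iff smooth_map_euclidean_iff[OF fin_dim_alg_dual] alg_bivector_def
    by (intro smooth_apply smooth_along_id smooth_mult) simp_all
qed

lemma cubic_form_alg:
  assumes "smooth (\<beta> :: 'a dual \<Rightarrow> 'a)" "smooth \<gamma>"
  shows "cov_bivector nabla0 alg_bivector (sharp_field alg_bivector \<alpha>) \<beta> \<gamma> \<mu>
    = blinfun_apply \<mu> (\<alpha> \<mu> * \<beta> \<mu> * \<gamma> \<mu>)"
  by (simp add: cov_bivector_alg[OF assms] sharp_field_alg mult.assoc)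

lemma generalized_pseudo_Hessian_alg: "generalized_pseudo_Hessian nabla0 (alg_bivector :: 'a bivector)"
  unfolding generalized_pseudo_Hessian_def
  using affine_connection_nabla0[OF fin_dim_alg_dual] torsion_free_nabla0
    flat_nabla0[OF fin_dim_alg_dual] symmetric_bivector_field_alg
  by (simp add: one_form_iff cubic_form_alg mult.commute)

lemma form_connection_alg:
  assumes \<alpha>: "smooth (\<alpha> :: 'a dual \<Rightarrow> 'a)" and \<beta>: "smooth \<beta>"
  shows "form_connection nabla0 alg_bivector \<alpha> \<beta> \<mu> =
    \<alpha> \<mu> * \<beta> \<mu> + frechet_derivative \<beta> (at \<mu>) (L_dual (\<alpha> \<mu>) \<mu>)"
  unfolding form_connection_def
  by (rule the_covector)
    (simp add: cov_bivector_alg[OF \<alpha> \<beta>] dual_connection_nabla0[OF \<beta>] sharp_field_alg blinfun.add_right)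

lemma smooth_form_connection:
  assumes \<alpha>: "smooth (\<alpha> :: 'a dual \<Rightarrow> 'a)" and \<beta>: "smooth \<beta>"
  shows "smooth (form_connection nabla0 alg_bivector \<alpha> \<beta>)"
proof -
  have "form_connection nabla0 alg_bivector \<alpha> \<beta> =
      (\<lambda>\<mu>. \<alpha> \<mu> * \<beta> \<mu> + frechet_derivative \<beta> (at \<mu>) (L_dual (\<alpha> \<mu>) \<mu>))"
    by (rule ext) (rule form_connection_alg[OF \<alpha> \<beta>])
  moreover have "smooth (\<lambda>\<mu>. \<alpha> \<mu> * \<beta> \<mu> + frechet_derivative \<beta> (at \<mu>) (L_dual (\<alpha> \<mu>) \<mu>))"
    by (intro smooth_along_add smooth_mult \<alpha> \<beta> smooth_derivative_along[OF fin_dim_alg_dual \<beta>]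
        smooth_L_dual smooth_along_id) simp_all
  ultimately show ?thesis by (simp only:)
qed

text \<open>Varying the base point contributes the quartic term once, and the product part of
  \<open>D\<close> subtracts it once in each of the three corrections; hence the factor
  \<open>- 2\<close>. All derivatives of the forms cancel.\<close>

lemma cubic_form_derivative:
  assumes \<alpha>: "smooth (\<alpha> :: 'a dual \<Rightarrow> 'a)" and \<beta>: "smooth \<beta>" and \<gamma>: "smooth \<gamma>" and \<delta>: "smooth \<delta>"
  defines "T \<equiv> \<lambda>\<alpha> \<beta> \<gamma>. cov_bivector nabla0 alg_bivector (sharp_field alg_bivector \<alpha>) \<beta> \<gamma>"
    and "D \<equiv> form_connection nabla0 (alg_bivector :: 'a bivector)"
  shows "dir euclidean (sharp_field alg_bivector \<delta>) (T \<alpha> \<beta> \<gamma>) \<mu>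
    - T (D \<delta> \<alpha>) \<beta> \<gamma> \<mu> - T \<alpha> (D \<delta> \<beta>) \<gamma> \<mu> - T \<alpha> \<beta> (D \<delta> \<gamma>) \<mu>
    = - 2 * blinfun_apply \<mu> (\<alpha> \<mu> * \<beta> \<mu> * \<gamma> \<mu> * \<delta> \<mu>)"
proof -
  have ab: "smooth (\<lambda>\<mu>. \<alpha> \<mu> * \<beta> \<mu>)" using \<alpha> \<beta> by (simp add: smooth_mult)
  have abc: "smooth (\<lambda>\<mu>. \<alpha> \<mu> * \<beta> \<mu> * \<gamma> \<mu>)" using ab \<gamma> by (simp add: smooth_mult)
  have T: "T \<alpha> \<beta> \<gamma> = (\<lambda>\<mu>. blinfun_apply \<mu> (\<alpha> \<mu> * \<beta> \<mu> * \<gamma> \<mu>))"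
    unfolding T_def by (rule ext) (rule cubic_form_alg[OF \<beta> \<gamma>])
  have "dir euclidean (sharp_field alg_bivector \<delta>) (T \<alpha> \<beta> \<gamma>) \<mu> =
    blinfun_apply \<mu> (frechet_derivative (\<lambda>\<mu>. \<alpha> \<mu> * \<beta> \<mu> * \<gamma> \<mu>) (at \<mu>) (L_dual (\<delta> \<mu>) \<mu>))
    + blinfun_apply (L_dual (\<delta> \<mu>) \<mu>) (\<alpha> \<mu> * \<beta> \<mu> * \<gamma> \<mu>)"
    unfolding T dir_euclidean sharp_field_alg
    by (simp add: derivative_apply[OF smooth_along_id abc] derivative_ident)
  then show ?thesis
    unfolding derivative_mult[OF ab \<gamma>] derivative_mult[OF \<alpha> \<beta>]
    unfolding T_def D_def cubic_form_alg[OF \<beta> \<gamma>] cubic_form_alg[OF smooth_form_connection[OF \<delta> \<beta>] \<gamma>]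
      cubic_form_alg[OF \<beta> smooth_form_connection[OF \<delta> \<gamma>]]
      form_connection_alg[OF \<delta> \<alpha>] form_connection_alg[OF \<delta> \<beta>] form_connection_alg[OF \<delta> \<gamma>]
    by (simp add: blinfun.add_right distrib_left distrib_right mult_ac)
qed

lemma generalized_affine_special_real_alg_iff:
  "generalized_affine_special_real nabla0 (alg_bivector :: 'a bivector) \<longleftrightarrow>
    (\<forall>u v w x :: 'a. u * v * w * x = 0)"
proof
  assume "generalized_affine_special_real nabla0 (alg_bivector :: 'a bivector)"
  then have *: "blinfun_apply \<mu> (\<alpha> \<mu> * \<beta> \<mu> * \<gamma> \<mu> * \<delta> \<mu>) = 0"
    if "smooth \<alpha>" "smooth \<beta>" "smooth \<gamma>" "smooth \<delta>" for \<alpha> \<beta> \<gamma> \<delta> and \<mu> :: "'a dual"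
    using cubic_form_derivative[OF that, of \<mu>] that
    unfolding generalized_affine_special_real_def Let_def one_form_iff by simp
  \<comment> \<open>Constant forms turn the pointwise identity into one in the algebra.\<close>
  have c: "smooth (\<lambda>_::'a dual. u)" for u :: 'a by (simp add: smooth_along_const)
  show "\<forall>u v w x :: 'a. u * v * w * x = 0"
  proof (intro allI)
    fix u v w x :: 'a
    show "u * v * w * x = 0"
      by (rule dual_separates[OF fin_dim_algebra]) (rule *[OF c c c c])
  qed
next
  assume "\<forall>u v w x :: 'a. u * v * w * x = 0"
  then show "generalized_affine_special_real nabla0 (alg_bivector :: 'a bivector)"
    unfolding generalized_affine_special_real_def Let_def one_form_iff
    by (intro conjI generalized_pseudo_Hessian_alg allI impI) (subst cubic_form_derivative, simp_all)
qed

end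

section \<open>Local parametrizations\<close>

lemma second_countable_euclidean:
  "second_countable (euclidean :: 'b::second_countable_topology topology)"
proof -
  obtain B :: "'b set set" where B: "countable B" "topological_basis B"
    using ex_countable_basis by blast
  show ?thesis
    unfolding second_countable_def
  proof (intro exI[of _ B] conjI allI impI ballI)
    show "openin euclidean V" if "V \<in> B" for V
      using topological_basis_open[OF B(2) that] by simp
    show "\<exists>V\<in>B. x \<in> V \<and> V \<subseteq> U" if "openin euclidean U \<and> x \<in> U" for U x
      using topological_basisE[OF B(2), of U x] that by auto
  qed (rule B(1))
qed

text \<open>Coordinates, padded by zeros, exhibit the space as a retract of
  \<open>nat \<Rightarrow> real\<close>, whose product topology is second countable.\<close>

lemma fin_dim_second_countable:
  assumes fd: "fin_dim (UNIV :: 'a::real_normed_vector set)"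
  shows "second_countable (euclidean :: 'a topology)"
proof -
  obtain I :: "'a set" and e :: "'a \<Rightarrow> 'a" and c :: "'a \<Rightarrow> 'a \<Rightarrow> real" where I: "finite I"
    "\<And>i. i \<in> I \<Longrightarrow> bounded_linear (c i)" "\<And>x. x = (\<Sum>i\<in>I. c i x *\<^sub>R e i)"
    by (rule fin_dim_coordinates[OF fd subspace_UNIV]) auto
  obtain n and b :: "nat \<Rightarrow> 'a" where b: "bij_betw b {..<n} I"
    using ex_bij_betw_nat_finite[OF I(1)] by (auto simp: atLeast0LessThan)
  define r where "r = (\<lambda>t::nat \<Rightarrow> real. \<Sum>j<n. t j *\<^sub>R e (b j))"
  define s where "s = (\<lambda>x j. if j < n then c (b j) x else 0)"
  have "continuous_on UNIV (\<lambda>x. s x j)" for j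
    using bounded_linear.continuous_on[OF I(2)[OF bij_betw_apply[OF b]] continuous_on_id]
    by (cases "j < n") (simp_all add: s_def)
  then have "continuous_on UNIV s" by (rule continuous_on_coordinatewise_then_product)
  moreover have "continuous_on UNIV r"
    unfolding r_def by (intro continuous_on_sum continuous_on_scaleR continuous_on_product_coordinates continuous_on_const)
  moreover have "r (s x) = x" for x
  proof -
    have "r (s x) = (\<Sum>j<n. c (b j) x *\<^sub>R e (b j))" by (simp add: r_def s_def)
    also have "\<dots> = (\<Sum>i\<in>I. c i x *\<^sub>R e i)"
      by (rule sum.reindex_bij_betw[OF b])
    finally show ?thesis using I(3)[of x] by simp
  qed
  ultimately have "retraction_map euclidean euclidean r"
    unfolding retraction_map_def retraction_maps_def by auto
  then show ?thesis
    by (rule second_countable_retraction_map_image) (rule second_countable_euclidean)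
qed

lemma parametrization_continuous_map:
  assumes "parametrization \<tau> E U f"
  shows "continuous_map (top_of_set U) \<tau> f"
proof -
  have "homeomorphic_map (top_of_set U) (subtopology \<tau> (f ` U)) f"
    using assms by (simp add: parametrization_def)
  from homeomorphic_imp_continuous_map[OF this] show ?thesis
    by (simp add: continuous_map_in_subtopology)
qed

lemma parametrization_has_derivative:
  assumes p: "parametrization \<tau> E U f" and x: "x \<in> U"
  shows "(f has_derivative frechet_derivative f (at x within U)) (at x within U)"
  by (rule smooth_along_derivative(1)[OF parametrization_open_along[OF p] _ x])
    (use p in \<open>simp add: parametrization_def\<close>)

text \<open>Only continuity into \<open>\<tau>\<close> is asked of \<open>f\<close>, so besides
  changes of parametrization this covers arbitrary maps into the submanifold. The map
  \<open>c\<close> inverts \<open>g\<close> where \<open>f\<close> lands in its image, and is merely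
  continuous at this stage.\<close>

lemma parametrization_transition:
  assumes p: "parametrization \<tau> F W g"
    and E: "open_along E U" and f: "continuous_map (top_of_set U) \<tau> f"
    and x0: "x0 \<in> U" "z0 \<in> W" "f x0 = g z0"
  obtains U' c where "open_along E U'" "x0 \<in> U'" "U' \<subseteq> U" "continuous_on U' c" "c ` U' \<subseteq> W"
    "\<And>x. x \<in> U' \<Longrightarrow> g (c x) = f x" "c x0 = z0"
proof -
  have hom: "homeomorphic_map (top_of_set W) (subtopology \<tau> (g ` W)) g" and op: "openin \<tau> (g ` W)"
    using p by (auto simp: parametrization_def)
  obtain k where k: "continuous_map (top_of_set W) (subtopology \<tau> (g ` W)) g"
    "continuous_map (subtopology \<tau> (g ` W)) (top_of_set W) k"
    "\<And>x. x \<in> W \<Longrightarrow> k (g x) = x"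
    "\<And>y. y \<in> topspace (subtopology \<tau> (g ` W)) \<Longrightarrow> g (k y) = y"
    using hom unfolding homeomorphic_map_maps homeomorphic_maps_def by auto
  have ts: "topspace (subtopology \<tau> (g ` W)) = g ` W" using openin_subset[OF op] by auto
  define U' where "U' = {x\<in>U. f x \<in> g ` W}"
  have sub: "U' \<subseteq> U" by (auto simp: U'_def)
  have "openin (top_of_set U) U'"
    unfolding U'_def using openin_continuous_map_preimage[OF f op] by simp
  then have U': "open_along E U'" using E openin_trans unfolding open_along_def by blast
  have "continuous_map (top_of_set U') \<tau> f"
    using f sub by (metis continuous_map_from_subtopology_mono)
  then have "continuous_map (top_of_set U') (subtopology \<tau> (g ` W)) f"
    unfolding continuous_map_in_subtopology by (auto simp: U'_def)
  from continuous_map_compose[OF this k(2)]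
  have c: "continuous_map (top_of_set U') (top_of_set W) (k \<circ> f)" .
  then have "continuous_on U' (k \<circ> f)" and im: "(k \<circ> f) ` U' \<subseteq> W"
    unfolding continuous_map_in_subtopology by auto
  moreover have "g ((k \<circ> f) x) = f x" if "x \<in> U'" for x
    using that k(4)[of "f x"] unfolding ts by (auto simp: U'_def)
  moreover have "(k \<circ> f) x0 = z0" using x0 k(3) by simp
  moreover have "x0 \<in> U'" using x0 by (auto simp: U'_def)
  ultimately show thesis using U' sub by (intro that[of U' "k \<circ> f"])
qed

text \<open>The change of parametrization is differentiable by
  \<open>left_inverse_has_derivative\<close>, and the chain rule factors the derivative of
  \<open>f\<close> through that of \<open>g\<close>. A single parametrization thus determines the
  tangent space.\<close>

lemma parametrization_tangent_subset:
  fixes f g :: "'v::real_normed_vector \<Rightarrow> 'v"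
  assumes fd: "fin_dim (UNIV :: 'v set)"
    and f: "parametrization \<tau> E U f" and g: "parametrization \<tau> F W g"
    and x0: "x0 \<in> U" "z0 \<in> W" "f x0 = g z0"
  shows "frechet_derivative f (at x0 within U) ` E \<subseteq> frechet_derivative g (at z0 within W) ` F"
proof -
  note E = parametrization_open_along[OF f] and F = parametrization_open_along[OF g]
  let ?f' = "frechet_derivative f (at x0 within U)" and ?g' = "frechet_derivative g (at z0 within W)"
  obtain U' c where c: "open_along E U'" "x0 \<in> U'" "U' \<subseteq> U" "continuous_on U' c" "c ` U' \<subseteq> W"
    "\<And>x. x \<in> U' \<Longrightarrow> g (c x) = f x" "c x0 = z0"
    by (rule parametrization_transition[OF g E parametrization_continuous_map[OF f] x0]) (rule that; assumption)
  have g': "(g has_derivative ?g') (at z0 within W)"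
    by (rule parametrization_has_derivative[OF g x0(2)])
  have f': "(f has_derivative ?f') (at x0 within U')"
    by (rule has_derivative_subset[OF parametrization_has_derivative[OF f x0(1)] c(3)])
  have lg: "linear ?g'" using has_derivative_bounded_linear[OF g'] by (rule bounded_linear.linear)
  have sF: "subspace F" using F by (simp add: open_along_def)
  obtain h where h: "bounded_linear h" "\<And>v. v \<in> F \<Longrightarrow> h (?g' v) = v" "range h \<subseteq> F"
    by (rule fin_dim_left_inverse[OF fd lg sF]) (use g x0(2) in \<open>auto simp: parametrization_def\<close>)
  have diff: "z - z0 \<in> F" if "z \<in> W" for z
    using that x0(2) open_along_subset[OF F] sF by (auto intro: subspace_diff)
  have "(c has_derivative (\<lambda>v. h (?f' v))) (at x0 within U')"
  proof (rule left_inverse_has_derivative[where S' = W and g = g and g' = ?g' and f = f and f' = ?f' and h = h])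
    show "continuous (at x0 within U') c" using c(2,4) by (simp add: continuous_on_eq_continuous_within)
  qed (use c g' f' h diff in auto)
  then have "((\<lambda>x. g (c x)) has_derivative (\<lambda>v. ?g' (h (?f' v)))) (at x0 within U')"
    using has_derivative_in_compose[of c "\<lambda>v. h (?f' v)" x0 U' g ?g'] has_derivative_subset[OF g' c(5)] c(7)
    by simp
  then have "(f has_derivative (\<lambda>v. ?g' (h (?f' v)))) (at x0 within U')"
    by (rule has_derivative_transform[OF c(2), rotated]) (simp add: c(6))
  then have "?f' v = ?g' (h (?f' v))" if "v \<in> E" for v
    by (rule has_derivative_unique_subspace[OF c(1,2) that f'])
  then show ?thesis using h(3) by blast
qed

lemma tangent_parametrization:
  fixes g :: "'v::real_normed_vector \<Rightarrow> 'v"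
  assumes fd: "fin_dim (UNIV :: 'v set)" and g: "parametrization \<tau> F W g" and z: "z \<in> W"
  shows "tangent \<tau> (g z) = frechet_derivative g (at z within W) ` F"
proof
  show "tangent \<tau> (g z) \<subseteq> frechet_derivative g (at z within W) ` F"
  proof
    fix t assume "t \<in> tangent \<tau> (g z)"
    then obtain E U f u v where f: "parametrization \<tau> E U f" "u \<in> U" "f u = g z" "v \<in> E"
      "t = frechet_derivative f (at u within U) v"
      unfolding tangent_def by blast
    then show "t \<in> frechet_derivative g (at z within W) ` F"
      using parametrization_tangent_subset[OF fd f(1) g f(2) z f(3)] by blast
  qed
  show "frechet_derivative g (at z within W) ` F \<subseteq> tangent \<tau> (g z)"
    using g z unfolding tangent_def by blast
qed

section \<open>Orbits as immersed submanifolds\<close>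

context fd_comm_algebra
begin

abbreviation otop :: "'a dual \<Rightarrow> 'a dual topology"
  where "otop \<equiv> orbit_topology (Phi :: 'a \<Rightarrow> 'a dual \<Rightarrow> 'a dual)"

abbreviation orb :: "'a dual \<Rightarrow> 'a dual set"
  where "orb \<equiv> orbit (Phi :: 'a \<Rightarrow> 'a dual \<Rightarrow> 'a dual)"

abbreviation tang :: "'a dual \<Rightarrow> 'a dual set"
  where "tang y \<equiv> range (\<lambda>u::'a. L_dual u y)"

lemma openin_otop: "openin (otop y) S \<longleftrightarrow> S \<subseteq> orb y \<and> open {u::'a. Phi u y \<in> S}"
proof -
  have "istopology (\<lambda>S. S \<subseteq> orb y \<and> open {u::'a. Phi u y \<in> S})"
    unfolding istopology_def
  proof (intro conjI allI impI)
    fix S T assume "S \<subseteq> orb y \<and> open {u::'a. Phi u y \<in> S}" "T \<subseteq> orb y \<and> open {u::'a. Phi u y \<in> T}"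
    moreover from this have "open ({u::'a. Phi u y \<in> S} \<inter> {u. Phi u y \<in> T})" by (intro open_Int) auto
    moreover have "{u::'a. Phi u y \<in> S} \<inter> {u. Phi u y \<in> T} = {u. Phi u y \<in> S \<inter> T}" by auto
    ultimately show "S \<inter> T \<subseteq> orb y" "open {u::'a. Phi u y \<in> S \<inter> T}" by auto
  next
    fix K assume K: "\<forall>S\<in>K. S \<subseteq> orb y \<and> open {u::'a. Phi u y \<in> S}"
    then have "open (\<Union>S\<in>K. {u::'a. Phi u y \<in> S})" by (intro open_UN) auto
    moreover have "(\<Union>S\<in>K. {u::'a. Phi u y \<in> S}) = {u. Phi u y \<in> \<Union>K}" by auto
    ultimately show "open {u::'a. Phi u y \<in> \<Union>K}" by simp
    show "\<Union>K \<subseteq> orb y" using K by auto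
  qed
  then show ?thesis unfolding orbit_topology_def by (simp add: topology_inverse')
qed

lemma topspace_otop: "topspace (otop y) = orb y"
proof
  show "topspace (otop y) \<subseteq> orb y"
    using openin_topspace[of "otop y"] unfolding openin_otop by blast
  have "{u::'a. Phi u y \<in> orb y} = UNIV" by (auto simp: orbit_def)
  then have "openin (otop y) (orb y)" by (simp add: openin_otop)
  then show "orb y \<subseteq> topspace (otop y)" by (rule openin_subset)
qed

lemma orb_refl: "y \<in> orb y"
  unfolding orbit_def using Phi_zero[of y] by (metis rangeI)

lemma orb_Phi [simp]: "Phi u y \<in> orb y" for u :: 'a
  by (simp add: orbit_def)

lemma orb_eq:
  assumes "z \<in> orb y"
  shows "orb z = orb y"
proof -
  obtain w :: 'a where w: "z = Phi w y" using assms by (auto simp: orbit_def)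
  have "Phi u z = Phi (u + w) y" "Phi u y = Phi (u - w) z" for u :: 'a
    by (simp_all add: w Phi_add[symmetric])
  then show ?thesis unfolding orbit_def by (metis (no_types, lifting) image_subsetI rangeI subset_antisym)
qed

text \<open>The two orbit maps differ by a translation of the algebra, which is a homeomorphism.
  Base points on an orbit can therefore be exchanged freely.\<close>

lemma otop_eq:
  assumes "z \<in> orb y"
  shows "otop z = otop y"
proof -
  have "openin (otop z) S" if z: "z \<in> orb y" and S: "openin (otop y) S" for y z S
  proof -
    obtain w :: 'a where w: "z = Phi w y" using z by (auto simp: orbit_def)
    have "open {u::'a. Phi u y \<in> S}" using S by (simp add: openin_otop)
    then have "open ((\<lambda>u. u + w) -` {u::'a. Phi u y \<in> S})"
      by (rule open_vimage) (intro continuous_intros)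
    moreover have "(\<lambda>u. u + w) -` {u::'a. Phi u y \<in> S} = {u. Phi u z \<in> S}"
      by (auto simp: w Phi_add)
    ultimately show ?thesis using S orb_eq[OF z] by (simp add: openin_otop)
  qed
  moreover have "y \<in> orb z" using orb_eq[OF assms] orb_refl by blast
  ultimately show ?thesis using assms by (intro topology_eq[THEN iffD2]) blast
qed

lemma continuous_map_orbit_map: "continuous_map euclidean (otop y) (\<lambda>u::'a. Phi u y)"
  unfolding continuous_map_def by (simp add: topspace_otop openin_otop)

lemma subspace_tang: "subspace (tang y)"
  by (rule linear_subspace_image[OF bounded_linear.linear[OF bounded_linear_L_dual_left] subspace_UNIV, of y, simplified])

lemma open_along_tang: "open_along (tang y) (tang y)"
  by (simp add: open_along_def subspace_tang)

text \<open>A linear section of \<open>u \<mapsto> L_dual u y\<close>; composed with the orbit map it gives a chart of the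
  orbit at \<open>y\<close> that is defined on the tangent space.\<close>

definition lift :: "'a dual \<Rightarrow> 'a dual \<Rightarrow> 'a"
  where "lift y = (SOME g. bounded_linear g \<and> (\<forall>x\<in>tang y. L_dual (g x) y = x))"

lemma lift: "bounded_linear (lift y)" "x \<in> tang y \<Longrightarrow> L_dual (lift y x) y = x"
proof -
  obtain g where "bounded_linear g" "\<And>x. x \<in> tang y \<Longrightarrow> L_dual (g x) y = x"
    by (rule fin_dim_right_inverse[OF fin_dim_alg_dual bounded_linear.linear[OF bounded_linear_L_dual_left[of y]]])
      (rule that; assumption)
  then have "\<exists>g. bounded_linear g \<and> (\<forall>x\<in>tang y. L_dual (g x) y = x)" by blast
  from someI_ex[OF this] show "bounded_linear (lift y)" "x \<in> tang y \<Longrightarrow> L_dual (lift y x) y = x"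
    unfolding lift_def by blast+
qed

definition chart :: "'a dual \<Rightarrow> 'a dual \<Rightarrow> 'a dual"
  where "chart y x = Phi (lift y x) y"

text \<open>The chosen lift and \<open>u\<close> differ by an element annihilating \<open>y\<close>,
  and such an element fixes \<open>y\<close> under the action.\<close>

lemma chart_L_dual: "chart y (L_dual u y) = Phi u y" for u :: 'a
proof -
  define k where "k = u - lift y (L_dual u y)"
  have "L_dual k y = 0" by (simp add: k_def L_dual_diff lift(2))
  then have "Phi (lift y (L_dual u y)) (Phi k y) = chart y (L_dual u y)"
    by (simp add: Phi_stabilizer chart_def)
  then show ?thesis by (simp add: Phi_add[symmetric] k_def)
qed

lemma chart_zero [simp]: "chart y 0 = y"
  using chart_L_dual[of y 0] by (simp add: L_dual_zero)

lemma chart_in_orb [simp]: "chart y x \<in> orb y"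
  by (simp add: chart_def)

lemma smooth_lift: "smooth (lift y)"
  using smooth_along_linear[OF _ lift(1) smooth_along_id, of UNIV UNIV y] by simp

lemma smooth_chart: "smooth (chart y)"
  unfolding chart_def by (intro smooth_along_Phi smooth_along_const smooth_lift) simp_all

lemma chart_has_derivative:
  "(chart y has_derivative (\<lambda>v. Phi (lift y x) (L_dual (lift y v) y))) (at x)"
proof -
  have "((\<lambda>x. Phi (lift y x) y) has_derivative (\<lambda>v. L_dual (lift y v) (Phi (lift y x) y))) (at x)"
    by (rule has_derivative_compose[OF bounded_linear_imp_has_derivative[OF lift(1)] orbit_map_has_derivative])
  then show ?thesis by (simp add: chart_def[abs_def] L_dual_Phi)
qed

text \<open>By additivity of the action, moving the group element from \<open>u0\<close> to
  \<open>u\<close> shifts the chart coordinate by \<open>L_dual (u - u0) y\<close>; so for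
  \<open>u\<close> near \<open>u0\<close> the orbit point keeps a coordinate in
  \<open>N\<close>.\<close>

lemma openin_chart_image:
  assumes N: "openin (top_of_set (tang y)) N"
  shows "openin (otop y) (chart y ` N)"
proof -
  obtain T where T: "open T" "N = tang y \<inter> T" using N by (auto simp: openin_open)
  have "open {u::'a. Phi u y \<in> chart y ` N}"
  proof (subst open_subopen, intro ballI)
    fix u0 :: 'a assume "u0 \<in> {u. Phi u y \<in> chart y ` N}"
    then obtain x where x: "x \<in> N" "Phi u0 y = chart y x" by auto
    define m where "m = (\<lambda>u. x + L_dual (u - u0) y)"
    have "continuous_on UNIV m"
      unfolding m_def by (intro continuous_intros bounded_linear.continuous_on[OF bounded_linear_L_dual_left])
    then have o: "open (m -` T)" using T(1) open_vimage by blast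
    have u0: "u0 \<in> m -` T" using x(1) T(2) by (simp add: m_def L_dual_zero)
    have "Phi u y \<in> chart y ` N" if "u \<in> m -` T" for u
    proof -
      have xl: "L_dual (lift y x) y = x" using x(1) T(2) by (intro lift(2)) auto
      then have m: "m u = L_dual (lift y x + (u - u0)) y" by (simp add: m_def L_dual_add)
      have "chart y (m u) = Phi (u - u0) (chart y x)"
        unfolding m chart_L_dual by (simp add: chart_def Phi_add[symmetric] add.commute)
      also have "\<dots> = Phi u y" unfolding x(2)[symmetric] by (simp add: Phi_add[symmetric])
      finally have "Phi u y = chart y (m u)" by simp
      moreover have "m u \<in> N" using that m T(2) by auto
      ultimately show ?thesis by blast
    qed
    then show "\<exists>S. open S \<and> u0 \<in> S \<and> S \<subseteq> {u. Phi u y \<in> chart y ` N}"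
      using o u0 by (intro exI[of _ "m -` T"]) auto
  qed
  then show ?thesis unfolding openin_otop by auto
qed

text \<open>The derivative of the chart at the origin is the identity on the tangent space, so
  strict differentiability applies with error 1/2. On such a ball the chart is injective with
  Lipschitz inverse.\<close>

lemma chart_near_identity:
  "\<exists>\<delta>>0. \<forall>x\<in>ball 0 \<delta> \<inter> tang y. \<forall>z\<in>ball 0 \<delta> \<inter> tang y.
    norm (chart y x - chart y z - (x - z)) \<le> 1/2 * norm (x - z)"
proof -
  have 0: "0 \<in> tang y" using subspace_0[OF subspace_tang] .
  have "Ck_along (Suc 0) (tang y) (tang y) (chart y)"
    using smooth_along_of_smooth[OF fin_dim_alg_dual open_along_tang smooth_chart]
    by (simp only: smooth_along_def)
  moreover have "(chart y has_derivative (\<lambda>v. L_dual (lift y v) y)) (at 0 within tang y)"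
    using has_derivative_at_withinI[OF chart_has_derivative[of y 0]] 
      linear_0[OF bounded_linear.linear[OF lift(1)]] by simp
  ultimately obtain \<delta> where \<delta>: "\<delta> > 0"
    "\<And>x z. x \<in> ball 0 \<delta> \<inter> tang y \<Longrightarrow> z \<in> ball 0 \<delta> \<inter> tang y \<Longrightarrow>
      norm (chart y x - chart y z - L_dual (lift y (x - z)) y) \<le> 1/2 * norm (x - z)"
    using strictly_differentiable[OF fin_dim_alg_dual open_along_tang _ 0, where f = "chart y" and D = "\<lambda>v. L_dual (lift y v) y" and \<epsilon> = "1/2"]
    by auto
  have "L_dual (lift y (x - z)) y = x - z" if "x \<in> tang y" "z \<in> tang y" for x z
    by (rule lift(2)[OF subspace_diff[OF subspace_tang that]])
  with \<delta> show ?thesis by (intro exI[of _ \<delta>]) force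
qed

definition rad :: "'a dual \<Rightarrow> real"
  where "rad y = (SOME \<delta>. \<delta> > 0 \<and> (\<forall>x\<in>ball 0 \<delta> \<inter> tang y. \<forall>z\<in>ball 0 \<delta> \<inter> tang y.
    norm (chart y x - chart y z - (x - z)) \<le> 1/2 * norm (x - z)))"

abbreviation dom :: "'a dual \<Rightarrow> 'a dual set"
  where "dom y \<equiv> ball 0 (rad y) \<inter> tang y"

lemma rad: "rad y > 0"
  "x \<in> dom y \<Longrightarrow> z \<in> dom y \<Longrightarrow> norm (chart y x - chart y z - (x - z)) \<le> 1/2 * norm (x - z)"
  using someI_ex[OF chart_near_identity[of y]] unfolding rad_def by blast+

lemma zero_in_dom [simp]: "0 \<in> dom y"
  using rad(1) subspace_0[OF subspace_tang] by simp

lemma open_along_dom: "open_along (tang y) (dom y)"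
  by (rule open_along_ball_Int[OF subspace_tang])

lemma chart_expanding:
  assumes "x \<in> dom y" "z \<in> dom y"
  shows "norm (x - z) \<le> 2 * norm (chart y x - chart y z)"
  using rad(2)[OF assms] norm_triangle_ineq2[of "x - z" "chart y x - chart y z"]
  by (simp add: norm_minus_commute[of "x - z"])

lemma inj_on_chart: "inj_on (chart y) (dom y)"
proof (rule inj_onI)
  fix x z assume "x \<in> dom y" "z \<in> dom y" "chart y x = chart y z"
  then show "x = z" using chart_expanding[of x y z] by simp
qed

lemma continuous_map_chart: "continuous_map (top_of_set S) (otop y) (chart y)"
proof -
  have "continuous_map euclidean euclidean (lift y)"
    using bounded_linear.continuous_on[OF lift(1) continuous_on_id] by simp
  from continuous_map_compose[OF this continuous_map_orbit_map[of y]]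
  have "continuous_map euclidean (otop y) (chart y)" by (simp add: o_def chart_def[abs_def])
  then show ?thesis by (rule continuous_map_from_subtopology)
qed

lemma homeomorphic_map_chart:
  "homeomorphic_map (top_of_set (dom y)) (subtopology (otop y) (chart y ` dom y)) (chart y)"
proof (rule bijective_open_imp_homeomorphic_map)
  have op: "openin (otop y) (chart y ` N)" if "openin (top_of_set (dom y)) N" for N
    by (rule openin_chart_image, rule openin_trans[OF that]) (use open_along_dom in \<open>simp add: open_along_def\<close>)
  show "continuous_map (top_of_set (dom y)) (subtopology (otop y) (chart y ` dom y)) (chart y)"
    unfolding continuous_map_in_subtopology using continuous_map_chart by simp
  show "open_map (top_of_set (dom y)) (subtopology (otop y) (chart y ` dom y)) (chart y)"
    unfolding open_map_def
  proof (intro allI impI)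
    fix N assume N: "openin (top_of_set (dom y)) N"
    show "openin (subtopology (otop y) (chart y ` dom y)) (chart y ` N)"
      unfolding openin_subtopology using op[OF N] openin_imp_subset[OF N]
      by (intro exI[of _ "chart y ` N"]) auto
  qed
  show "chart y ` topspace (top_of_set (dom y)) = topspace (subtopology (otop y) (chart y ` dom y))"
    by (auto simp: topspace_otop)
  show "inj_on (chart y) (topspace (top_of_set (dom y)))" using inj_on_chart by simp
qed

text \<open>The topology does not depend on the base point, so a chart may be centred at any point
  of the orbit. It is an immersion because every \<open>Phi u\<close> is invertible.\<close>

lemma parametrization_chart:
  assumes "z \<in> orb y"
  shows "parametrization (otop y) (tang z) (dom z) (chart z)"
proof -
  have "frechet_derivative (chart z) (at x within dom z) v = Phi (lift z x) v"
    if "x \<in> dom z" "v \<in> tang z" for x v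
    using frechet_derivative_subspace[OF open_along_dom that has_derivative_at_withinI[OF chart_has_derivative]]
      lift(2)[OF that(2)] by simp
  moreover have "v = 0" if "Phi u v = 0" for u :: 'a and v
    using Phi_minus(1)[of u v] that by (simp add: Phi_zero_right)
  ultimately have "parametrization (otop z) (tang z) (dom z) (chart z)"
    unfolding parametrization_def
    using subspace_tang open_along_dom[of z] homeomorphic_map_chart[of z]
      smooth_along_of_smooth[OF fin_dim_alg_dual open_along_dom smooth_chart]
      openin_chart_image[of z "dom z"]
    by (auto simp: open_along_def)
  then show ?thesis using otop_eq[OF assms] by simp
qed

lemma tangent_otop:
  assumes "z \<in> orb y"
  shows "tangent (otop y) z = tang z"
proof -
  have "tangent (otop y) (chart z 0) = frechet_derivative (chart z) (at 0 within dom z) ` tang z"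
    by (rule tangent_parametrization[OF fin_dim_alg_dual parametrization_chart[OF assms] zero_in_dom])
  also have "\<dots> = (\<lambda>v. v) ` tang z"
  proof (rule image_cong[OF refl])
    fix v assume v: "v \<in> tang z"
    show "frechet_derivative (chart z) (at 0 within dom z) v = v"
      using frechet_derivative_subspace[OF open_along_dom zero_in_dom v has_derivative_at_withinI[OF chart_has_derivative]]
        lift(2)[OF v] linear_0[OF bounded_linear.linear[OF lift(1)]] by simp
  qed
  finally show ?thesis by simp
qed

text \<open>The inclusion into the ambient space is continuous and injective, which gives the
  Hausdorff property; the orbit map is open, which carries second countability over from the
  algebra.\<close>

lemma immersed_submanifold_otop: "immersed_submanifold (otop y)"
  unfolding immersed_submanifold_def
proof (intro conjI ballI)
  have cont: "continuous_on UNIV (\<lambda>u::'a. Phi u y)"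
    using smooth_along_continuous_on[OF _ smooth_orbit_map] by simp
  have "continuous_map (otop y) euclidean (\<lambda>x. x)"
    unfolding continuous_map_def
  proof (intro conjI allI impI)
    fix S :: "'a dual set" assume "openin euclidean S"
    then have "open ((\<lambda>u::'a. Phi u y) -` S)" using cont by (intro open_vimage) auto
    moreover have "(\<lambda>u::'a. Phi u y) -` S = {u. Phi u y \<in> {x \<in> topspace (otop y). x \<in> S}}"
      by (auto simp: topspace_otop)
    ultimately show "openin (otop y) {x \<in> topspace (otop y). x \<in> S}"
      by (auto simp: openin_otop topspace_otop)
  qed simp
  then show "Hausdorff_space (otop y)"
    by (rule Hausdorff_space_injective_preimage[OF Hausdorff_space_euclidean]) simp
  have "open_map euclidean (otop y) (\<lambda>u::'a. Phi u y)"
    unfolding open_map_def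
  proof (intro allI impI)
    fix N :: "'a set" assume "openin euclidean N"
    then have N: "open N" by simp
    \<comment> \<open>The saturation of \<open>N\<close> is the union of its translates by the
      stabilizer of \<open>y\<close>.\<close>
    have "{u. Phi u y \<in> (\<lambda>u. Phi u y) ` N} = (\<Union>k\<in>{k::'a. Phi k y = y}. (\<lambda>u. u + k) ` N)"
    proof (intro set_eqI iffI)
      fix u assume "u \<in> {u. Phi u y \<in> (\<lambda>u. Phi u y) ` N}"
      then obtain w where w: "w \<in> N" "Phi u y = Phi w y" by auto
      have "Phi (u - w) y = Phi (- w) (Phi u y)" by (simp add: Phi_add[symmetric])
      then have "Phi (u - w) y = y" using w(2) by simp
      moreover have "u = w + (u - w)" by simp
      ultimately show "u \<in> (\<Union>k\<in>{k. Phi k y = y}. (\<lambda>u. u + k) ` N)" using w(1) by blast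
    next
      fix u assume "u \<in> (\<Union>k\<in>{k::'a. Phi k y = y}. (\<lambda>u. u + k) ` N)"
      then show "u \<in> {u. Phi u y \<in> (\<lambda>u. Phi u y) ` N}" by (auto simp: Phi_add)
    qed
    moreover have "open ((\<lambda>u. u + k) ` N)" for k :: 'a
      using open_translation[OF N, of k] by (simp add: add.commute)
    ultimately show "openin (otop y) ((\<lambda>u. Phi u y) ` N)"
      by (auto simp: openin_otop)
  qed
  then show "second_countable (otop y)"
    by (rule second_countable_open_map_image[OF continuous_map_orbit_map])
      (simp_all add: topspace_otop orbit_def fin_dim_second_countable[OF fin_dim_algebra])
next
  fix x assume "x \<in> topspace (otop y)"
  then have "x \<in> orb y" by (simp add: topspace_otop)
  moreover have "x \<in> chart x ` dom x" using zero_in_dom[of x] chart_zero[of x] by (metis image_eqI)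
  ultimately show "\<exists>E U f. parametrization (otop y) E U f \<and> x \<in> f ` U"
    using parametrization_chart by blast
qed

lemma connected_space_otop: "connected_space (otop y)"
proof -
  have "connectedin (euclidean :: 'a topology) UNIV"
    by (simp add: convex_connected)
  from connectedin_continuous_map_image[OF continuous_map_orbit_map[of y] this]
  show ?thesis by (simp add: connectedin_topspace[symmetric] topspace_otop orbit_def)
qed

lemma integral_manifold_otop: "integral_manifold (image_distribution alg_bivector) (otop y)"
  unfolding integral_manifold_def
  using immersed_submanifold_otop connected_space_otop orb_refl[of y]
  by (auto simp: topspace_otop tangent_otop image_distribution_alg)

text \<open>A map into an orbit lifts locally to the group, and the lift is as smooth as the map: if
  \<open>f = chart z \<circ> c\<close> then \<open>c' = Phi (- lift z c) f'\<close>, which bootstraps the smoothness of \<open>c\<close>.\<close>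

lemma smooth_local_lift:
  fixes f :: "'m::real_normed_vector \<Rightarrow> 'a dual"
  assumes E: "open_along E U" and f: "continuous_map (top_of_set U) (otop y) f" "smooth_along E U f"
    and x0: "x0 \<in> U"
  obtains U' and w :: "'m \<Rightarrow> 'a" where "open_along E U'" "x0 \<in> U'" "U' \<subseteq> U" "smooth_along E U' w"
    "\<And>x. x \<in> U' \<Longrightarrow> f x = Phi (w x) (f x0)"
proof -
  define z where "z = f x0"
  have "z \<in> topspace (otop y)" using continuous_map_image_subset_topspace[OF f(1)] x0 by (auto simp: z_def)
  then have z: "z \<in> orb y" by (simp add: topspace_otop)
  have z0: "f x0 = chart z 0" by (simp add: z_def)
  obtain U' c where c: "open_along E U'" "x0 \<in> U'" "U' \<subseteq> U" "continuous_on U' c" "c ` U' \<subseteq> dom z"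
    "\<And>x. x \<in> U' \<Longrightarrow> chart z (c x) = f x" "c x0 = 0"
    by (rule parametrization_transition[OF parametrization_chart[OF z] E f(1) x0 zero_in_dom z0])
      (rule that; assumption)
  let ?f' = "\<lambda>x. frechet_derivative f (at x within U)"
  have fU': "smooth_along E U' (\<lambda>x. ?f' x v)" if "v \<in> E" for v
    by (rule smooth_along_subset[OF E c(1,3) smooth_along_derivative(2)[OF E f(2) that]])
  \<comment> \<open>On the tangent space \<open>h x\<close> inverts the derivative of the chart at
    \<open>c x\<close> from the left.\<close>
  define h where "h = (\<lambda>x. Phi (- lift z (c x)) :: 'a dual \<Rightarrow> 'a dual)"
  have der: "(c has_derivative (\<lambda>v. h x (?f' x v))) (at x within U')" if x: "x \<in> U'" for x
  proof (rule left_inverse_has_derivative[where S' = "dom z" and g = "chart z" and f = f and h = "h x"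
        and f' = "?f' x" and g' = "\<lambda>v. Phi (lift z (c x)) (L_dual (lift z v) z)"])
    show "(chart z has_derivative (\<lambda>v. Phi (lift z (c x)) (L_dual (lift z v) z))) (at (c x) within dom z)"
      by (rule has_derivative_at_withinI[OF chart_has_derivative])
    show "continuous (at x within U') c" using c(4) x by (simp add: continuous_on_eq_continuous_within)
    show "(f has_derivative ?f' x) (at x within U')"
      using has_derivative_subset[OF smooth_along_derivative(1)[OF E f(2)] c(3)] x c(3) by blast
    show "bounded_linear (h x)" unfolding h_def by (rule bounded_linear_Phi)
    fix y assume "y \<in> dom z"
    moreover have "c x \<in> dom z" using c(5) x by blast
    ultimately have "y - c x \<in> tang z" by (intro subspace_diff[OF subspace_tang]) auto
    then show "h x (Phi (lift z (c x)) (L_dual (lift z (y - c x)) z)) = y - c x"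
      by (simp add: h_def lift(2))
  qed (use c x in auto)
  have "Ck_along k E U' c" for k
  proof (induction k)
    case 0
    then show ?case using c(4) by simp
  next
    case (Suc k)
    show ?case
    proof (rule Ck_SucI[OF c(1), where f' = "\<lambda>x v. h x (?f' x v)"])
      fix v assume v: "v \<in> E"
      have "bounded_linear (\<lambda>x. - lift z x)" by (rule bounded_linear_minus[OF lift(1)])
      then have "Ck_along k E U' (\<lambda>x. - lift z (c x))"
        by (rule Ck_linear[OF c(1) _ Suc.IH])
      moreover have "Ck_along k E U' (\<lambda>x. ?f' x v)" using fU'[OF v] by (simp only: smooth_along_def)
      ultimately have p: "Ck_along k E U' (\<lambda>x. (- lift z (c x), ?f' x v))" by (rule Ck_Pair[OF c(1)])
      have s: "Ck_along k UNIV UNIV (\<lambda>p. Phi (fst p :: 'a) (snd p))"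
        using smooth_Phi by (simp only: smooth_along_def)
      show "Ck_along k E U' (\<lambda>x. h x (?f' x v))"
        using Ck_compose[OF fin_dim_alg_prod c(1) _ _ p s] by (simp add: h_def)
    qed (rule der)
  qed
  then have sc: "smooth_along E U' c" unfolding smooth_along_def by blast
  show thesis
  proof (rule that[OF c(1-3)])
    show "smooth_along E U' (\<lambda>x. lift z (c x))" by (rule smooth_along_linear[OF c(1) lift(1) sc])
    show "f x = Phi (lift z (c x)) (f x0)" if "x \<in> U'" for x
      using c(6)[OF that] by (simp add: chart_def z_def)
  qed
qed

section \<open>Smooth maps and vector fields on an orbit\<close>

text \<open>Near \<open>u0\<close> the orbit map is the chart at \<open>Phi u0 y\<close> applied to
  a linear function of \<open>u - u0\<close>, which gives one direction; the other lifts a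
  parametrization locally to the group.\<close>

lemma smooth_map_otop_iff:
  fixes F :: "'a dual \<Rightarrow> 'b::real_normed_vector"
  shows "smooth_map (otop y) F \<longleftrightarrow> smooth (\<lambda>u::'a. F (Phi u y))"
proof
  assume F: "smooth_map (otop y) F"
  show "smooth (\<lambda>u::'a. F (Phi u y))"
  proof (rule smooth_along_local)
    fix u0 :: 'a
    define z where "z = Phi u0 y"
    have "smooth_along (tang z) (dom z) (F \<circ> chart z)"
      using F parametrization_chart[of z y] unfolding smooth_map_def by (simp add: z_def)
    then have s: "smooth_along (tang z) (dom z) (\<lambda>x. F (chart z x))" by (simp add: o_def)
    define m where "m = (\<lambda>u. L_dual (u - u0) z)"
    have sm: "smooth m"
      unfolding m_def
      by (rule smooth_L_dual) (simp_all add: smooth_along_diff smooth_along_id smooth_along_const)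
    define W where "W = m -` ball 0 (rad z)"
    have W: "open W" unfolding W_def using smooth_along_continuous_on[OF _ sm]
      by (intro open_vimage) auto
    have mW: "m ` W \<subseteq> dom z" by (auto simp: W_def m_def)
    have "smooth_along UNIV W (\<lambda>u. F (chart z (m u)))"
      by (rule smooth_along_compose[OF fin_dim_alg_dual _ open_along_dom mW _ s])
        (use W smooth_along_subset[OF _ _ _ sm, of W] in auto)
    moreover have "chart z (m u) = Phi u y" for u
      unfolding m_def chart_L_dual by (simp add: z_def Phi_add[symmetric])
    ultimately have "smooth_along UNIV W (\<lambda>u. F (Phi u y))" by simp
    moreover have "u0 \<in> W" using rad(1) by (simp add: W_def m_def L_dual_zero)
    ultimately show "\<exists>W. open_along UNIV W \<and> u0 \<in> W \<and> W \<subseteq> UNIV \<and> smooth_along UNIV W (\<lambda>u. F (Phi u y))"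
      using W by (intro exI[of _ W]) simp
  qed simp
next
  assume F: "smooth (\<lambda>u::'a. F (Phi u y))"
  show "smooth_map (otop y) F"
    unfolding smooth_map_def o_def
  proof (intro allI impI)
    fix E U and f :: "'a dual \<Rightarrow> 'a dual" assume p: "parametrization (otop y) E U f"
    note E = parametrization_open_along[OF p]
    have sf: "smooth_along E U f" using p by (simp add: parametrization_def)
    show "smooth_along E U (\<lambda>x. F (f x))"
    proof (rule smooth_along_local[OF E])
      fix x0 assume x0: "x0 \<in> U"
      obtain U' and w :: "'a dual \<Rightarrow> 'a" where w: "open_along E U'" "x0 \<in> U'" "U' \<subseteq> U" "smooth_along E U' w"
        "\<And>x. x \<in> U' \<Longrightarrow> f x = Phi (w x) (f x0)"
        by (rule smooth_local_lift[OF E parametrization_continuous_map[OF p] sf x0]) (rule that; assumption)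
      have "f x0 \<in> topspace (otop y)"
        using continuous_map_image_subset_topspace[OF parametrization_continuous_map[OF p]] x0 by auto
      then obtain a :: 'a where a: "f x0 = Phi a y" by (auto simp: topspace_otop orbit_def)
      have "smooth_along E U' (\<lambda>x. w x + a)"
        by (intro smooth_along_add[OF w(1)] w(4) smooth_along_const[OF w(1)])
      then have "smooth_along E U' (\<lambda>x. F (Phi (w x + a) y))"
        by (rule smooth_along_compose_smooth[OF fin_dim_algebra w(1) _ F])
      then have "smooth_along E U' (\<lambda>x. F (f x))"
        by (subst smooth_along_cong[where g = "\<lambda>x. F (Phi (w x + a) y)"]) (simp_all add: w(5) a Phi_add)
      then show "\<exists>W. open_along E W \<and> x0 \<in> W \<and> W \<subseteq> U \<and> smooth_along E W (\<lambda>x. F (f x))"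
        using w(1-3) by blast
    qed
  qed
qed

lemma vector_field_otop_iff:
  "vector_field (otop y) X \<longleftrightarrow> smooth (\<lambda>u::'a. X (Phi u y)) \<and> (\<forall>x\<in>orb y. X x \<in> tang x)"
  unfolding vector_field_def smooth_map_otop_iff topspace_otop by (auto simp: tangent_otop)

end

section \<open>Derivatives along vector fields of an orbit\<close>

text \<open>Replaces the increments \<open>t\<close> of a difference quotient by increments
  \<open>s\<close> that agree with them to first order. It is used with the chart coordinate and the
  ambient increment in either role.\<close>

lemma relative_remainder_transfer:
  fixes D :: "'v::real_normed_vector \<Rightarrow> 'b::real_normed_vector"
  assumes D: "bounded_linear D" and r: "((\<lambda>z. norm (s z - t z) / norm (t z)) \<longlongrightarrow> 0) F"
    and le: "\<forall>\<^sub>F z in F. t z \<noteq> 0 \<and> norm (t z) \<le> C * norm (s z)"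
    and q: "((\<lambda>z. (a z - D (t z)) /\<^sub>R norm (t z)) \<longlongrightarrow> 0) F"
  shows "((\<lambda>z. (a z - D (s z)) /\<^sub>R norm (s z)) \<longlongrightarrow> 0) F"
proof -
  obtain K where K: "K > 0" "\<And>v. norm (D v) \<le> norm v * K"
    using bounded_linear.pos_bounded[OF D] by blast
  define e where "e = (\<lambda>z. norm ((a z - D (t z)) /\<^sub>R norm (t z)) + norm (s z - t z) / norm (t z) * K)"
  have "((\<lambda>z. e z * C) \<longlongrightarrow> (0 + 0 * K) * C) F"
    unfolding e_def by (intro tendsto_mult tendsto_add tendsto_const r tendsto_norm_zero[OF q])
  then have lim: "((\<lambda>z. e z * C) \<longlongrightarrow> 0) F" by simp
  have "\<forall>\<^sub>F z in F. norm ((a z - D (s z)) /\<^sub>R norm (s z)) \<le> e z * C"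
  proof (rule eventually_mono[OF le])
    fix z assume z: "t z \<noteq> 0 \<and> norm (t z) \<le> C * norm (s z)"
    then have t: "norm (t z) > 0" "norm (s z) > 0" by (auto intro: ccontr)
    have "a z - D (s z) = (a z - D (t z)) - D (s z - t z)"
      by (simp add: linear_diff[OF bounded_linear.linear[OF D]])
    then have "norm (a z - D (s z)) \<le> norm (a z - D (t z)) + norm (s z - t z) * K"
      using norm_triangle_ineq4 K(2) by (metis add_left_mono order_trans)
    also have "\<dots> = e z * norm (t z)" unfolding e_def distrib_right using t(1) by simp
    also have "\<dots> \<le> e z * (C * norm (s z))" using z K(1) by (intro mult_left_mono) (auto simp: e_def)
    finally show "norm ((a z - D (s z)) /\<^sub>R norm (s z)) \<le> e z * C"
      unfolding norm_scaleR abs_inverse abs_norm_cancel using t(2) by (simp add: field_simps)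
  qed
  then show ?thesis using lim by (rule Lim_null_comparison)
qed

context fd_comm_algebra
begin

text \<open>Chart images of small relative balls form a neighbourhood base of \<open>y\<close> in
  the orbit topology, and injectivity of the chart keeps punctured neighbourhoods punctured.\<close>

lemma atin_otop: "atin (otop y) y = filtermap (chart y) (at 0 within tang y)"
proof (rule filter_eqI)
  fix P
  have "(\<exists>S. openin (otop y) S \<and> y \<in> S \<and> (\<forall>x\<in>S - {y}. P x)) \<longleftrightarrow>
      (\<exists>d>0. \<forall>z\<in>tang y. z \<noteq> 0 \<and> dist z 0 < d \<longrightarrow> P (chart y z))"
  proof
    assume "\<exists>S. openin (otop y) S \<and> y \<in> S \<and> (\<forall>x\<in>S - {y}. P x)"
    then obtain S where S: "openin (otop y) S" "y \<in> S" "\<And>x. x \<in> S - {y} \<Longrightarrow> P x" by blast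
    have "openin (top_of_set (dom y)) {z \<in> dom y. chart y z \<in> S}"
      using openin_continuous_map_preimage[OF continuous_map_chart S(1), of "dom y"] by simp
    then have "open_along (tang y) {z \<in> dom y. chart y z \<in> S}"
      using open_along_dom openin_trans unfolding open_along_def by blast
    moreover have "0 \<in> {z \<in> dom y. chart y z \<in> S}" using S(2) zero_in_dom[of y] by simp
    ultimately obtain d where d: "d > 0" "ball 0 d \<inter> tang y \<subseteq> {z \<in> dom y. chart y z \<in> S}"
      by (rule open_along_ball)
    have "P (chart y z)" if z: "z \<in> tang y" "z \<noteq> 0" "dist z 0 < d" for z
    proof -
      have zd: "z \<in> dom y" "chart y z \<in> S" using d(2) z by auto
      then have "chart y z \<noteq> y"
        using inj_onD[OF inj_on_chart _ zd(1) zero_in_dom] z(2) by auto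
      then show ?thesis using S(3) zd by blast
    qed
    then show "\<exists>d>0. \<forall>z\<in>tang y. z \<noteq> 0 \<and> dist z 0 < d \<longrightarrow> P (chart y z)" using d(1) by blast
  next
    assume "\<exists>d>0. \<forall>z\<in>tang y. z \<noteq> 0 \<and> dist z 0 < d \<longrightarrow> P (chart y z)"
    then obtain d where d: "d > 0" "\<And>z. z \<in> tang y \<Longrightarrow> z \<noteq> 0 \<Longrightarrow> dist z 0 < d \<Longrightarrow> P (chart y z)" by blast
    define S where "S = chart y ` (ball 0 d \<inter> tang y)"
    have "openin (otop y) S"
      unfolding S_def using open_along_ball_Int[OF subspace_tang, of y 0 d]
      by (intro openin_chart_image) (simp add: open_along_def)
    moreover have "y \<in> S"
      unfolding S_def using d(1) subspace_0[OF subspace_tang, of y] chart_zero[of y]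
      by (intro image_eqI[of _ _ 0]) auto
    moreover have "P x" if x: "x \<in> S - {y}" for x
    proof -
      obtain z where z: "z \<in> ball 0 d \<inter> tang y" "x = chart y z" using x unfolding S_def by blast
      then have "z \<noteq> 0" using x by auto
      then show ?thesis using d(2) z by auto
    qed
    ultimately show "\<exists>S. openin (otop y) S \<and> y \<in> S \<and> (\<forall>x\<in>S - {y}. P x)" by blast
  qed
  then show "eventually P (atin (otop y) y) \<longleftrightarrow>
      eventually P (filtermap (chart y) (at 0 within tang y))"
    using orb_refl[of y] by (simp add: eventually_atin topspace_otop eventually_filtermap eventually_at)
qed

text \<open>One side divides by ambient increments \<open>chart y z - y\<close>, the other by
  coordinates \<open>z\<close>. Their difference is of smaller order because the chart is tangent to
  the identity.\<close>

lemma has_derivative_atin_otop: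
  fixes F :: "'a dual \<Rightarrow> 'b::real_normed_vector"
  shows "(F has_derivative D) (atin (otop y) y) \<longleftrightarrow>
    ((\<lambda>z. F (chart y z)) has_derivative D) (at 0 within tang y)"
proof (cases "at 0 within tang y = bot")
  \<comment> \<open>Here the tangent space is zero: the filter is trivial and both sides say only
    that \<open>D\<close> is bounded linear.\<close>
  case True
  then show ?thesis unfolding atin_otop by (simp add: has_derivative_def)
next
  case False
  let ?A = "at 0 within tang y"
  have cont: "((\<lambda>z. chart y z) \<longlongrightarrow> y) ?A"
    using has_derivative_continuous[OF has_derivative_at_withinI[OF chart_has_derivative[of y 0], where s = "tang y"]]
    by (simp add: continuous_within)
  then have lim: "Lim (atin (otop y) y) (\<lambda>x. x) = y"
    unfolding atin_otop by (intro tendsto_Lim) (simp_all add: False filtermap_bot_iff filterlim_filtermap)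
  define a where "a = (\<lambda>z. F (chart y z) - F y)"
  show ?thesis
  proof (cases "bounded_linear D")
    case False
    then show ?thesis by (simp add: has_derivative_def)
  next
    case bl: True
    define q1 where "q1 = (\<lambda>z. (a z - D (chart y z - y)) /\<^sub>R norm (chart y z - y))"
    define q2 where "q2 = (\<lambda>z. (a z - D z) /\<^sub>R norm z)"
    define r where "r = (\<lambda>z. norm (chart y z - y - z) / norm z)"
    have "((\<lambda>z. (1 / norm z) *\<^sub>R (chart y z - (y + L_dual (lift y z) y))) \<longlongrightarrow> 0) ?A"
      using has_derivative_at_withinI[OF chart_has_derivative[of y 0], where s = "tang y"]
        linear_0[OF bounded_linear.linear[OF lift(1)]]
      by (simp add: has_derivative_within)
    then have "((\<lambda>z. norm ((1 / norm z) *\<^sub>R (chart y z - (y + L_dual (lift y z) y)))) \<longlongrightarrow> 0) ?A"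
      by (rule tendsto_norm_zero)
    moreover have "\<forall>\<^sub>F z in ?A. norm ((1 / norm z) *\<^sub>R (chart y z - (y + L_dual (lift y z) y))) = r z"
      unfolding eventually_at by (intro exI[of _ 1]) (auto simp: r_def lift(2) diff_diff_eq)
    ultimately have r0: "(r \<longlongrightarrow> 0) ?A" by (rule Lim_transform_eventually)
    have ev: "\<forall>\<^sub>F z in ?A. z \<noteq> 0 \<and> z \<in> dom y"
      unfolding eventually_at using rad(1)[of y] by (intro exI[of _ "rad y"]) (auto simp: dist_norm)
    have cmp: "norm (chart y z - y) \<le> 3/2 * norm z" "norm z \<le> 2 * norm (chart y z - y)" "norm (chart y z - y) > 0"
      if "z \<noteq> 0 \<and> z \<in> dom y" for z
    proof -
      have "norm (chart y z - y - z) \<le> 1/2 * norm z" using rad(2)[of z y 0, OF _ zero_in_dom] that by simp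
      then show "norm (chart y z - y) \<le> 3/2 * norm z"
        using norm_triangle_sub[of "chart y z - y" z] by simp
      show le: "norm z \<le> 2 * norm (chart y z - y)" using chart_expanding[of z y 0, OF _ zero_in_dom] that by simp
      have "norm z > 0" using that by simp
      with le show "norm (chart y z - y) > 0" by linarith
    qed
    have "(q1 \<longlongrightarrow> 0) ?A \<longleftrightarrow> (q2 \<longlongrightarrow> 0) ?A"
    proof
      assume q1: "(q1 \<longlongrightarrow> 0) ?A"
      have "\<forall>\<^sub>F z in ?A. norm (norm (z - (chart y z - y)) / norm (chart y z - y)) \<le> 2 * r z"
        using ev
      proof (rule eventually_mono)
        fix z assume z: "z \<noteq> 0 \<and> z \<in> dom y"
        have "norm (chart y z - y - z) * norm z \<le> norm (chart y z - y - z) * (2 * norm (chart y z - y))"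
          by (intro mult_left_mono cmp(2)[OF z]) simp
        then show "norm (norm (z - (chart y z - y)) / norm (chart y z - y)) \<le> 2 * r z"
          unfolding norm_minus_commute[of z "chart y z - y"]
          using z cmp(3)[OF z] by (simp add: r_def field_simps)
      qed
      then have "((\<lambda>z. norm (z - (chart y z - y)) / norm (chart y z - y)) \<longlongrightarrow> 0) ?A"
        by (rule Lim_null_comparison) (use tendsto_mult_right[OF r0, of 2] in \<open>simp add: mult.commute\<close>)
      moreover have "\<forall>\<^sub>F z in ?A. chart y z - y \<noteq> 0 \<and> norm (chart y z - y) \<le> 3/2 * norm z"
        by (rule eventually_mono[OF ev]) (use cmp in fastforce)
      ultimately show "(q2 \<longlongrightarrow> 0) ?A"
        using q1 unfolding q1_def q2_def by (rule relative_remainder_transfer[OF bl])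
    next
      assume q2: "(q2 \<longlongrightarrow> 0) ?A"
      have "\<forall>\<^sub>F z in ?A. z \<noteq> 0 \<and> norm z \<le> 2 * norm (chart y z - y)"
        by (rule eventually_mono[OF ev]) (use cmp(2) in blast)
      then show "(q1 \<longlongrightarrow> 0) ?A"
        using q2 r0 unfolding q1_def q2_def r_def by (rule relative_remainder_transfer[OF bl, rotated])
    qed
    moreover have "(F has_derivative D) (atin (otop y) y) \<longleftrightarrow> (q1 \<longlongrightarrow> 0) ?A"
      unfolding has_derivative_def lim using bl
      by (simp add: atin_otop filterlim_filtermap q1_def a_def)
    moreover have "((\<lambda>z. F (chart y z)) has_derivative D) ?A \<longleftrightarrow> (q2 \<longlongrightarrow> 0) ?A"
      unfolding has_derivative_def using bl \<open>?A \<noteq> bot\<close>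
      by (simp add: Lim_ident_at q2_def a_def)
    ultimately show ?thesis by simp
  qed
qed

text \<open>The coefficient \<open>v\<close> need not be the lift of \<open>X\<close>: two
  coefficients of the same tangent vector differ by an element annihilating the point, in whose
  direction the pulled-back function has zero derivative.\<close>

lemma dir_otop:
  fixes F :: "'a dual \<Rightarrow> 'b::real_normed_vector"
  assumes F: "smooth (\<lambda>u::'a. F (Phi u y))" and X: "X (Phi u y) = L_dual v (Phi u y)"
  shows "dir (otop y) X F (Phi u y) = frechet_derivative (\<lambda>u. F (Phi u y)) (at u) v"
proof -
  define x where "x = Phi u y"
  let ?G = "\<lambda>u::'a. F (Phi u y)"
  let ?D = "frechet_derivative ?G (at u)"
  have G: "(?G has_derivative ?D) (at u)" by (rule smooth_has_derivative[OF F])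
  have "((\<lambda>z. lift x z + u) has_derivative lift x) (at 0)"
    by (intro has_derivative_add_const bounded_linear_imp_has_derivative lift(1))
  moreover have "(?G has_derivative ?D) (at (lift x 0 + u))"
    using G linear_0[OF bounded_linear.linear[OF lift(1)]] by simp
  ultimately have "((\<lambda>z. ?G (lift x z + u)) has_derivative (\<lambda>z. ?D (lift x z))) (at 0)"
    by (rule has_derivative_compose)
  moreover have eq: "F (chart x z) = ?G (lift x z + u)" for z
    by (simp add: chart_def x_def Phi_add)
  ultimately have Fc: "((\<lambda>z. F (chart x z)) has_derivative (\<lambda>z. ?D (lift x z))) (at 0)" by simp
  \<comment> \<open>Two expressions for the derivative of \<open>?G (w + u)\<close> at
    \<open>w = 0\<close> are compared; this shows that \<open>?D w\<close> depends on
    \<open>L_dual w x\<close> alone.\<close>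
  have "((\<lambda>w. L_dual w x) has_derivative (\<lambda>w. L_dual w x)) (at 0)"
    by (rule bounded_linear_imp_has_derivative[OF bounded_linear_L_dual_left])
  moreover have "((\<lambda>z. F (chart x z)) has_derivative (\<lambda>z. ?D (lift x z))) (at (L_dual 0 x))"
    using Fc by (simp add: L_dual_zero)
  ultimately have "((\<lambda>w. F (chart x (L_dual w x))) has_derivative (\<lambda>w. ?D (lift x (L_dual w x)))) (at 0)"
    by (rule has_derivative_compose)
  then have 1: "((\<lambda>w. ?G (w + u)) has_derivative (\<lambda>w. ?D (lift x (L_dual w x)))) (at 0)"
    by (simp add: chart_L_dual x_def Phi_add)
  have "((\<lambda>w. w + u) has_derivative (\<lambda>w. w)) (at 0)"
    by (intro has_derivative_add_const has_derivative_ident)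
  moreover have "(?G has_derivative ?D) (at (0 + u))" using G by simp
  ultimately have "((\<lambda>w. ?G (w + u)) has_derivative ?D) (at 0)"
    by (rule has_derivative_compose)
  from has_derivative_unique[OF 1 this] have 2: "?D (lift x (L_dual w x)) = ?D w" for w by metis
  have "dir (otop x) X F x = frechet_derivative (\<lambda>z. F (chart x z)) (at 0 within tang x) (X x)"
    by (simp add: dir_def frechet_derivative_def has_derivative_atin_otop)
  also have "\<dots> = ?D (lift x (X x))"
    by (rule frechet_derivative_subspace[OF open_along_tang _ _ has_derivative_at_withinI[OF Fc]])
      (use subspace_0[OF subspace_tang, of x] X in \<open>auto simp: x_def\<close>)
  also have "\<dots> = ?D v" unfolding X[folded x_def] by (rule 2)
  finally show ?thesis using otop_eq[of x y] by (simp add: x_def)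
qed

text \<open>Vector fields on the orbit of \<open>y\<close> correspond to maps \<open>\<xi>\<close> from the group to the algebra.\<close>

definition coord :: "'a dual \<Rightarrow> ('a dual \<Rightarrow> 'a dual) \<Rightarrow> 'a \<Rightarrow> 'a"
  where "coord y X u = lift y (Phi (- u) (X (Phi u y)))"

lemma smooth_coord:
  assumes "vector_field (otop y) X"
  shows "smooth (coord y X)"
proof -
  have "smooth (\<lambda>u::'a. Phi (- u) (X (Phi u y)))"
    by (rule smooth_along_Phi)
      (use assms in \<open>simp_all add: vector_field_otop_iff smooth_along_uminus smooth_along_id\<close>)
  then show ?thesis
    unfolding coord_def[abs_def] by (intro smooth_along_linear[OF _ lift(1)]) simp_all
qed

lemma vector_field_coord:
  assumes "vector_field (otop y) X"
  shows "X (Phi u y) = L_dual (coord y X u) (Phi u y)"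
proof -
  obtain c :: 'a where c: "X (Phi u y) = L_dual c (Phi u y)"
    using assms by (force simp: vector_field_otop_iff)
  then have "Phi (- u) (X (Phi u y)) = L_dual c y" by (simp add: L_dual_Phi)
  then have "L_dual (coord y X u) y = Phi (- u) (X (Phi u y))" by (simp add: coord_def lift(2))
  then show ?thesis by (simp add: L_dual_Phi)
qed

lemma dir_coord:
  fixes F :: "'a dual \<Rightarrow> 'b::real_normed_vector"
  assumes "vector_field (otop y) X" "smooth (\<lambda>u::'a. F (Phi u y))"
  shows "dir (otop y) X F (Phi u y) = frechet_derivative (\<lambda>u. F (Phi u y)) (at u) (coord y X u)"
  by (rule dir_otop) (rule assms(2), rule vector_field_coord[OF assms(1)])

section \<open>The induced connection in group coordinates\<close>

lemma vector_field_smooth: "vector_field (otop y) X \<Longrightarrow> smooth (\<lambda>u::'a. X (Phi u y))"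
  by (simp add: vector_field_otop_iff)

lemma derivative_orbit_map: "frechet_derivative (\<lambda>u::'a. Phi u y) (at u) v = L_dual v (Phi u y)"
  by (simp add: frechet_derivative_eq[OF orbit_map_has_derivative])

lemma derivative_vector_field:
  assumes "vector_field (otop y) Y"
  shows "frechet_derivative (\<lambda>u::'a. Y (Phi u y)) (at u) v =
    L_dual (frechet_derivative (coord y Y) (at u) v + v * coord y Y u) (Phi u y)"
  unfolding vector_field_coord[OF assms]
  using smooth_coord[OF assms] smooth_orbit_map[of y]
  by (simp add: derivative_L_dual derivative_orbit_map L_dual_L_dual L_dual_add mult.commute add.commute)

lemma dir_vector_field:
  assumes "vector_field (otop y) X" "vector_field (otop y) Y"
  shows "dir (otop y) X Y (Phi u y) =
    L_dual (frechet_derivative (coord y Y) (at u) (coord y X u) + coord y X u * coord y Y u) (Phi u y)"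
  by (simp add: dir_coord[OF assms(1) vector_field_smooth[OF assms(2)]] derivative_vector_field[OF assms(2)])

lemma vector_field_dir:
  assumes X: "vector_field (otop y) X" and Y: "vector_field (otop y) Y"
  shows "vector_field (otop y) (dir (otop y) X Y)"
  unfolding vector_field_otop_iff
proof
  show "smooth (\<lambda>u::'a. dir (otop y) X Y (Phi u y))"
    unfolding dir_coord[OF X vector_field_smooth[OF Y]]
    by (rule smooth_derivative_along[OF fin_dim_algebra vector_field_smooth[OF Y] smooth_coord[OF X]])
  show "\<forall>x\<in>orb y. dir (otop y) X Y x \<in> tang x"
    by (auto simp: orbit_def dir_vector_field[OF X Y])
qed

lemma vector_field_otop_add:
  assumes "vector_field (otop y) X" "vector_field (otop y) Y"
  shows "vector_field (otop y) (\<lambda>x. X x + Y x)"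
  using assms subspace_add[OF subspace_tang] by (simp add: vector_field_otop_iff smooth_along_add)

lemma vector_field_otop_scaleR:
  assumes "smooth_map (otop y) \<phi>" "vector_field (otop y) X"
  shows "vector_field (otop y) (\<lambda>x. \<phi> x *\<^sub>R X x)"
  using assms subspace_scale[OF subspace_tang]
  by (simp add: vector_field_otop_iff smooth_map_otop_iff smooth_along_bilinear[OF _ bounded_bilinear_scaleR])

lemma affine_connection_otop: "affine_connection (otop y) (nabla0_on (otop y))"
  unfolding affine_connection_def nabla0_on_def topspace_otop
proof (intro conjI allI impI ballI, goal_cases)
  case (1 X Y)
  then show ?case by (rule vector_field_dir)
next
  case (2 X X' Y x)
  then obtain u :: 'a where x: "x = Phi u y" by (auto simp: orbit_def)
  note s = vector_field_smooth[OF 2(3)]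
  \<comment> \<open>By \<open>dir_otop\<close> any coefficient of the sum vector will do, so
    \<open>coord\<close> of the sum field never has to be computed.\<close>
  have "X (Phi u y) + X' (Phi u y) = L_dual (coord y X u + coord y X' u) (Phi u y)"
    by (simp only: vector_field_coord[OF 2(1), of u] vector_field_coord[OF 2(2), of u] L_dual_add)
  from dir_otop[OF s, of "\<lambda>x. X x + X' x", OF this] show ?case
    unfolding x dir_coord[OF 2(1) s] dir_coord[OF 2(2) s] by (simp add: linear_add[OF smooth_linear_derivative[OF s]])
next
  case (3 \<phi> X Y x)
  then obtain u :: 'a where x: "x = Phi u y" by (auto simp: orbit_def)
  note s = vector_field_smooth[OF 3(3)]
  have "\<phi> (Phi u y) *\<^sub>R X (Phi u y) = L_dual (\<phi> (Phi u y) *\<^sub>R coord y X u) (Phi u y)"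
    by (simp only: vector_field_coord[OF 3(2), of u] L_dual_scaleR)
  from dir_otop[OF s, of "\<lambda>x. \<phi> x *\<^sub>R X x", OF this] show ?case
    unfolding x dir_coord[OF 3(2) s] by (simp add: linear_scale[OF smooth_linear_derivative[OF s]])
next
  case (4 X Y Y' x)
  then obtain u :: 'a where x: "x = Phi u y" by (auto simp: orbit_def)
  note s = vector_field_smooth[OF 4(2)] vector_field_smooth[OF 4(3)]
    vector_field_smooth[OF vector_field_otop_add[OF 4(2,3)]]
  show ?case
    unfolding x dir_coord[OF 4(1) s(1)] dir_coord[OF 4(1) s(2)] dir_coord[OF 4(1) s(3)]
    by (rule smooth_derivative_add[OF s(1,2)])
next
  case (5 \<phi> X Y x)
  then obtain u :: 'a where x: "x = Phi u y" by (auto simp: orbit_def)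
  have \<phi>: "smooth (\<lambda>u::'a. \<phi> (Phi u y))" using 5(1) by (simp add: smooth_map_otop_iff)
  note s = vector_field_smooth[OF 5(3)] vector_field_smooth[OF vector_field_otop_scaleR[OF 5(1,3)]]
  show ?case
    unfolding x dir_coord[OF 5(2) s(1)] dir_coord[OF 5(2) s(2)] dir_coord[OF 5(2) \<phi>]
      smooth_derivative_bilinear[OF bounded_bilinear_scaleR \<phi> s(1)]
    by simp
qed

lemma torsion_free_otop: "torsion_free (otop y) (nabla0_on (otop y))"
  by (simp add: torsion_free_def nabla0_on_def lie_bracket_def)

lemma flat_otop: "flat (otop y) (nabla0_on (otop y))"
  unfolding flat_def nabla0_on_def topspace_otop
proof (intro allI impI ballI)
  fix X Y Z x
  assume X: "vector_field (otop y) X" and Y: "vector_field (otop y) Y" and Z: "vector_field (otop y) Z"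
    and "x \<in> orb y"
  then obtain u :: 'a where x: "x = Phi u y" by (auto simp: orbit_def)
  note s = vector_field_smooth[OF Z]
  \<comment> \<open>A coefficient of the bracket: commutativity cancels the multiplication terms of
    the two derivatives and leaves the direction that occurs in
    \<open>derivative_along_commutator\<close>.\<close>
  define v where "v = frechet_derivative (coord y Y) (at u) (coord y X u)
    - frechet_derivative (coord y X) (at u) (coord y Y u)"
  have "lie_bracket (otop y) X Y (Phi u y) = L_dual v (Phi u y)"
    unfolding lie_bracket_def dir_vector_field[OF X Y] dir_vector_field[OF Y X] v_def
    by (simp add: L_dual_diff[symmetric] mult.commute)
  note b = dir_otop[OF s, of "lie_bracket (otop y) X Y", OF this]
  show "dir (otop y) X (dir (otop y) Y Z) x - dir (otop y) Y (dir (otop y) X Z) x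
      - dir (otop y) (lie_bracket (otop y) X Y) Z x = 0"
    unfolding x b dir_coord[OF X vector_field_smooth[OF vector_field_dir[OF Y Z]]]
      dir_coord[OF Y vector_field_smooth[OF vector_field_dir[OF X Z]]]
      dir_coord[OF Y s] dir_coord[OF X s]
      derivative_along_commutator[OF fin_dim_algebra s smooth_coord[OF X] smooth_coord[OF Y]] v_def
    by simp
qed

section \<open>The metric on an orbit and its covariant derivatives\<close>

text \<open>By commutativity the form depends on each argument only through its image under
  \<open>L_dual\<close>, so representatives can be exchanged one at a time and the description has a
  unique value.\<close>

lemma leaf_metric_alg:
  "leaf_metric alg_bivector x (L_dual u x) (L_dual v x) = blinfun_apply x (u * v)" for u v :: 'a
  unfolding leaf_metric_def
proof (rule the_equality)
  show "\<exists>u' v'. sharp alg_bivector x u' = L_dual u x \<and> sharp alg_bivector x v' = L_dual v x \<and>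
      blinfun_apply x (u * v) = alg_bivector x u' v'"
    by (intro exI[of _ u] exI[of _ v]) (simp add: sharp_alg_bivector alg_bivector_def)
  fix r assume "\<exists>u' v'. sharp alg_bivector x u' = L_dual u x \<and> sharp alg_bivector x v' = L_dual v x \<and>
      r = alg_bivector x u' v'"
  then obtain u' v' where u': "L_dual u' x = L_dual u x" and v': "L_dual v' x = L_dual v x"
    and r: "r = blinfun_apply x (u' * v')"
    by (auto simp: sharp_alg_bivector alg_bivector_def)
  have "r = blinfun_apply (L_dual u' x) v'" by (simp add: r)
  also have "\<dots> = blinfun_apply (L_dual v' x) u" unfolding u' by (simp add: mult.commute)
  also have "\<dots> = blinfun_apply x (u * v)" unfolding v' by (simp add: mult.commute)
  finally show "r = blinfun_apply x (u * v)" .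
qed

lemma leaf_metric_fields:
  assumes "vector_field (otop y) Y" "vector_field (otop y) Z"
  shows "leaf_metric alg_bivector (Phi u y) (Y (Phi u y)) (Z (Phi u y)) =
    blinfun_apply (Phi u y) (coord y Y u * coord y Z u)"
  unfolding vector_field_coord[OF assms(1)] vector_field_coord[OF assms(2)] by (rule leaf_metric_alg)

lemma smooth_leaf_metric:
  assumes "vector_field (otop y) Y" "vector_field (otop y) Z"
  shows "smooth (\<lambda>u::'a. leaf_metric alg_bivector (Phi u y) (Y (Phi u y)) (Z (Phi u y)))"
  unfolding leaf_metric_fields[OF assms]
  by (intro smooth_apply smooth_mult smooth_orbit_map smooth_coord assms) simp_all

lemma pseudo_riemannian_metric_otop: "pseudo_riemannian_metric (otop y) (leaf_metric alg_bivector)"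
  unfolding pseudo_riemannian_metric_def topspace_otop
proof (intro conjI ballI allI impI)
  fix x s t assume x: "x \<in> orb y" and "s \<in> tangent (otop y) x" "t \<in> tangent (otop y) x"
  then obtain a b :: 'a where s: "s = L_dual a x" and t: "t = L_dual b x" by (auto simp: tangent_otop)
  show "leaf_metric alg_bivector x s t = leaf_metric alg_bivector x t s"
    by (simp add: s t leaf_metric_alg mult.commute)
  show "leaf_metric alg_bivector x (c *\<^sub>R s) t = c * leaf_metric alg_bivector x s t" for c
    by (simp add: s t L_dual_scaleR[symmetric] leaf_metric_alg blinfun.scaleR_right)
  fix w assume "w \<in> tangent (otop y) x"
  then obtain c :: 'a where w: "w = L_dual c x" using x by (auto simp: tangent_otop)
  show "leaf_metric alg_bivector x (s + t) w = leaf_metric alg_bivector x s w + leaf_metric alg_bivector x t w"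
    by (simp add: s t w L_dual_add[symmetric] leaf_metric_alg blinfun.add_right distrib_right)
next
  fix x s assume x: "x \<in> orb y" and "s \<in> tangent (otop y) x"
    and 0: "\<forall>v\<in>tangent (otop y) x. leaf_metric alg_bivector x s v = 0"
  then obtain a :: 'a where s: "s = L_dual a x" by (auto simp: tangent_otop)
  show "s = 0"
  proof (rule blinfun_eqI)
    fix b :: 'a
    \<comment> \<open>Pairing with \<open>L_dual b x\<close> evaluates \<open>s\<close> at
      \<open>b\<close>; this gives nondegeneracy.\<close>
    have "leaf_metric alg_bivector x s (L_dual b x) = 0" using 0 x by (auto simp: tangent_otop)
    then show "blinfun_apply s b = blinfun_apply 0 b" by (simp add: s leaf_metric_alg)
  qed
next
  fix X Y assume "vector_field (otop y) X" "vector_field (otop y) Y"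
  then show "smooth_map (otop y) (\<lambda>x. leaf_metric alg_bivector x (X x) (Y x))"
    unfolding smooth_map_otop_iff by (rule smooth_leaf_metric)
qed

text \<open>The moving base point contributes the cubic term once and the multiplication part of the
  connection subtracts it twice; the derivatives of the coordinates cancel.\<close>

lemma cov_metric_coord:
  assumes X: "vector_field (otop y) X" and Y: "vector_field (otop y) Y" and Z: "vector_field (otop y) Z"
  shows "cov_metric (otop y) (nabla0_on (otop y)) (leaf_metric alg_bivector) X Y Z (Phi u y) =
    - blinfun_apply (Phi u y) (coord y X u * coord y Y u * coord y Z u)"
proof -
  have YZ: "smooth (\<lambda>u. coord y Y u * coord y Z u)" by (intro smooth_mult smooth_coord Y Z) simp
  show ?thesis
    unfolding cov_metric_def nabla0_on_def dir_coord[OF X smooth_leaf_metric[OF Y Z]]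
      leaf_metric_fields[OF Y Z] dir_vector_field[OF X Y] dir_vector_field[OF X Z]
      vector_field_coord[OF Y, of u] vector_field_coord[OF Z, of u] leaf_metric_alg
      derivative_apply[OF smooth_orbit_map YZ] derivative_mult[OF smooth_coord[OF Y] smooth_coord[OF Z]]
      derivative_orbit_map
    by (simp add: blinfun.add_right distrib_left distrib_right mult_ac)
qed

text \<open>Coordinates of a field such as \<open>dir (otop y) W X\<close> are known only up to
  elements annihilating the point. Each factor of the cubic form can be replaced in turn, so the
  coefficient from \<open>dir_vector_field\<close> can be inserted directly.\<close>

lemma cov_metric_otop:
  fixes a b c :: 'a
  assumes V: "vector_field (otop y) X" "vector_field (otop y) Y" "vector_field (otop y) Z"
    and a: "X (Phi u y) = L_dual a (Phi u y)" and b: "Y (Phi u y) = L_dual b (Phi u y)"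
    and c: "Z (Phi u y) = L_dual c (Phi u y)"
  shows "cov_metric (otop y) (nabla0_on (otop y)) (leaf_metric alg_bivector) X Y Z (Phi u y) =
    - blinfun_apply (Phi u y) (a * b * c)"
proof -
  let ?x = "Phi u y"
  have a': "blinfun_apply ?x (a * w) = blinfun_apply ?x (coord y X u * w)" for w
    using a vector_field_coord[OF V(1), of u] by (metis L_dual_apply)
  have b': "blinfun_apply ?x (b * w) = blinfun_apply ?x (coord y Y u * w)" for w
    using b vector_field_coord[OF V(2), of u] by (metis L_dual_apply)
  have c': "blinfun_apply ?x (c * w) = blinfun_apply ?x (coord y Z u * w)" for w
    using c vector_field_coord[OF V(3), of u] by (metis L_dual_apply)
  have "blinfun_apply ?x (a * b * c) = blinfun_apply ?x (coord y X u * (b * c))"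
    using a'[of "b * c"] by (simp add: mult.assoc)
  also have "\<dots> = blinfun_apply ?x (coord y Y u * (coord y X u * c))"
    using b'[of "coord y X u * c"] by (simp add: mult.left_commute)
  also have "\<dots> = blinfun_apply ?x (coord y X u * coord y Y u * coord y Z u)"
    using c'[of "coord y X u * coord y Y u"] by (simp add: mult_ac)
  finally show ?thesis by (simp add: cov_metric_coord[OF V])
qed

lemma pseudo_Hessian_manifold_otop:
  "pseudo_Hessian_manifold (otop y) (nabla0_on (otop y)) (leaf_metric alg_bivector)"
  unfolding pseudo_Hessian_manifold_def
proof (intro conjI allI impI ballI immersed_submanifold_otop affine_connection_otop torsion_free_otop
    flat_otop pseudo_riemannian_metric_otop)
  fix X Y Z x
  assume V: "vector_field (otop y) X" "vector_field (otop y) Y" "vector_field (otop y) Z"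
    and "x \<in> topspace (otop y)"
  then obtain u :: 'a where x: "x = Phi u y" by (auto simp: orbit_def topspace_otop)
  let ?c = "cov_metric (otop y) (nabla0_on (otop y)) (leaf_metric alg_bivector)"
  show "?c X Y Z x = ?c Y X Z x"
    unfolding x cov_metric_coord[OF V] cov_metric_coord[OF V(2,1,3)] by (simp add: mult_ac)
  show "?c X Y Z x = ?c X Z Y x"
    unfolding x cov_metric_coord[OF V] cov_metric_coord[OF V(1,3,2)] by (simp add: mult_ac)
qed

text \<open>The variation of the base point and the multiplication terms of the connection are
  fourfold products and vanish by \<open>nil\<close>; the terms with a derivative of a coordinate
  cancel.\<close>

lemma affine_special_real_manifold_otop:
  assumes nil: "\<And>u v w x :: 'a. u * v * w * x = 0"
  shows "affine_special_real_manifold (otop y) (nabla0_on (otop y)) (leaf_metric alg_bivector)"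
  unfolding affine_special_real_manifold_def
proof (intro conjI allI impI ballI pseudo_Hessian_manifold_otop)
  fix W X Y Z x
  assume W: "vector_field (otop y) W" and X: "vector_field (otop y) X"
    and Y: "vector_field (otop y) Y" and Z: "vector_field (otop y) Z"
    and "x \<in> topspace (otop y)"
  then obtain u :: 'a where x: "x = Phi u y" by (auto simp: orbit_def topspace_otop)
  let ?c = "cov_metric (otop y) (nabla0_on (otop y)) (leaf_metric alg_bivector)"
  let ?D = "\<lambda>X. frechet_derivative (coord y X) (at u) (coord y W u)"
  have XY: "smooth (\<lambda>u. coord y X u * coord y Y u)" by (intro smooth_mult smooth_coord X Y) simp
  have XYZ: "smooth (\<lambda>u. coord y X u * coord y Y u * coord y Z u)"
    by (intro smooth_mult[OF _ XY] smooth_coord Z) simp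
  have "smooth (\<lambda>u. blinfun_apply (Phi u y) (coord y X u * coord y Y u * coord y Z u))"
    by (intro smooth_apply smooth_orbit_map XYZ) simp
  from smooth_along_uminus[OF _ this]
  have s: "smooth (\<lambda>u::'a. ?c X Y Z (Phi u y))" unfolding cov_metric_coord[OF X Y Z] by simp
  have "dir (otop y) W (?c X Y Z) (Phi u y) =
    - (blinfun_apply (Phi u y) (?D X * coord y Y u * coord y Z u)
      + blinfun_apply (Phi u y) (coord y X u * ?D Y * coord y Z u)
      + blinfun_apply (Phi u y) (coord y X u * coord y Y u * ?D Z))"
  proof -
    have "frechet_derivative (\<lambda>u. - blinfun_apply (Phi u y) (coord y X u * coord y Y u * coord y Z u)) (at u) v =
      - frechet_derivative (\<lambda>u. blinfun_apply (Phi u y) (coord y X u * coord y Y u * coord y Z u)) (at u) v" for v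
      using frechet_derivative_eq[OF has_derivative_minus[OF smooth_has_derivative[OF
          \<open>smooth (\<lambda>u. blinfun_apply (Phi u y) (coord y X u * coord y Y u * coord y Z u))\<close>]]] by simp
    then show ?thesis
      unfolding dir_coord[OF W s] cov_metric_coord[OF X Y Z]
      by (simp add: derivative_apply[OF smooth_orbit_map XYZ] derivative_mult[OF XY smooth_coord[OF Z]]
          derivative_mult[OF smooth_coord[OF X] smooth_coord[OF Y]] derivative_orbit_map
          blinfun.add_right distrib_left distrib_right nil mult.assoc[symmetric] blinfun.zero_right)
  qed
  moreover have "?c (dir (otop y) W X) Y Z (Phi u y) = - blinfun_apply (Phi u y) (?D X * coord y Y u * coord y Z u)"
    by (simp add: cov_metric_otop[OF vector_field_dir[OF W X] Y Z dir_vector_field[OF W X]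
        vector_field_coord[OF Y] vector_field_coord[OF Z]] distrib_right nil)
  moreover have "?c X (dir (otop y) W Y) Z (Phi u y) = - blinfun_apply (Phi u y) (coord y X u * ?D Y * coord y Z u)"
    by (simp add: cov_metric_otop[OF X vector_field_dir[OF W Y] Z vector_field_coord[OF X]
        dir_vector_field[OF W Y] vector_field_coord[OF Z]] distrib_left distrib_right nil mult.assoc[symmetric])
  moreover have "?c X Y (dir (otop y) W Z) (Phi u y) = - blinfun_apply (Phi u y) (coord y X u * coord y Y u * ?D Z)"
    by (simp add: cov_metric_otop[OF X Y vector_field_dir[OF W Z] vector_field_coord[OF X]
        vector_field_coord[OF Y] dir_vector_field[OF W Z]] distrib_left nil mult.assoc[symmetric])
  ultimately show "dir (otop y) W (?c X Y Z) x - ?c (nabla0_on (otop y) W X) Y Z x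
      - ?c X (nabla0_on (otop y) W Y) Z x - ?c X Y (nabla0_on (otop y) W Z) x = 0"
    unfolding x nabla0_on_def by simp
qed

text \<open>Since \<open>X\<close> is tangent to the orbit, the chain rule along the orbit map
  identifies the derivative on the orbit with the ambient one.\<close>

lemma induced_connection_otop: "induced_connection nabla0 (otop y) (nabla0_on (otop y))"
  unfolding induced_connection_def
proof (intro conjI allI impI ballI affine_connection_otop)
  fix X Y :: "'a dual \<Rightarrow> 'a dual" and x
  assume "vector_field euclidean X" "vector_field euclidean Y"
    and t: "\<forall>x\<in>topspace (otop y). X x \<in> tangent (otop y) x \<and> Y x \<in> tangent (otop y) x"
    and x: "x \<in> topspace (otop y)"
  then have Y: "smooth Y" by (simp add: vector_field_dual_iff)
  have xo: "x \<in> orb y" using x by (simp add: topspace_otop)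
  obtain u :: 'a where u: "x = Phi u y" using xo by (auto simp: orbit_def)
  obtain v :: 'a where v: "X x = L_dual v x"
    using t x tangent_otop[OF xo] by blast
  have s: "smooth (\<lambda>u::'a. Y (Phi u y))"
    by (rule smooth_along_compose_smooth[OF fin_dim_alg_dual _ smooth_orbit_map Y]) simp
  have "frechet_derivative (\<lambda>u::'a. Y (Phi u y)) (at u) v = frechet_derivative Y (at x) (L_dual v x)"
    using frechet_derivative_eq[OF has_derivative_compose[OF orbit_map_has_derivative smooth_has_derivative[OF Y]], of y u]
    by (simp add: u)
  then show "nabla0_on (otop y) X Y x = nabla0 X Y x"
    unfolding nabla0_on_def nabla0_def using dir_otop[OF s, of X u v] v u by simp
qed

end

section \<open>Integral manifolds are open pieces of orbits\<close>

text \<open>A dimension count: \<open>A\<close> shows that \<open>E\<close> and \<open>T\<close>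
  have equal dimension, \<open>B\<close> and \<open>C\<close> preserve dimension, and an inclusion
  of subspaces of equal finite dimension is an equality.\<close>

lemma linear_image_eq_if_subset:
  fixes A B :: "'v::real_normed_vector \<Rightarrow> 'v"
  assumes fd: "fin_dim (UNIV :: 'v set)" and E: "subspace E" "subspace T"
    and lin: "linear A" "linear B" "linear C"
    and inj: "\<And>v. v \<in> E \<Longrightarrow> A v = 0 \<Longrightarrow> v = 0" "\<And>v. v \<in> T \<Longrightarrow> B v = 0 \<Longrightarrow> v = 0"
      "\<And>v. v \<in> E \<Longrightarrow> C v = 0 \<Longrightarrow> v = 0"
    and AE: "A ` E = T" and sub: "B ` T \<subseteq> C ` E"
  shows "B ` T = C ` E"
proof -
  obtain Bs :: "'v set" where Bs: "finite Bs" "independent Bs" "span Bs = UNIV"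
    using fin_dim_basis[OF fd] by (metis top.extremum_unique)
  interpret fd: finite_dimensional_vector_space "scaleR :: real \<Rightarrow> 'v \<Rightarrow> 'v" Bs
    by unfold_locales (use Bs in \<open>auto simp: dependent_raw_def span_raw_def algebra_simps\<close>)
  interpret fdp: finite_dimensional_vector_space_pair_1 "scaleR :: real \<Rightarrow> 'v \<Rightarrow> 'v" Bs "scaleR :: real \<Rightarrow> 'v \<Rightarrow> 'v" ..
  have d: "dim (L ` S) = dim S" if "linear L" "subspace S" "\<And>v. v \<in> S \<Longrightarrow> L v = 0 \<Longrightarrow> v = 0"
    for L :: "'v \<Rightarrow> 'v" and S
    unfolding dim_raw_def
  proof (rule fdp.dim_image_eq)
    show "Vector_Spaces.linear scaleR scaleR L" using that(1) by (simp add: linear_def)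
    have "inj_on L S" using linear_inj_on_iff_eq_0[OF that(1,2)] that(3) by blast
    then show "inj_on L (module.span scaleR S)"
      using that(2) by (simp add: span_raw_def[symmetric] span_eq_iff[THEN iffD2])
  qed
  have "dim (B ` T) = dim (C ` E)"
    using d[OF lin(2) E(2) inj(2)] d[OF lin(3) E(1) inj(3)] d[OF lin(1) E(1) inj(1)] AE by simp
  moreover have "subspace (B ` T)" "subspace (C ` E)"
    using linear_subspace_image[OF lin(2) E(2)] linear_subspace_image[OF lin(3) E(1)]
    by simp_all
  ultimately show ?thesis
    using fd.subspace_dim_equal[OF _ _ sub] by (simp add: subspace_raw_def dim_raw_def)
qed

context fd_comm_algebra
begin

text \<open>The map \<open>\<Psi> z = Phi (lift y (P z)) (y + (z - P z))\<close>, with \<open>P\<close> a projection onto the tangent space,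
  is a local diffeomorphism that straightens the distribution; in these coordinates an integral manifold
  through \<open>y\<close> has constant transversal component.\<close>

lemma integral_manifold_chart:
  assumes p: "parametrization \<sigma> E U f"
    and tan: "\<And>x. x \<in> U \<Longrightarrow> frechet_derivative f (at x within U) ` E = tang (f x)"
    and e0: "e0 \<in> U"
  obtains U' where "open_along E U'" "e0 \<in> U'" "U' \<subseteq> U" "continuous_map (top_of_set U') (otop (f e0)) f"
    "\<And>W. open_along E W \<Longrightarrow> e0 \<in> W \<Longrightarrow> W \<subseteq> U' \<Longrightarrow> \<exists>S. openin (otop (f e0)) S \<and> f e0 \<in> S \<and> S \<subseteq> f ` W"
proof -
  define y where "y = f e0"
  define T where "T = tang y"
  have sT: "subspace T" unfolding T_def by (rule subspace_tang)
  have E: "open_along E U" by (rule parametrization_open_along[OF p])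
  have sE: "subspace E" using E by (simp add: open_along_def)
  have sf: "smooth_along E U f" using p by (simp add: parametrization_def)
  let ?f' = "\<lambda>x. frechet_derivative f (at x within U)"
  note f' = parametrization_has_derivative[OF p]
  have lf: "linear (?f' x)" if "x \<in> U" for x
    using has_derivative_bounded_linear[OF f'[OF that]] by (rule bounded_linear.linear)
  have f'inj: "v = 0" if "x \<in> U" "v \<in> E" "?f' x v = 0" for x v
    using p that by (auto simp: parametrization_def)
  define A where "A = ?f' e0"
  have bA: "bounded_linear A" unfolding A_def by (rule has_derivative_bounded_linear[OF f'[OF e0]])
  have AE: "A ` E = T" using tan[OF e0] by (simp add: A_def T_def y_def)
  obtain J where J: "bounded_linear J" "\<And>v. v \<in> E \<Longrightarrow> J (A v) = v" "range J \<subseteq> E"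
    by (rule fin_dim_left_inverse[OF fin_dim_alg_dual bounded_linear.linear[OF bA] sE])
      (use f'inj[OF e0] in \<open>auto simp: A_def\<close>)
  obtain P :: "'a dual \<Rightarrow> 'a dual" where P: "bounded_linear P" "range P = T" "\<And>x. x \<in> T \<Longrightarrow> P x = x"
    by (rule fin_dim_projection[OF fin_dim_alg_dual sT]) (rule that; assumption)
  note lP = bounded_linear.linear[OF P(1)]
  define \<Psi> where "\<Psi> = (\<lambda>z. Phi (lift y (P z)) (y + (z - P z)))"
  define \<Psi>' where "\<Psi>' = (\<lambda>z v. Phi (lift y (P z)) ((v - P v) + L_dual (lift y (P v)) (y + (z - P z))))"
  have lifts: "L_dual (lift y x) y = x" if "x \<in> T" for x using that lift(2) by (simp add: T_def)
  have \<Psi>': "(\<Psi> has_derivative \<Psi>' z) (at z)" for z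
  proof -
    have "((\<lambda>z. (lift y (P z), y + (z - P z))) has_derivative (\<lambda>v. (lift y (P v), v - P v))) (at z)"
      by (intro has_derivative_Pair bounded_linear_imp_has_derivative bounded_linear_compose[OF lift(1) P(1)])
        (auto intro!: derivative_eq_intros bounded_linear_imp_has_derivative P(1))
    from has_derivative_compose[OF this Phi_has_derivative[of "lift y (P z)" "y + (z - P z)"]]
    show ?thesis by (simp add: \<Psi>_def \<Psi>'_def)
  qed
  have \<Psi>0: "\<Psi> 0 = y" "\<Psi>' 0 v = v" for v
    using lifts[of "P v"] P(2)
    by (auto simp: \<Psi>_def \<Psi>'_def linear_0[OF lP] linear_0[OF bounded_linear.linear[OF lift(1)]])
  have s\<Psi>: "smooth \<Psi>"
    unfolding \<Psi>_def
  proof (rule smooth_along_Phi)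
    show "smooth (\<lambda>z. lift y (P z))"
      by (rule smooth_along_linear[OF _ bounded_linear_compose[OF lift(1) P(1)] smooth_along_id]) simp_all
    show "smooth (\<lambda>z. y + (z - P z))"
      by (intro smooth_along_add smooth_along_const smooth_along_diff smooth_along_id
          smooth_along_linear[OF _ P(1)]) simp_all
  qed simp
  \<comment> \<open>Tangential directions are mapped into the distribution at every point, not only
    on the orbit of \<open>y\<close>; this is the straightening.\<close>
  have \<Psi>'T: "\<Psi>' z v \<in> tang (\<Psi> z)" if "v \<in> T" for z v
    using P(3)[OF that] by (auto simp: \<Psi>_def \<Psi>'_def L_dual_Phi)
  obtain KA where KA: "KA > 0" "\<And>v. norm (A v) \<le> norm v * KA" using bounded_linear.pos_bounded[OF bA] by blast
  obtain KJ where KJ: "KJ > 0" "\<And>v. norm (J v) \<le> norm v * KJ" using bounded_linear.pos_bounded[OF J(1)] by blast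
  \<comment> \<open>The constants make the composite of \<open>z\<close> and \<open>J\<close> differ
    from the identity of \<open>E\<close> by a Lipschitz error of at most 1/4 from \<open>f\<close>
    and 1/4 from \<open>\<Psi>\<close>.\<close>
  define \<eta> where "\<eta> = min 1 (1 / (4 * KJ))"
  define \<epsilon> where "\<epsilon> = min (1/2) (1 / (8 * KJ * (1 + KA)))"
  have \<eta>: "\<eta> > 0" "\<eta> \<le> 1" "KJ * \<eta> \<le> 1/4"
    using KJ(1) by (auto simp: \<eta>_def min_def field_simps)
  have \<epsilon>: "\<epsilon> > 0" "\<epsilon> \<le> 1/2" "KJ * (\<epsilon> * (2 * (1 + KA))) \<le> 1/4"
  proof -
    have K: "8 * KJ * (1 + KA) > 0" using KJ(1) KA(1) by simp
    then show "\<epsilon> > 0" "\<epsilon> \<le> 1/2" by (auto simp: \<epsilon>_def)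
    have "\<epsilon> \<le> 1 / (8 * KJ * (1 + KA))" by (simp add: \<epsilon>_def)
    then have "\<epsilon> * (8 * KJ * (1 + KA)) \<le> 1" using K by (simp add: pos_le_divide_eq)
    then show "KJ * (\<epsilon> * (2 * (1 + KA))) \<le> 1/4" by (simp add: algebra_simps)
  qed
  obtain \<delta>1 where \<delta>1: "\<delta>1 > 0"
    "\<And>z w. z \<in> ball 0 \<delta>1 \<Longrightarrow> w \<in> ball 0 \<delta>1 \<Longrightarrow> norm (\<Psi> z - \<Psi> w - (z - w)) \<le> \<epsilon> * norm (z - w)"
  proof -
    have "Ck_along (Suc 0) UNIV UNIV \<Psi>" using s\<Psi> by (simp only: smooth_along_def)
    moreover have "(\<Psi> has_derivative (\<lambda>v. v)) (at 0 within UNIV)" using \<Psi>'[of 0] by (simp add: \<Psi>0(2)[abs_def])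
    ultimately show thesis
      using strictly_differentiable[OF fin_dim_alg_dual _ _ _ _ \<epsilon>(1), of UNIV UNIV \<Psi> 0 "\<lambda>v. v"] that
      by auto
  qed
  have half: "norm (\<Psi> z - \<Psi> w - (z - w)) \<le> 1/2 * norm (z - w)" if "z \<in> ball 0 \<delta>1" "w \<in> ball 0 \<delta>1" for z w
    using \<delta>1(2)[OF that] mult_right_mono[OF \<epsilon>(2), of "norm (z - w)"] by simp
  have expand: "norm (z - w) \<le> 2 * norm (\<Psi> z - \<Psi> w)" if "z \<in> ball 0 \<delta>1" "w \<in> ball 0 \<delta>1" for z w
    using half[OF that] norm_triangle_ineq2[of "z - w" "\<Psi> z - \<Psi> w"] by (simp add: norm_minus_commute[of "z - w"])
  \<comment> \<open>Along a kernel vector \<open>\<Psi>\<close> would move by at most a quarter of a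
    small increment, against the lower bound 1/2 from \<open>expand\<close>.\<close>
  have \<Psi>'inj: "v = 0" if z: "z \<in> ball 0 \<delta>1" and v: "\<Psi>' z v = 0" for z v
  proof (rule ccontr)
    assume "v \<noteq> 0"
    obtain d where d: "d > 0" "\<And>w. norm (w - z) < d \<Longrightarrow> norm (\<Psi> w - \<Psi> z - \<Psi>' z (w - z)) \<le> 1/4 * norm (w - z)"
      using \<Psi>'[of z] unfolding has_derivative_at_alt by (metis zero_less_divide_1_iff zero_less_numeral)
    obtain r where r: "r > 0" "ball z r \<subseteq> ball 0 \<delta>1" using openE[OF open_ball z] by blast
    define t where "t = min d r / (2 * norm v)"
    have t: "t > 0" "t * norm v < d" "t * norm v < r"
      using d(1) r(1) \<open>v \<noteq> 0\<close> by (auto simp: t_def min_def)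
    define w where "w = z + t *\<^sub>R v"
    have wz: "w - z = t *\<^sub>R v" "norm (w - z) = t * norm v" using t(1) by (auto simp: w_def)
    have "linear (\<Psi>' z)" using has_derivative_bounded_linear[OF \<Psi>'] by (rule bounded_linear.linear)
    then have "\<Psi>' z (w - z) = 0" by (simp add: wz(1) linear_scale v)
    then have "norm (\<Psi> w - \<Psi> z) \<le> 1/4 * norm (w - z)" using d(2)[of w] wz(2) t(2) by simp
    moreover have "w \<in> ball 0 \<delta>1" using r(2) wz(2) t(3) by (auto simp: subset_iff dist_norm norm_minus_commute)
    ultimately have "norm (w - z) \<le> 1/2 * norm (w - z)" using expand[OF _ z, of w] by linarith
    moreover have "norm (w - z) > 0" using wz(2) t(1) \<open>v \<noteq> 0\<close> by simp
    ultimately show False by linarith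
  qed
  obtain \<delta>2 where \<delta>2: "\<delta>2 > 0" "ball e0 \<delta>2 \<inter> E \<subseteq> U"
    "\<And>x x'. x \<in> ball e0 \<delta>2 \<inter> E \<Longrightarrow> x' \<in> ball e0 \<delta>2 \<inter> E \<Longrightarrow>
      norm (f x - f x' - A (x - x')) \<le> \<eta> * norm (x - x')"
  proof -
    have "Ck_along (Suc 0) E U f" using sf by (simp only: smooth_along_def)
    from strictly_differentiable[OF fin_dim_alg_dual E this e0 f'[OF e0] \<eta>(1)] show thesis
      using that unfolding A_def by blast
  qed
  \<comment> \<open>The bound \<open>\<delta>1 / 4\<close> is half of the radius
    \<open>\<delta>1 / 2\<close> on which \<open>near_identity_surjective\<close> solves
    \<open>\<Psi> z = f x\<close>.\<close>
  obtain \<delta> where \<delta>: "\<delta> > 0" "\<delta> \<le> \<delta>2" "\<And>x. x \<in> ball e0 \<delta> \<inter> E \<Longrightarrow> norm (f x - y) \<le> \<delta>1 / 4"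
  proof -
    have "continuous (at e0 within U) f"
      using has_derivative_continuous[OF f'[OF e0]] .
    then obtain d where "d > 0" "\<And>x. x \<in> U \<Longrightarrow> dist x e0 < d \<Longrightarrow> dist (f x) (f e0) < \<delta>1 / 4"
      unfolding continuous_within_eps_delta using \<delta>1(1) by (metis divide_pos_pos zero_less_numeral)
    then show thesis
      using \<delta>2(1,2) by (intro that[of "min d \<delta>2"]) (auto simp: y_def dist_norm norm_minus_commute subset_iff less_imp_le)
  qed
  define N where "N = ball e0 \<delta> \<inter> E"
  have N: "open_along E N" unfolding N_def by (rule open_along_ball_Int[OF sE])
  have NU: "N \<subseteq> U" "N \<subseteq> ball e0 \<delta>2 \<inter> E" using \<delta>(2) \<delta>2(2) by (auto simp: N_def)
  have e0N: "e0 \<in> N" using e0 open_along_subset[OF E] \<delta>(1) by (auto simp: N_def)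
  have "\<exists>z. z \<in> cball 0 (\<delta>1 / 2) \<and> \<Psi> z = f x" if x: "x \<in> N" for x
  proof -
    obtain z where "z \<in> cball 0 (\<delta>1 / 2) \<inter> UNIV" "\<Psi> z = f x"
    proof (rule near_identity_surjective[of UNIV 0 "\<delta>1 / 2" \<Psi> "f x"])
      show "norm (\<Psi> z - \<Psi> w - (z - w)) \<le> 1/2 * norm (z - w)"
        if "z \<in> cball 0 (\<delta>1 / 2) \<inter> UNIV" "w \<in> cball 0 (\<delta>1 / 2) \<inter> UNIV" for z w
        using that \<delta>1(1) by (intro half) auto
      show "norm (f x - \<Psi> 0) \<le> \<delta>1 / 2 / 2"
        using \<delta>(3)[of x] x by (simp add: N_def \<Psi>0(1))
    qed (use \<delta>1(1) in auto)
    then show ?thesis by auto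
  qed
  then obtain z where z: "\<And>x. x \<in> N \<Longrightarrow> z x \<in> cball 0 (\<delta>1 / 2)" "\<And>x. x \<in> N \<Longrightarrow> \<Psi> (z x) = f x" by metis
  have zb: "z x \<in> ball 0 \<delta>1" if "x \<in> N" for x using z(1)[OF that] \<delta>1(1) by auto
  have z_lip: "norm (z x - z x') \<le> 2 * (1 + KA) * norm (x - x')" if "x \<in> N" "x' \<in> N" for x x'
  proof -
    have "norm (z x - z x') \<le> 2 * norm (f x - f x')"
      using expand[OF zb[OF that(1)] zb[OF that(2)]] z(2) that by simp
    also have "norm (f x - f x') \<le> norm (f x - f x' - A (x - x')) + norm (A (x - x'))"
      using norm_triangle_ineq[of "f x - f x' - A (x - x')" "A (x - x')"] by simp
    also have "\<dots> \<le> \<eta> * norm (x - x') + norm (x - x') * KA"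
      using \<delta>2(3) NU(2) that by (intro add_mono KA(2)) blast
    also have "\<dots> \<le> (1 + KA) * norm (x - x')"
      using mult_right_mono[OF \<eta>(2), of "norm (x - x')"] by (simp add: algebra_simps)
    finally show ?thesis by (simp add: algebra_simps)
  qed
  have z_cont: "continuous_on N z"
  proof (rule lipschitz_on_continuous_on[of "2 * (1 + KA)"])
    show "(2 * (1 + KA))-lipschitz_on N z"
      using KA(1) z_lip by (intro lipschitz_onI) (auto simp: dist_norm)
  qed
  have z0: "z e0 = 0"
    using expand[OF zb[OF e0N], of 0] z(2)[OF e0N] \<Psi>0(1) \<delta>1(1) by (simp add: y_def)
  have z_der: "\<exists>z'. (z has_derivative z') (at x within N) \<and> (\<forall>v\<in>E. z' v \<in> T)" if x: "x \<in> N" for x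
  proof -
    have xU: "x \<in> U" using x NU by blast
    have l\<Psi>: "linear (\<Psi>' (z x))" using has_derivative_bounded_linear[OF \<Psi>'] by (rule bounded_linear.linear)
    obtain h where h: "bounded_linear h" "\<And>v. h (\<Psi>' (z x) v) = v"
      by (rule fin_dim_left_inverse[OF fin_dim_alg_dual l\<Psi> subspace_UNIV]) (use \<Psi>'inj[OF zb[OF x]] in auto)
    have f'N: "(f has_derivative ?f' x) (at x within N)"
      by (rule has_derivative_subset[OF f'[OF xU] NU(1)])
    have zd: "(z has_derivative (\<lambda>v. h (?f' x v))) (at x within N)"
    proof (rule left_inverse_has_derivative[where S' = UNIV and g = \<Psi> and g' = "\<Psi>' (z x)" and f = f
          and f' = "?f' x" and h = h])
      show "continuous (at x within N) z" using z_cont x by (simp add: continuous_on_eq_continuous_within)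
    qed (use \<Psi>' x f'N z(2) h in auto)
    \<comment> \<open>Images of tangential directions lie in the distribution, which is the tangent
      space of the integral manifold. Equality of dimensions turns the inclusion around, so the
      derivative of \<open>z\<close> takes values in \<open>T\<close>.\<close>
    have im: "\<Psi>' (z x) ` T = ?f' x ` E"
    proof (rule linear_image_eq_if_subset[OF fin_dim_alg_dual sE sT bounded_linear.linear[OF bA] l\<Psi> lf[OF xU]])
      show "\<Psi>' (z x) ` T \<subseteq> ?f' x ` E"
        using \<Psi>'T[of _ "z x"] unfolding tan[OF xU] z(2)[OF x] by blast
    qed (use f'inj[OF e0] f'inj[OF xU] \<Psi>'inj[OF zb[OF x]] AE in \<open>auto simp: A_def\<close>)
    have "h (?f' x v) \<in> T" if v: "v \<in> E" for v
    proof -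
      have "?f' x v \<in> \<Psi>' (z x) ` T" unfolding im using v by (rule imageI)
      then obtain t where "t \<in> T" "?f' x v = \<Psi>' (z x) t" by (rule imageE)
      then show ?thesis by (simp add: h(2))
    qed
    then show ?thesis using zd by blast
  qed
  \<comment> \<open>The transversal component of \<open>z\<close> has zero derivative on the convex
    set \<open>N\<close>, hence keeps its value 0 at \<open>e0\<close>.\<close>
  have zT: "z x \<in> T" if x: "x \<in> N" for x
  proof -
    have "((\<lambda>x. z x - P (z x)) has_derivative (\<lambda>v. 0)) (at x within N)" if x: "x \<in> N" for x
    proof -
      obtain z' where z': "(z has_derivative z') (at x within N)" "\<And>v. v \<in> E \<Longrightarrow> z' v \<in> T"
        using z_der[OF x] by blast
      show ?thesis
      proof (rule has_derivative_cong_subspace[OF sE])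
        show "((\<lambda>x. z x - P (z x)) has_derivative (\<lambda>v. z' v - P (z' v))) (at x within N)"
          by (intro has_derivative_diff z' bounded_linear.has_derivative[OF P(1)])
      qed (use x z'(2) P(3) in \<open>auto simp: N_def bounded_linear_zero\<close>)
    qed
    moreover have "convex N" unfolding N_def by (intro convex_Int convex_ball subspace_imp_convex sE)
    ultimately obtain c where "\<And>x. x \<in> N \<Longrightarrow> z x - P (z x) = c"
      using has_derivative_zero_constant[of N "\<lambda>x. z x - P (z x)"] by blast
    then have "z x - P (z x) = z e0 - P (z e0)" using x e0N by simp
    then have "z x = P (z x)" by (simp add: z0 linear_0[OF lP])
    then show ?thesis using P(2) by (metis rangeI)
  qed
  have fz: "f x = chart y (z x)" if "x \<in> N" for x
    using z(2)[OF that] P(3)[OF zT[OF that]] by (simp add: \<Psi>_def chart_def)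
  show thesis
  proof (rule that[OF N e0N NU(1)])
    have "continuous_map (top_of_set N) (top_of_set UNIV) z" using z_cont by simp
    from continuous_map_compose[OF this continuous_map_chart[of UNIV y]]
    have "continuous_map (top_of_set N) (otop y) (chart y \<circ> z)" .
    then show "continuous_map (top_of_set N) (otop (f e0)) f"
      unfolding y_def[symmetric] by (rule continuous_map_eq) (simp add: fz)
  next
    fix W assume W: "open_along E W" "e0 \<in> W" "W \<subseteq> N"
    obtain d where d: "d > 0" "ball e0 d \<inter> E \<subseteq> W" by (rule open_along_ball[OF W(1,2)])
    \<comment> \<open>\<open>J\<close> turns coordinates in \<open>T\<close> back into parameters in
      \<open>E\<close>. Near \<open>e0\<close> the composite is close to the identity, so a
      contraction shows that \<open>f\<close> covers a neighbourhood in the orbit.\<close>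
    define g where "g = (\<lambda>x. J (z x))"
    have sub: "cball e0 (d / 2) \<inter> E \<subseteq> W" using d by (auto simp: subset_iff)
    have lJ: "linear J" using J(1) by (rule bounded_linear.linear)
    have g: "norm (g x - g x' - (x - x')) \<le> 1/2 * norm (x - x')"
      if "x \<in> cball e0 (d / 2) \<inter> E" "x' \<in> cball e0 (d / 2) \<inter> E" for x x'
    proof -
      have xN: "x \<in> N" "x' \<in> N" using that sub W(3) by auto
      have xE: "x - x' \<in> E" using that sE by (auto intro: subspace_diff)
      have "z x - z x' - A (x - x') = (f x - f x' - A (x - x')) - (\<Psi> (z x) - \<Psi> (z x') - (z x - z x'))"
        by (simp add: z(2)[OF xN(1)] z(2)[OF xN(2)])
      then have "norm (z x - z x' - A (x - x')) \<le>
          norm (f x - f x' - A (x - x')) + norm (\<Psi> (z x) - \<Psi> (z x') - (z x - z x'))"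
        by (metis norm_triangle_ineq4)
      also have "\<dots> \<le> \<eta> * norm (x - x') + \<epsilon> * norm (z x - z x')"
        using \<delta>2(3) NU(2) xN by (intro add_mono \<delta>1(2) zb) blast+
      also have "\<dots> \<le> \<eta> * norm (x - x') + \<epsilon> * (2 * (1 + KA) * norm (x - x'))"
        using z_lip[OF xN] \<epsilon>(1) by (intro add_left_mono mult_left_mono) auto
      finally have 1: "norm (z x - z x' - A (x - x')) \<le> (\<eta> + \<epsilon> * (2 * (1 + KA))) * norm (x - x')"
        by (simp add: algebra_simps)
      have "g x - g x' - (x - x') = J (z x - z x' - A (x - x'))"
        using J(2)[OF xE] by (simp add: g_def linear_diff[OF lJ])
      then have "norm (g x - g x' - (x - x')) \<le> KJ * norm (z x - z x' - A (x - x'))"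
        using KJ(2) by (simp add: mult.commute)
      also have "\<dots> \<le> KJ * ((\<eta> + \<epsilon> * (2 * (1 + KA))) * norm (x - x'))"
        using 1 KJ(1) by (intro mult_left_mono) auto
      also have "\<dots> = (KJ * \<eta> + KJ * (\<epsilon> * (2 * (1 + KA)))) * norm (x - x')" by (simp add: algebra_simps)
      also have "\<dots> \<le> 1/2 * norm (x - x')"
        using \<eta>(3) \<epsilon>(3) by (intro mult_right_mono) auto
      finally show ?thesis .
    qed
    \<comment> \<open>With this radius \<open>J t\<close> stays within \<open>d / 4\<close> of
      \<open>g e0 = 0\<close>, half of the radius on which \<open>g\<close> is controlled.\<close>
    define \<rho> where "\<rho> = d / (4 * KJ)"
    have \<rho>: "\<rho> > 0" using d(1) KJ(1) by (simp add: \<rho>_def)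
    have "chart y t \<in> f ` W" if t: "t \<in> ball 0 \<rho> \<inter> T" for t
    proof -
      have "norm (J t) \<le> norm t * KJ" by (rule KJ(2))
      also have "\<dots> \<le> \<rho> * KJ" using t KJ(1) by (intro mult_right_mono) auto
      also have "\<dots> = d / 2 / 2" using KJ(1) by (simp add: \<rho>_def)
      finally have le: "norm (J t - g e0) \<le> d / 2 / 2" by (simp add: g_def z0 linear_0[OF lJ])
      have e0E: "e0 \<in> E" using e0N by (simp add: N_def)
      obtain x where x: "x \<in> cball e0 (d / 2) \<inter> E" "g x = J t"
      proof (rule near_identity_surjective[OF sE fin_dim_closed_subspace[OF fin_dim_alg_dual sE] e0E _ _ g _ le])
        show "d / 2 > 0" using d(1) by simp
        show "g x \<in> E" for x using J(3) by (auto simp: g_def)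
        show "J t \<in> E" using J(3) by auto
      qed
      have xN: "x \<in> N" using x(1) sub W(3) by blast
      have AJ: "A (J s) = s" if "s \<in> T" for s using that J(2) unfolding AE[symmetric] by auto
      have "z x = A (J (z x))" using AJ[OF zT[OF xN]] by simp
      also have "\<dots> = t" using x(2) AJ[of t] t by (simp add: g_def)
      finally have "f x = chart y t" using fz[OF xN] by simp
      then show ?thesis using x(1) sub by (metis image_eqI subsetD)
    qed
    then have "chart y ` (ball 0 \<rho> \<inter> T) \<subseteq> f ` W" by blast
    moreover have "openin (otop y) (chart y ` (ball 0 \<rho> \<inter> T))"
      using open_along_ball_Int[OF sT, of 0 \<rho>] by (intro openin_chart_image) (simp add: open_along_def T_def)
    moreover have "y \<in> chart y ` (ball 0 \<rho> \<inter> T)"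
      using \<rho> subspace_0[OF sT] chart_zero[of y] by (intro image_eqI[of _ _ 0]) auto
    ultimately show "\<exists>S. openin (otop (f e0)) S \<and> f e0 \<in> S \<and> S \<subseteq> f ` W"
      unfolding y_def[symmetric] by blast
  qed
qed

section \<open>Comparison of topologies and maximality of the orbits\<close>

text \<open>Images of small parameter domains contain open pieces of the orbit, which gives the
  first comparison; continuity of the parametrization into the orbit topology gives the
  second.\<close>

lemma integral_manifold_local:
  assumes \<sigma>: "integral_manifold (image_distribution alg_bivector) \<sigma>" and y: "y \<in> topspace \<sigma>"
  shows "openin \<sigma> S \<Longrightarrow> y \<in> S \<Longrightarrow> \<exists>N. openin (otop y) N \<and> y \<in> N \<and> N \<subseteq> S"
    and "openin (otop y) S \<Longrightarrow> y \<in> S \<Longrightarrow> \<exists>N. openin \<sigma> N \<and> y \<in> N \<and> N \<subseteq> S"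
proof -
  obtain E U f e0 where p: "parametrization \<sigma> E U f" and e0: "e0 \<in> U" "f e0 = y"
    using \<sigma> y unfolding integral_manifold_def immersed_submanifold_def by (metis image_iff)
  have op: "openin \<sigma> (f ` U)" and hom: "homeomorphic_map (top_of_set U) (subtopology \<sigma> (f ` U)) f"
    using p by (auto simp: parametrization_def)
  have tan: "frechet_derivative f (at x within U) ` E = tang (f x)" if "x \<in> U" for x
  proof -
    have "f x \<in> topspace \<sigma>" using openin_subset[OF op] that by blast
    then show ?thesis
      using \<sigma> tangent_parametrization[OF fin_dim_alg_dual p that]
      by (simp add: integral_manifold_def image_distribution_alg)
  qed
  have "\<exists>U'. open_along E U' \<and> e0 \<in> U' \<and> U' \<subseteq> U \<and> continuous_map (top_of_set U') (otop y) f \<and>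
    (\<forall>W. open_along E W \<longrightarrow> e0 \<in> W \<longrightarrow> W \<subseteq> U' \<longrightarrow> (\<exists>S. openin (otop y) S \<and> y \<in> S \<and> S \<subseteq> f ` W))"
    by (rule integral_manifold_chart[OF p tan e0(1), unfolded e0(2)]) (assumption, blast)
  then obtain U' where U': "open_along E U'" "e0 \<in> U'" "U' \<subseteq> U" "continuous_map (top_of_set U') (otop y) f"
    "\<And>W. open_along E W \<Longrightarrow> e0 \<in> W \<Longrightarrow> W \<subseteq> U' \<Longrightarrow> \<exists>S. openin (otop y) S \<and> y \<in> S \<and> S \<subseteq> f ` W"
    by blast
  have open_trans: "open_along E W" if "openin (top_of_set U') W" for W
    using that U'(1) openin_trans unfolding open_along_def by blast
  show "\<exists>N. openin (otop y) N \<and> y \<in> N \<and> N \<subseteq> S" if S: "openin \<sigma> S" "y \<in> S"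
  proof -
    have "continuous_map (top_of_set U') \<sigma> f"
      using parametrization_continuous_map[OF p] U'(3) by (metis continuous_map_from_subtopology_mono)
    from openin_continuous_map_preimage[OF this S(1)]
    have "open_along E {x \<in> U'. f x \<in> S}" by (intro open_trans) simp
    from U'(5)[OF this] show ?thesis using U'(2) e0(2) S(2) by blast
  qed
  show "\<exists>N. openin \<sigma> N \<and> y \<in> N \<and> N \<subseteq> S" if S: "openin (otop y) S" "y \<in> S"
  proof -
    let ?W = "{x \<in> U'. f x \<in> S}"
    have "open_along E ?W" using openin_continuous_map_preimage[OF U'(4) S(1)] by (intro open_trans) simp
    then have "openin (top_of_set E) ?W" by (simp add: open_along_def)
    moreover have "U \<subseteq> E" by (rule open_along_subset[OF parametrization_open_along[OF p]])
    moreover have "?W \<subseteq> U" using U'(3) by auto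
    ultimately have "openin (top_of_set U) ?W" by (meson openin_subset_trans)
    then have "openin (subtopology \<sigma> (f ` U)) (f ` ?W)"
      using homeomorphic_imp_open_map[OF hom] by (simp add: open_map_def)
    then have "openin \<sigma> (f ` ?W)" using op openin_open_subtopology by blast
    then show ?thesis using U'(2) e0(2) S(2) by (intro exI[of _ "f ` ?W"]) auto
  qed
qed

text \<open>Orbits cut the integral manifold into sets that are open in it, so connectedness
  confines it to the one it meets; the local comparison then identifies the topologies.\<close>

lemma integral_manifold_subset_orbit:
  assumes \<sigma>: "integral_manifold (image_distribution alg_bivector) \<sigma>"
    and meet: "topspace \<sigma> \<inter> topspace (otop \<mu>) \<noteq> {}"
  shows "openin (otop \<mu>) (topspace \<sigma>) \<and> \<sigma> = subtopology (otop \<mu>) (topspace \<sigma>)"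
proof -
  have orb_open: "\<exists>N. openin \<sigma> N \<and> y \<in> N \<and> N \<subseteq> orb y" if "y \<in> topspace \<sigma>" for y
    using integral_manifold_local(2)[OF \<sigma> that, of "orb y"] orb_refl[of y] openin_topspace[of "otop y"]
    by (simp add: topspace_otop)
  have disj: "orb y \<inter> orb \<mu> = {}" if "y \<notin> orb \<mu>" for y
    using that orb_eq orb_refl by blast
  have 1: "openin \<sigma> (topspace \<sigma> \<inter> orb \<mu>)"
  proof (subst openin_subopen, intro ballI)
    fix y assume y: "y \<in> topspace \<sigma> \<inter> orb \<mu>"
    then obtain N where "openin \<sigma> N" "y \<in> N" "N \<subseteq> orb y" using orb_open by blast
    then show "\<exists>N. openin \<sigma> N \<and> y \<in> N \<and> N \<subseteq> topspace \<sigma> \<inter> orb \<mu>"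
      using y orb_eq[of y \<mu>] openin_subset[of \<sigma> N] by blast
  qed
  have 2: "openin \<sigma> (topspace \<sigma> - orb \<mu>)"
  proof (subst openin_subopen, intro ballI)
    fix y assume y: "y \<in> topspace \<sigma> - orb \<mu>"
    then obtain N where "openin \<sigma> N" "y \<in> N" "N \<subseteq> orb y" using orb_open by blast
    then show "\<exists>N. openin \<sigma> N \<and> y \<in> N \<and> N \<subseteq> topspace \<sigma> - orb \<mu>"
      using y disj[of y] openin_subset[of \<sigma> N] by blast
  qed
  have "connected_space \<sigma>" using \<sigma> by (simp add: integral_manifold_def)
  then have "topspace \<sigma> - orb \<mu> = {}"
    using 1 2 meet unfolding connected_space_def topspace_otop by blast
  then have sub: "topspace \<sigma> \<subseteq> orb \<mu>" by blast
  have eq: "otop y = otop \<mu>" if "y \<in> topspace \<sigma>" for y using otop_eq sub that by blast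
  have fwd: "openin (otop \<mu>) S" if S: "openin \<sigma> S" for S
  proof (subst openin_subopen, intro ballI)
    fix y assume y: "y \<in> S"
    then have "y \<in> topspace \<sigma>" using openin_subset[OF S] by blast
    then show "\<exists>N. openin (otop \<mu>) N \<and> y \<in> N \<and> N \<subseteq> S"
      using integral_manifold_local(1)[OF \<sigma> _ S y] eq by simp
  qed
  have bwd: "openin \<sigma> S" if S: "openin (otop \<mu>) S" "S \<subseteq> topspace \<sigma>" for S
  proof (subst openin_subopen, intro ballI)
    fix y assume y: "y \<in> S"
    then have y': "y \<in> topspace \<sigma>" using S(2) by blast
    then show "\<exists>N. openin \<sigma> N \<and> y \<in> N \<and> N \<subseteq> S"
      using integral_manifold_local(2)[OF \<sigma> y' _ y] eq S(1) by simp
  qed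
  have op: "openin (otop \<mu>) (topspace \<sigma>)" by (rule fwd) simp
  moreover have "\<sigma> = subtopology (otop \<mu>) (topspace \<sigma>)"
    unfolding topology_eq openin_open_subtopology[OF op] using fwd bwd openin_subset by blast
  ultimately show ?thesis ..
qed

lemma leaf_otop: "leaf (image_distribution alg_bivector) (otop \<mu>)"
  unfolding leaf_def using integral_manifold_otop integral_manifold_subset_orbit by blast

text \<open>A given leaf meets the orbit of each of its points. Its maximality puts the orbit inside
  it, the orbit's maximality gives the reverse inclusion, and then the topologies coincide.\<close>

lemma leaves_alg: "{\<tau>. leaf (image_distribution alg_bivector) \<tau>} = range otop"
proof
  show "range otop \<subseteq> {\<tau>. leaf (image_distribution alg_bivector) \<tau>}"
    using leaf_otop by blast
  show "{\<tau>. leaf (image_distribution alg_bivector) \<tau>} \<subseteq> range otop"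
  proof
    fix \<tau> :: "'a dual topology" assume "\<tau> \<in> {\<tau>. leaf (image_distribution alg_bivector) \<tau>}"
    then have \<tau>: "leaf (image_distribution alg_bivector) \<tau>" by simp
    then have i: "integral_manifold (image_distribution alg_bivector) \<tau>" by (simp add: leaf_def)
    then obtain x where x: "x \<in> topspace \<tau>" unfolding integral_manifold_def by blast
    have meet: "topspace (otop x) \<inter> topspace \<tau> \<noteq> {}" using x orb_refl[of x] by (auto simp: topspace_otop)
    have 1: "openin \<tau> (topspace (otop x))" "otop x = subtopology \<tau> (topspace (otop x))"
      using \<tau> integral_manifold_otop meet unfolding leaf_def by blast+
    have "openin (otop x) (topspace \<tau>)"
      using integral_manifold_subset_orbit[OF i, of x] meet by (simp add: Int_commute)
    then have "topspace \<tau> = topspace (otop x)"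
      using openin_subset 1(1) by (metis subset_antisym)
    then have "otop x = \<tau>" using 1(2) by (metis subtopology_topspace)
    then show "\<tau> \<in> range otop" by blast
  qed
qed

end

theorem theorem7p1:
  fixes h :: "'a::{real_normed_vector, real_algebra, comm_ring} bivector"
  assumes fin_dim: "\<exists>B :: 'a set. finite B \<and> span B = UNIV"
    and h_def: "h = alg_bivector"
  shows
    "generalized_pseudo_Hessian nabla0 h \<and>
     smooth_linear_action (Phi :: 'a \<Rightarrow> 'a dual \<Rightarrow> 'a dual) \<and>
     {\<tau>. leaf (image_distribution h) \<tau>} = range (orbit_topology (Phi :: 'a \<Rightarrow> 'a dual \<Rightarrow> 'a dual)) \<and>
     (generalized_affine_special_real nabla0 h \<longleftrightarrow> (\<forall>u v w x :: 'a. u * v * w * x = 0)) \<and>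
     (\<forall>\<mu> :: 'a dual. let \<tau> = orbit_topology Phi \<mu> in
        topspace \<tau> = orbit Phi \<mu> \<and>
        induced_connection nabla0 \<tau> (nabla0_on \<tau>) \<and>
        pseudo_Hessian_manifold \<tau> (nabla0_on \<tau>) (leaf_metric h)) \<and>
     ((\<forall>u v w x :: 'a. u * v * w * x = 0) \<longrightarrow>
        (\<forall>\<mu> :: 'a dual. let \<tau> = orbit_topology Phi \<mu> in
           affine_special_real_manifold \<tau> (nabla0_on \<tau>) (leaf_metric h)))"
proof -
  interpret fd_comm_algebra "TYPE('a)"
  proof
    show "fin_dim (UNIV :: 'a set)" using fin_dim unfolding fin_dim_def by (metis order_refl)
  qed
  show ?thesis
    unfolding h_def Let_def
    by (intro conjI allI impI generalized_pseudo_Hessian_alg smooth_linear_action_Phi leaves_alg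
        generalized_affine_special_real_alg_iff topspace_otop induced_connection_otop
        pseudo_Hessian_manifold_otop affine_special_real_manifold_otop) simp
qed

end
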